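(* Given an $n$-node graph $G$ with an unknown girth $g$, there exists a randomized algorithm in the CONGEST model running in $O(\min\{g\cdot n^{1-1/\Theta(g)},n\})$ rounds which outputs $g$, in the sense that the first node that halts outputs the girth $g$.
   Context: The girth of a graph is the length of its shortest cycle. CONGEST model: the input graph $G$ with $n$ nodes is also the communication network; computation proceeds in synchronous rounds, and in each round each node may send a message of $O(\log n)$ bits to each of its neighbors in $G$. Initially each node knows its incident edges. *)

theory Defs
  imports "HOL-Probability.Probability" "HOL-Probability.Product_PMF"
    "HOL-Library.Extended_Nat" "HOL-Library.Landau_Symbols"
begin

section \<open>Graphs and girth\<close>

definition simple_graph :: "nat set \<Rightarrow> nat set set \<Rightarrow> bool" where
  "simple_graph V E \<longleftrightarrow>
     finite V \<and> (\<forall>e\<in>E. \<exists>u v. u \<in> V \<and> v \<in> V \<and> u \<noteq> v \<and> e = {u, v})"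

definition neighbours :: "nat set set \<Rightarrow> nat \<Rightarrow> nat set" where
  "neighbours E v = {u. {u, v} \<in> E}"

definition is_cycle :: "nat set set \<Rightarrow> nat list \<Rightarrow> bool" where
  "is_cycle E p \<longleftrightarrow> length p \<ge> 3 \<and> distinct p \<and>
     (\<forall>i<length p. {p ! i, p ! (Suc i mod length p)} \<in> E)"

text \<open>Acyclic graphs have girth \<open>\<infinity>\<close>, the infimum of the empty set.\<close>

definition girth :: "nat set set \<Rightarrow> enat" where
  "girth E = Inf {enat (length p) | p. is_cycle E p}"

section \<open>Randomized algorithms in the CONGEST model\<close>

type_synonym message = "bool list"

text \<open>
  The program run by every node, with local states in \<open>'s\<close>. Taking \<open>'s = nat\<close> loses no
  generality, since a node's memory always holds one of countably many bit strings. Local computation is unbounded,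
  and every local step may use fresh private randomness.
  \<^item> \<open>init v N\<close>: distribution of the initial state of the node with identifier \<open>v\<close> and
    set of neighbour identifiers \<open>N\<close>;
  \<^item> \<open>send s u\<close>: message sent in state \<open>s\<close> to the neighbour \<open>u\<close> (\<open>[]\<close> stands for silence);
  \<^item> \<open>recv s m\<close>: distribution of the next state after receiving \<open>m u\<close> from each neighbour \<open>u\<close>;
  \<^item> \<open>result s\<close>: \<open>Some x\<close> if a node in state \<open>s\<close> has halted with output \<open>x\<close>.
\<close>

record 's program =
  init :: "nat \<Rightarrow> nat set \<Rightarrow> 's pmf"
  send :: "'s \<Rightarrow> nat \<Rightarrow> message"
  recv :: "'s \<Rightarrow> (nat \<Rightarrow> message) \<Rightarrow> 's pmf"
  result :: "'s \<Rightarrow> enat option"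

text \<open>
  An algorithm is a family of programs indexed by the number \<open>n\<close> of nodes, which expresses
  that the nodes know \<open>n\<close> (and nothing else about the graph beyond their incident edges).
\<close>

definition has_bandwidth :: "(nat \<Rightarrow> 's program) \<Rightarrow> (nat \<Rightarrow> nat) \<Rightarrow> bool" where
  "has_bandwidth A B \<longleftrightarrow> (\<forall>n s u. length (send (A n) s u) \<le> B n)"

definition congest_algorithm :: "(nat \<Rightarrow> 's program) \<Rightarrow> bool" where
  "congest_algorithm A \<longleftrightarrow>
     (\<exists>B. has_bandwidth A B \<and> (\<lambda>n. real (B n)) \<in> O(\<lambda>n. ln (real n)))"

definition inbox :: "'s program \<Rightarrow> nat set set \<Rightarrow> (nat \<Rightarrow> 's) \<Rightarrow> nat \<Rightarrow> nat \<Rightarrow> message" where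
  "inbox P E \<sigma> v = (\<lambda>u.
     if u \<in> neighbours E v \<and> result P (\<sigma> u) = None then send P (\<sigma> u) v else [])"

text \<open>
  A configuration maps each node to its local state. The random choices of distinct nodes are
  independent; halted nodes keep their state and are silent.
\<close>

definition initial_config :: "'s program \<Rightarrow> nat set \<Rightarrow> nat set set \<Rightarrow> (nat \<Rightarrow> 's) pmf" where
  "initial_config P V E = Pi_pmf V undefined (\<lambda>v. init P v (neighbours E v))"

definition round_step ::
  "'s program \<Rightarrow> nat set \<Rightarrow> nat set set \<Rightarrow> (nat \<Rightarrow> 's) \<Rightarrow> (nat \<Rightarrow> 's) pmf" where
  "round_step P V E \<sigma> = Pi_pmf V undefined (\<lambda>v.
     if result P (\<sigma> v) = None then recv P (\<sigma> v) (inbox P E \<sigma> v) else return_pmf (\<sigma> v))"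

text \<open>
  The random execution of \<open>T\<close> rounds: a list of \<open>T + 1\<close> configurations whose entry at
  position \<open>t\<close> is the configuration after \<open>t\<close> rounds.
\<close>

primrec execution ::
  "'s program \<Rightarrow> nat set \<Rightarrow> nat set set \<Rightarrow> nat \<Rightarrow> (nat \<Rightarrow> 's) list pmf" where
  "execution P V E 0 = map_pmf (\<lambda>\<sigma>. [\<sigma>]) (initial_config P V E)"
| "execution P V E (Suc T) = bind_pmf (execution P V E T)
     (\<lambda>\<sigma>s. map_pmf (\<lambda>\<sigma>. \<sigma>s @ [\<sigma>]) (round_step P V E (last \<sigma>s)))"

text \<open>
  Some node halts during the given execution, and every node that halts in the earliest round
  in which a node halts outputs \<open>x\<close>.
\<close>

definition first_halting_outputs ::
  "'s program \<Rightarrow> nat set \<Rightarrow> (nat \<Rightarrow> 's) list \<Rightarrow> enat \<Rightarrow> bool" where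
  "first_halting_outputs P V \<sigma>s x \<longleftrightarrow>
     (\<exists>t<length \<sigma>s.
        (\<forall>s<t. \<forall>v\<in>V. result P ((\<sigma>s ! s) v) = None) \<and>
        (\<exists>v\<in>V. result P ((\<sigma>s ! t) v) \<noteq> None) \<and>
        (\<forall>v\<in>V. result P ((\<sigma>s ! t) v) \<noteq> None \<longrightarrow> result P ((\<sigma>s ! t) v) = Some x))"

section \<open>The round complexity\<close>

text \<open>
  \<open>min {g n^(1 - 1/\<theta>(g)), n}\<close>; for \<open>g = \<infinity>\<close> the minimum is \<open>n\<close>.
\<close>

definition girth_rounds :: "(nat \<Rightarrow> real) \<Rightarrow> nat \<Rightarrow> enat \<Rightarrow> real" where
  "girth_rounds \<theta> n g = (case g of
     enat k \<Rightarrow> min (real k * real n powr (1 - 1 / \<theta> k)) (real n)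
   | \<infinity> \<Rightarrow> real n)"

text \<open>
  \<open>\<Theta>\<close> in the library only constrains large arguments; positivity at every possible finite
  girth excludes the degenerate values \<open>1 / 0 = 0\<close> and negative exponents \<open>1/\<theta>(g)\<close>, and
  makes \<open>\<theta>\<close> bounded above and below by constant multiples of \<open>g\<close> for all \<open>g \<ge> 3\<close>.
\<close>

definition linear_order_of_growth :: "(nat \<Rightarrow> real) \<Rightarrow> bool" where
  "linear_order_of_growth \<theta> \<longleftrightarrow> \<theta> \<in> \<Theta>(\<lambda>g. real g) \<and> (\<forall>g\<ge>3. \<theta> g > 0)"

end

theory Submission imports Defs begin

text \<open>
  For \<open>k = 3, 4, \<dots>\<close> a stage looks for cycles of length \<open>k\<close>, knowing that there is none
  shorter; as soon as the stages would take too long, a final phase computes the girth in \<open>O(n)\<close>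
  rounds. Everything rests on one fact: two distinct non-backtracking walks with the same ends
  enclose a cycle that is no longer than their total length. So a node that learns of such walks
  from one source through two different neighbours has found a cycle, and while there is no cycle of
  length at most \<open>2l\<close>, non-backtracking walks of length at most \<open>l\<close> are determined by their ends,
  which bounds the number of tokens that have to be forwarded.

  Let \<open>l = (k - 1) div 2\<close>. Every node joins a random set \<open>X\<close> with probability \<open>n\<close> to the power
  \<open>-\<Theta>(1/k)\<close>. A \<open>k\<close>-cycle through \<open>X\<close> is found by walks of length \<open>l\<close> from \<open>X\<close>, and one whose nodes
  all have small degree by walks of length \<open>l\<close> through nodes of small degree. Otherwise some node \<open>v\<close>
  of the cycle has large degree, hence neighbours in \<open>X\<close>, whose tokens carry the name of \<open>v\<close> as
  first hop. A node \<open>y\<close> at distance \<open>l\<close> from \<open>v\<close> tells its neighbour \<open>x\<close> about \<open>v\<close> unless some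
  neighbour of \<open>v\<close> in \<open>X\<close> other than the one towards \<open>y\<close> has reached \<open>x\<close> within \<open>l\<close> steps: if \<open>v\<close>,
  \<open>y\<close> and \<open>x\<close> lie on a \<open>k\<close>-cycle, that neighbour lies on a \<open>k\<close>-cycle as well. For a fixed \<open>x\<close>, the
  random choice of \<open>X\<close> leaves few \<open>y\<close> for each \<open>v\<close>, so the list of \<open>y\<close> is too long for few
  neighbours \<open>y\<close> only. For even \<open>k\<close> no list on the cycle is too long. For odd \<open>k\<close>, if the lists in
  both directions along the edge opposite to \<open>v\<close> are too long, then \<open>x\<close> has large degree and sends
  the names of its few overflowing neighbours around the cycle to \<open>v\<close>, where they close the cycle.

  In the final phase every node repeatedly forwards the lexicographically least pair of a distance
  and a source that it has not sent yet, which delivers all distances within \<open>2n\<close> rounds.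
\<close>

section \<open>Reduced walks and short cycles\<close>

definition loopfree :: "nat set set \<Rightarrow> bool" where
  "loopfree E \<longleftrightarrow> (\<forall>x. {x} \<notin> E)"

text \<open>Reduced (non-backtracking) walks. In a loop-free graph, unlike an arbitrary walk, a
  closed one with at least one edge contains a cycle.\<close>

fun rwalk :: "nat set set \<Rightarrow> nat list \<Rightarrow> bool" where
  "rwalk E [] \<longleftrightarrow> False"
| "rwalk E [x] \<longleftrightarrow> True"
| "rwalk E [x, y] \<longleftrightarrow> {x, y} \<in> E"
| "rwalk E (x # y # z # p) \<longleftrightarrow> {x, y} \<in> E \<and> x \<noteq> z \<and> rwalk E (y # z # p)"

lemma rwalk_iff_nth:
  "rwalk E p \<longleftrightarrow> p \<noteq> [] \<and> (\<forall>i. Suc i < length p \<longrightarrow> {p ! i, p ! Suc i} \<in> E) \<and>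
     (\<forall>i. Suc (Suc i) < length p \<longrightarrow> p ! i \<noteq> p ! Suc (Suc i))"
proof (induction E p rule: rwalk.induct)
  case (4 E x y z p)
  have ex: "(\<forall>i. P i) \<longleftrightarrow> P 0 \<and> (\<forall>i. P (Suc i))" for P :: "nat \<Rightarrow> bool"
    by (metis not0_implies_Suc)
  let ?q = "x # y # z # p"
  have "(\<forall>i. Suc i < length ?q \<longrightarrow> {?q ! i, ?q ! Suc i} \<in> E) \<longleftrightarrow>
    {x, y} \<in> E \<and> (\<forall>i. Suc i < length (y # z # p) \<longrightarrow> {(y # z # p) ! i, (y # z # p) ! Suc i} \<in> E)"
    by (subst ex) simp
  moreover have "(\<forall>i. Suc (Suc i) < length ?q \<longrightarrow> ?q ! i \<noteq> ?q ! Suc (Suc i)) \<longleftrightarrow>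
    x \<noteq> z \<and> (\<forall>i. Suc (Suc i) < length (y # z # p) \<longrightarrow> (y # z # p) ! i \<noteq> (y # z # p) ! Suc (Suc i))"
    by (subst ex) simp
  ultimately show ?case unfolding rwalk.simps 4 by blast
qed auto

lemma rwalk_Cons: "rwalk E (x # y # p) \<longleftrightarrow> {x, y} \<in> E \<and> (p = [] \<or> x \<noteq> hd p) \<and> rwalk E (y # p)"
  by (cases p) auto

lemma rwalk_edge: "rwalk E (x # y # p) \<Longrightarrow> {x, y} \<in> E"
  by (simp add: rwalk_Cons)

lemma rwalk_tl: "rwalk E (x # y # p) \<Longrightarrow> rwalk E (y # p)"
  by (simp add: rwalk_Cons)

lemma rwalk_snoc:
  "rwalk E (p @ [x, y]) \<longleftrightarrow> rwalk E (p @ [x]) \<and> {x, y} \<in> E \<and> (p = [] \<or> last p \<noteq> y)"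
  by (induction p rule: induct_list012) (auto simp: rwalk_Cons hd_append)

lemma rwalk_rev [simp]: "rwalk E (rev p) \<longleftrightarrow> rwalk E p"
  by (induction p rule: induct_list012) (auto simp: rwalk_snoc rwalk_Cons insert_commute last_rev)

lemma rwalk_take: "rwalk E p \<Longrightarrow> 0 < m \<Longrightarrow> rwalk E (take m p)"
  by (auto simp: rwalk_iff_nth)

text \<open>Only the triple centred at \<open>x\<close> is new.\<close>

lemma rwalk_join:
  "rwalk E (p @ [x]) \<Longrightarrow> rwalk E (x # q) \<Longrightarrow> p = [] \<or> q = [] \<or> last p \<noteq> hd q \<Longrightarrow> rwalk E (p @ x # q)"
  by (induction p rule: induct_list012) (auto simp: rwalk_Cons hd_append split: if_splits)

lemma is_cycle_girth: "is_cycle E p \<Longrightarrow> girth E \<le> enat (length p)"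
  unfolding girth_def by (rule Inf_lower) auto

lemma girth_cycle:
  assumes "girth E = enat g" obtains p where "is_cycle E p" "length p = g"
proof -
  let ?S = "{enat (length p) | p. is_cycle E p}"
  have "?S \<noteq> {}" using assms unfolding girth_def by (auto simp: Inf_enat_def split: if_splits)
  hence "Inf ?S \<in> ?S" unfolding Inf_enat_def by (auto intro: LeastI)
  thus ?thesis using assms that unfolding girth_def by auto
qed

text \<open>A repetition at the least possible distance encloses no other repetition. Distance 1
  would be a loop and distance 2 a backtrack, so the enclosed vertices form a cycle.\<close>

lemma repeated_vertex_cycle:
  assumes lf: "loopfree E" and p: "rwalk E p" and ij: "i < j" "j < length p" "p ! i = p ! j"
  obtains a b where "a < b" "b < length p" "b - a \<le> j - i" "p ! a = p ! b"
    "is_cycle E (map (\<lambda>x. p ! x) [a..<b])"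
proof -
  let ?P = "\<lambda>d. \<exists>a b. a < b \<and> b < length p \<and> p ! a = p ! b \<and> b - a = d"
  define d where "d = (LEAST d. ?P d)"
  have ex: "?P (j - i)" using ij by auto
  have "?P d" unfolding d_def by (rule LeastI[of ?P, OF ex])
  then obtain a b where ab: "a < b" "b < length p" "p ! a = p ! b" "b - a = d" by auto
  have least: "d \<le> b' - a'" if "a' < b'" "b' < length p" "p ! a' = p ! b'" for a' b'
    unfolding d_def by (rule Least_le) (use that in auto)
  have E: "{p ! x, p ! Suc x} \<in> E" if "Suc x < length p" for x
    using p that by (simp add: rwalk_iff_nth)
  have "b \<noteq> Suc a" using E[of a] ab lf by (auto simp: loopfree_def)
  moreover have "b \<noteq> Suc (Suc a)" using p ab by (auto simp: rwalk_iff_nth)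
  ultimately have d3: "d \<ge> 3" using ab by linarith
  have "is_cycle E (map (\<lambda>x. p ! x) [a..<b])"
    unfolding is_cycle_def
  proof (intro conjI allI impI)
    show "3 \<le> length (map ((!) p) [a..<b])" using d3 ab by simp
    have "x = y" if "a \<le> x" "x < b" "a \<le> y" "y < b" "p ! x = p ! y" for x y
    proof (rule ccontr)
      assume "x \<noteq> y"
      hence "d \<le> max x y - min x y"
        using that ab by (intro least) (auto simp: max_def min_def)
      thus False using that ab by (auto simp: max_def min_def split: if_splits)
    qed
    thus "distinct (map ((!) p) [a..<b])" by (auto simp: distinct_map inj_on_def)
  next
    fix i assume "i < length (map ((!) p) [a..<b])"
    hence i: "i < d" using ab by simp
    show "{map ((!) p) [a..<b] ! i, map ((!) p) [a..<b] ! (Suc i mod length (map ((!) p) [a..<b]))} \<in> E"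
    proof (cases "Suc i = d")
      case True
      have "{p ! (a + i), p ! Suc (a + i)} \<in> E" using E[of "a + i"] ab True by simp
      moreover have "Suc (a + i) = b" using True ab by simp
      ultimately show ?thesis using True ab by (auto simp: insert_commute)
    next
      case False
      thus ?thesis using i ab E[of "a + i"] by auto
    qed
  qed
  moreover have "b - a \<le> j - i" using least[OF ij] ab by simp
  ultimately show ?thesis using ab that by blast
qed

lemma repeated_vertex_girth:
  assumes "loopfree E" "rwalk E p" "i < j" "j < length p" "p ! i = p ! j"
  shows "girth E \<le> enat (j - i)"
proof -
  obtain a b where ab: "a < b" "b - a \<le> j - i" "is_cycle E (map (\<lambda>x. p ! x) [a..<b])"
    using repeated_vertex_cycle[OF assms] by metis
  have "girth E \<le> enat (b - a)" using is_cycle_girth[OF ab(3)] by simp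
  also have "\<dots> \<le> enat (j - i)" using ab by simp
  finally show ?thesis .
qed

lemma closed_rwalk_girth:
  assumes "loopfree E" "rwalk E p" "length p \<ge> 2" "hd p = last p"
  shows "girth E \<le> enat (length p - 1)"
proof -
  have "p \<noteq> []" using assms(3) by auto
  thus ?thesis
    using repeated_vertex_girth[OF assms(1,2), of 0 "length p - 1"] assms
    by (auto simp: hd_conv_nth last_conv_nth)
qed

text \<open>The cycle found inside is at least as long as the girth, so it is the whole
  walk.\<close>

lemma short_closed_rwalk_is_cycle:
  assumes "loopfree E" "rwalk E p" "length p \<ge> 2" "hd p = last p" "enat (length p - 1) \<le> girth E"
  shows "is_cycle E (butlast p)"
proof -
  have ne: "p \<noteq> []" using assms(3) by auto
  obtain a b where ab: "a < b" "b < length p" "b - a \<le> length p - 1 - 0" "p ! a = p ! b"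
    "is_cycle E (map (\<lambda>x. p ! x) [a..<b])"
    using repeated_vertex_cycle[OF assms(1,2), of 0 "length p - 1"] assms ne
    by (auto simp: hd_conv_nth last_conv_nth)
  have "girth E \<le> enat (b - a)" using is_cycle_girth[OF ab(5)] by simp
  hence "length p - 1 \<le> b - a" using assms(5) by (meson enat_ord_simps(1) order_trans)
  hence "a = 0" "b = length p - 1" using ab by auto
  moreover have "map (\<lambda>x. p ! x) [0..<length p - 1] = butlast p"
    by (rule nth_equalityI) (auto simp: nth_butlast)
  ultimately show ?thesis using ab by simp
qed

text \<open>Common initial edges are peeled off. Once the walks diverge, one reversed and followed
  by the other is a closed reduced walk; if one of them ends there, the other is closed by
  itself.\<close>

lemma rwalk_unique:
  assumes lf: "loopfree E"
  shows "rwalk E p \<Longrightarrow> rwalk E q \<Longrightarrow> hd p = hd q \<Longrightarrow> last p = last q \<Longrightarrow> p \<noteq> q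
    \<Longrightarrow> girth E \<le> enat (length p + length q - 2)"
proof (induction p arbitrary: q)
  case Nil thus ?case by simp
next
  case (Cons x p q0)
  obtain q where q: "q0 = x # q" using Cons.prems(2,3) by (cases q0) auto
  have w: "rwalk E (x # p)" "rwalk E (x # q)" "last (x # p) = last (x # q)" "p \<noteq> q"
    using Cons.prems q by auto
  have "girth E \<le> enat (length p + length q)"
  proof (cases p)
    case p: Nil
    have "q \<noteq> []" using w p by auto
    hence "girth E \<le> enat (length (x # q) - 1)"
      by (intro closed_rwalk_girth[OF lf w(2)]) (use w(3) p in \<open>auto simp: Suc_le_eq\<close>)
    thus ?thesis using p by simp
  next
    case p: (Cons y p2)
    show ?thesis
    proof (cases q)
      case q: Nil
      have "girth E \<le> enat (length (x # p) - 1)"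
        by (intro closed_rwalk_girth[OF lf w(1)]) (use w(3) p q in auto)
      thus ?thesis using q by simp
    next
      case q: (Cons z q2)
      show ?thesis
      proof (cases "y = z")
        case True
        have "rwalk E p" "rwalk E q" "hd p = hd q" "last p = last q"
          using w p q True by (auto simp: rwalk_Cons)
        hence "girth E \<le> enat (length p + length q - 2)" using Cons.IH w(4) by blast
        also have "\<dots> \<le> enat (length p + length q)" by simp
        finally show ?thesis .
      next
        case False
        \<comment> \<open>Turning at \<open>x\<close> is no backtrack because \<open>y\<close> and
          \<open>z\<close> differ; at the common end a backtrack would do no harm, as
          \<open>rwalk\<close> does not look across the ends of a list.\<close>
        have "rwalk E (rev (x # p))" using w(1) by (simp only: rwalk_rev)
        hence 1: "rwalk E (rev p @ [x])" by simp
        have 2: "rwalk E (rev p @ x # q)"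
          by (rule rwalk_join[OF 1 w(2)]) (use p q False in \<open>simp add: last_rev\<close>)
        have 3: "hd (rev p @ x # q) = last (rev p @ x # q)"
          using w(3) p q by (auto simp: hd_append hd_rev split: if_splits)
        have "girth E \<le> enat (length (rev p @ x # q) - 1)"
          by (rule closed_rwalk_girth[OF lf 2 _ 3]) (use p in simp)
        thus ?thesis by simp
      qed
    qed
  qed
  thus ?case using q by simp
qed

lemma rwalk_unique':
  assumes "loopfree E" "rwalk E p" "rwalk E q" "hd p = hd q" "last p = last q"
    "enat (length p + length q - 2) < girth E"
  shows "p = q"
  using rwalk_unique[OF assms(1-5)] assms(6) by (meson leD)

section \<open>Cycles as periodic sequences\<close>

text \<open>Indexing by all integers turns rotation and reversal into substitutions, so that any
  vertex and either direction can be taken as the standard one.\<close>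

definition cyc :: "nat set set \<Rightarrow> nat \<Rightarrow> (int \<Rightarrow> nat) \<Rightarrow> bool" where
  "cyc E g c \<longleftrightarrow> g \<ge> 3 \<and> (\<forall>i. {c i, c (i + 1)} \<in> E) \<and> (\<forall>i j. c i = c j \<longleftrightarrow> i mod int g = j mod int g)"

lemma cyc_shift:
  assumes "cyc E g c" shows "cyc E g (\<lambda>i. c (i + a))"
proof -
  have "(i + a) mod int g = (j + a) mod int g \<longleftrightarrow> i mod int g = j mod int g" for i j
    by (simp add: mod_eq_dvd_iff)
  moreover have "{c (i + a), c (i + 1 + a)} \<in> E" for i
  proof -
    have "{c (i + a), c (i + a + 1)} \<in> E" using assms by (simp add: cyc_def)
    thus ?thesis by (simp add: ac_simps)
  qed
  ultimately show ?thesis using assms unfolding cyc_def by simp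
qed

lemma cyc_reflect: "cyc E g c \<Longrightarrow> cyc E g (\<lambda>i. c (- i))"
proof -
  have "(- i) mod int g = (- j) mod int g \<longleftrightarrow> i mod int g = j mod int g" for i j
    by (simp add: mod_eq_dvd_iff dvd_diff_commute)
  moreover assume c: "cyc E g c"
  moreover have "{c (- i), c (- (i + 1))} \<in> E" for i
  proof -
    have "{c (-i - 1), c (-i - 1 + 1)} \<in> E" using c unfolding cyc_def by blast
    thus ?thesis by (simp add: insert_commute)
  qed
  ultimately show ?thesis unfolding cyc_def by auto
qed

lemma cyc_neq:
  assumes "cyc E g c" "i < j" "j - i < int g" shows "c i \<noteq> c j"
proof
  assume "c i = c j"
  hence "i mod int g = j mod int g" using assms(1) unfolding cyc_def by blast
  hence "int g dvd j - i" by (metis mod_eq_dvd_iff)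
  thus False using assms(2,3) zdvd_imp_le by force
qed

lemma cyc_period: "cyc E g c \<Longrightarrow> c (i + int g) = c i"
  unfolding cyc_def by simp

lemma is_cycle_cyc:
  assumes p: "is_cycle E p" and v: "v \<in> set p"
  obtains c where "cyc E (length p) c" "c 0 = v" "range c \<subseteq> set p"
proof -
  define g where "g = length p"
  have g: "g \<ge> 3" "distinct p" using p by (auto simp: is_cycle_def g_def)
  define c where "c i = p ! nat (i mod int g)" for i
  have lt: "nat (i mod int g) < g" for i using g by (simp add: nat_less_iff)
  have E: "{c i, c (i + 1)} \<in> E" for i
  proof -
    have "nat ((i + 1) mod int g) = Suc (nat (i mod int g)) mod g"
    proof -
      have "int (Suc (nat (i mod int g)) mod g) = (i mod int g + 1) mod int g"
        using g by (simp add: zmod_int add.commute)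
      thus ?thesis by (metis mod_add_left_eq nat_int)
    qed
    thus ?thesis using p lt[of i] unfolding c_def is_cycle_def g_def by metis
  qed
  have inj: "c i = c j \<longleftrightarrow> i mod int g = j mod int g" for i j
    unfolding c_def using g lt[of i] lt[of j]
    by (auto simp: nth_eq_iff_index_eq g_def[symmetric] eq_nat_nat_iff)
  have c: "cyc E g c" using g E inj by (auto simp: cyc_def)
  obtain k where k: "k < g" "p ! k = v" using v by (auto simp: in_set_conv_nth g_def)
  have "c (0 + int k) = v" using k by (simp add: c_def)
  moreover have "range (\<lambda>i. c (i + int k)) \<subseteq> set p"
    using lt by (auto simp: c_def g_def)
  ultimately show ?thesis using that[of "\<lambda>i. c (i + int k)"] cyc_shift[OF c] by (simp add: g_def)
qed

locale graph =
  fixes V :: "nat set" and E :: "nat set set"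
  assumes graph: "simple_graph V E"
begin

abbreviation "N \<equiv> neighbours E"

lemma finV: "finite V" and loopfree: "loopfree E"
  using graph by (force simp: simple_graph_def loopfree_def doubleton_eq_iff)+

lemma edge_V: "{x, y} \<in> E \<Longrightarrow> x \<in> V \<and> y \<in> V"
  using graph unfolding simple_graph_def by (metis doubleton_eq_iff)

lemma N_iff: "y \<in> N x \<longleftrightarrow> {x, y} \<in> E"
  by (simp add: neighbours_def insert_commute)

lemma N_sub: "N x \<subseteq> V" using edge_V by (auto simp: N_iff)

lemma finN [simp]: "finite (N x)" using N_sub finV finite_subset by blast

lemma not_self: "v \<notin> N v" using loopfree by (simp add: N_iff loopfree_def)

end

section \<open>One stage of the algorithm\<close>

text \<open>\<open>Probe b s v\<close> comes from the sampled node \<open>s\<close> with first hop \<open>v\<close>, where \<open>b\<close> says whether \<open>v\<close> has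
  degree at least \<open>h2\<close>; for a token that has not moved yet, \<open>v = s\<close>. \<open>Low\<close> tokens move through nodes
  of degree less than \<open>h2\<close> only.\<close>

datatype token = Probe bool nat nat | Low nat | Listed nat | Overflow | Relay nat | Dist nat nat nat

text \<open>The negated part drops \<open>v\<close> if a source with first hop \<open>v\<close> has
  also arrived through \<open>x\<close>. This limits how many neighbours list \<open>v\<close> to
  \<open>x\<close> (\<open>card_listing_nbrs\<close>), and it does no harm on a shortest cycle if no
  shortest cycle meets the sample (\<open>listed_along\<close>).\<close>

definition listed :: "nat \<Rightarrow> nat set \<Rightarrow> (nat \<Rightarrow> nat \<Rightarrow> token set) \<Rightarrow> nat \<Rightarrow> nat set" where
  "listed l N R x = {v. (\<exists>a\<in>N - {x}. \<exists>s. Probe True s v \<in> R l a) \<and>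
     \<not> (\<exists>a\<in>N - {x}. \<exists>b s j b' v'. Probe b s v \<in> R l a \<and> j \<le> l \<and> Probe b' s v' \<in> R j x)}"

text \<open>Phases 0 to \<open>l\<close> flood, phase \<open>l + 1\<close> sends the lists, and
  phases \<open>l + 2\<close> to \<open>2 * l + 1\<close> relay overflow. Nothing is passed back to
  its sender, which makes all token paths non-backtracking. The first hop and its degree flag are
  filled in during phase 1.\<close>

definition stage_tokens ::
  "nat \<Rightarrow> nat \<Rightarrow> nat \<Rightarrow> nat \<Rightarrow> nat \<Rightarrow> nat \<Rightarrow> nat set \<Rightarrow> bool \<Rightarrow> (nat \<Rightarrow> nat \<Rightarrow> token set) \<Rightarrow> nat \<Rightarrow> token set" where
  "stage_tokens l h1 h2 M i u N smp R x =
    (if i = 0 then (if smp then {Probe False u u} else {}) \<union> (if card N < h2 then {Low u} else {})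
     else if i \<le> l then
       {Probe (if i = 1 then h2 \<le> card N else b) s (if i = 1 then u else v) | b s v.
          \<exists>y\<in>N - {x}. Probe b s v \<in> R (i - 1) y} \<union>
       {Low z | z. card N < h2 \<and> (\<exists>y\<in>N - {x}. Low z \<in> R (i - 1) y)}
     else if i = Suc l then
       (if card (listed l N R x) \<le> M then Listed ` listed l N R x else {Overflow})
     else if i = Suc (Suc l) then {Relay p | p. h1 \<le> card N \<and> p \<in> N - {x} \<and> Overflow \<in> R (Suc l) p}
     else {Relay p | p. \<exists>y\<in>N - {x}. Relay p \<in> R (i - 1) y})"

text \<open>\<open>evidence l R z y j\<close>: the tokens received from \<open>y\<close> witness a non-backtracking walk of length \<open>j\<close>
  from \<open>z\<close> to \<open>y\<close> that extends to the receiver.\<close>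

definition evidence :: "nat \<Rightarrow> (nat \<Rightarrow> nat \<Rightarrow> token set) \<Rightarrow> nat \<Rightarrow> nat \<Rightarrow> nat \<Rightarrow> bool" where
  "evidence l R z y j \<longleftrightarrow>
     (j \<le> l \<and> (\<exists>b v. Probe b z v \<in> R j y)) \<or>
     (j < l \<and> (\<exists>b s. Probe b s z \<in> R (Suc j) y)) \<or>
     (j \<le> l \<and> Low z \<in> R j y) \<or>
     (j = l \<and> Listed z \<in> R (Suc l) y) \<or>
     (1 \<le> j \<and> j \<le> l \<and> Relay z \<in> R (Suc l + j) y)"

text \<open>Both walks still have to be extended by an edge to the receiver, hence the summand
  2.\<close>

definition detects :: "nat \<Rightarrow> nat \<Rightarrow> (nat \<Rightarrow> nat \<Rightarrow> token set) \<Rightarrow> nat set \<Rightarrow> bool" where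
  "detects l k R N \<longleftrightarrow> (\<exists>z y y' j j'. y \<in> N \<and> y' \<in> N \<and> y \<noteq> y' \<and>
     evidence l R z y j \<and> evidence l R z y' j' \<and> j + j' + 2 \<le> k)"

text \<open>\<open>got i u x\<close> and \<open>due i u x\<close> are the tokens that \<open>x\<close> receives from \<open>u\<close> in phase \<open>i\<close> and
  those that \<open>u\<close> would send without the limit of \<open>M\<close> tokens per phase.\<close>

locale stage_run = graph +
  fixes X :: "nat set" and l h1 h2 M :: nat and got :: "nat \<Rightarrow> nat \<Rightarrow> nat \<Rightarrow> token set"
  assumes l1: "1 \<le> l"
begin

text \<open>The cut-off at phase \<open>i\<close> makes the tokens of a phase depend on earlier
  phases only.\<close>

definition due :: "nat \<Rightarrow> nat \<Rightarrow> nat \<Rightarrow> token set" where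
  "due i u x = stage_tokens l h1 h2 M i u (neighbours E u) (u \<in> X)
     (\<lambda>i' y. if i' < i then got i' y u else {}) x"

abbreviation "seen x \<equiv> \<lambda>i y. got i y x"
abbreviation "deg v \<equiv> card (neighbours E v)"

end

text \<open>Truncation only loses tokens, so soundness holds here whatever the load; completeness
  uses the bounds of \<open>stage_girth\<close>.\<close>

locale stage = stage_run +
  assumes got_sub: "\<And>i u x. i < 2 * l + 2 \<Longrightarrow> {u, x} \<in> E \<Longrightarrow> got i u x \<subseteq> due i u x"
    and got_eq: "\<And>i u x. i < 2 * l + 2 \<Longrightarrow> {u, x} \<in> E \<Longrightarrow> card (due i u x) \<le> M \<Longrightarrow> got i u x = due i u x"
begin

section \<open>Soundness of a stage: the walks behind the tokens\<close>

lemma probe_due_0: "Probe b s v \<in> due 0 u x \<longleftrightarrow> u \<in> X \<and> \<not> b \<and> s = u \<and> v = u"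
  by (auto simp: due_def stage_tokens_def)

lemma low_due_0: "Low z \<in> due 0 u x \<longleftrightarrow> deg u < h2 \<and> z = u"
  by (auto simp: due_def stage_tokens_def)

lemma due_Suc:
  assumes "Suc i \<le> l"
  shows "due (Suc i) u x =
       {Probe (if i = 0 then h2 \<le> deg u else b) s (if i = 0 then u else v) | b s v.
          \<exists>y\<in>N u - {x}. Probe b s v \<in> got i y u} \<union>
       {Low z | z. deg u < h2 \<and> (\<exists>y\<in>N u - {x}. Low z \<in> got i y u)}"
  using assms by (simp add: due_def stage_tokens_def)

lemma probe_due_Suc:
  assumes "Suc i \<le> l"
  shows "Probe b s v \<in> due (Suc i) u x \<longleftrightarrow> (\<exists>y b' v'. y \<in> N u \<and> y \<noteq> x \<and> Probe b' s v' \<in> got i y u \<and>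
    b = (if i = 0 then h2 \<le> deg u else b') \<and> v = (if i = 0 then u else v'))"
  unfolding due_Suc[OF assms] by blast

lemma low_due_Suc:
  assumes "Suc i \<le> l"
  shows "Low z \<in> due (Suc i) u x \<longleftrightarrow> deg u < h2 \<and> (\<exists>y. y \<in> N u \<and> y \<noteq> x \<and> Low z \<in> got i y u)"
  unfolding due_Suc[OF assms] by blast

lemma due_relay_0: "due (Suc (Suc l)) u x =
    {Relay p | p. h1 \<le> deg u \<and> p \<in> N u \<and> p \<noteq> x \<and> Overflow \<in> got (Suc l) p u}"
  by (auto simp: due_def stage_tokens_def)

lemma due_relay_Suc: "due (Suc (Suc l) + Suc i) u x =
    {Relay p | p. \<exists>y. y \<in> N u \<and> y \<noteq> x \<and> Relay p \<in> got (Suc (Suc l) + i) y u}"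
  by (auto simp: due_def stage_tokens_def)

text \<open>The walk is written from the receiver \<open>x\<close> to the source \<open>s\<close>,
  which has index \<open>i\<close> in \<open>u # p\<close>, so the first hop has index
  \<open>i - 1\<close>. For \<open>i = 0\<close> truncated subtraction gives \<open>u = s\<close>,
  as required of a token that has not moved.\<close>

lemma probe_sound:
  "i \<le> l \<Longrightarrow> {u, x} \<in> E \<Longrightarrow> Probe b s v \<in> due i u x \<Longrightarrow>
   \<exists>p. rwalk E (x # u # p) \<and> length p = i \<and> last (u # p) = s \<and> s \<in> X \<and>
     v = (u # p) ! (i - 1) \<and> b = (i \<noteq> 0 \<and> h2 \<le> deg v)"
proof (induction i arbitrary: u x b s v)
  case 0
  thus ?case by (auto simp: probe_due_0 insert_commute)
next
  case (Suc i)
  obtain b' v' y where y: "y \<in> N u" "y \<noteq> x" "Probe b' s v' \<in> got i y u"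
    and b: "b = (if i = 0 then h2 \<le> deg u else b')" and v: "v = (if i = 0 then u else v')"
    using Suc.prems probe_due_Suc by metis
  have yu: "{y, u} \<in> E" using y by (simp add: N_iff insert_commute)
  have il: "i \<le> l" and pr: "Probe b' s v' \<in> due i y u"
    using got_sub[of i y u] yu y Suc.prems by auto
  then obtain p where p: "rwalk E (u # y # p)" "length p = i" "last (y # p) = s" "s \<in> X"
    "v' = (y # p) ! (i - 1)" "b' = (i \<noteq> 0 \<and> h2 \<le> deg v')"
    using Suc.IH[OF il yu pr] by metis
  show ?case
    by (rule exI[of _ "y # p"])
       (use p y b v Suc.prems in \<open>auto simp: insert_commute nth_Cons split: nat.splits\<close>)
qed

lemma low_sound:
  "i \<le> l \<Longrightarrow> {u, x} \<in> E \<Longrightarrow> Low z \<in> due i u x \<Longrightarrow>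
   \<exists>p. rwalk E (x # u # p) \<and> length p = i \<and> last (u # p) = z \<and> (\<forall>w\<in>set (u # p). deg w < h2)"
proof (induction i arbitrary: u x)
  case 0
  thus ?case by (auto simp: low_due_0 insert_commute)
next
  case (Suc i)
  obtain y where y: "y \<in> N u" "y \<noteq> x" "Low z \<in> got i y u" "deg u < h2"
    using Suc.prems low_due_Suc by metis
  have yu: "{y, u} \<in> E" using y by (simp add: N_iff insert_commute)
  have "Low z \<in> due i y u" using got_sub[of i y u] yu y Suc.prems by auto
  then obtain p where p: "rwalk E (u # y # p)" "length p = i" "last (y # p) = z"
    "\<forall>w\<in>set (y # p). deg w < h2"
    using Suc.IH[OF _ yu] Suc.prems by auto
  show ?case
    by (rule exI[of _ "y # p"]) (use p y Suc.prems in \<open>auto simp: insert_commute\<close>)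
qed

lemma due_listed:
  "due (Suc l) u x = (if card (listed l (N u) (\<lambda>i y. if i < Suc l then got i y u else {}) x) \<le> M
     then Listed ` listed l (N u) (\<lambda>i y. if i < Suc l then got i y u else {}) x else {Overflow})"
  by (simp add: due_def stage_tokens_def)

abbreviation "lst u x \<equiv> listed l (N u) (\<lambda>i y. if i < Suc l then got i y u else {}) x"

lemma lst_walk:
  assumes "v \<in> lst u x"
  obtains a s p where "{a, u} \<in> E" "a \<noteq> x" "rwalk E (u # a # p)" "length p = l"
    "last (a # p) = s" "s \<in> X" "v = (a # p) ! (l - 1)" "h2 \<le> deg v" "Probe True s v \<in> got l a u"
proof -
  obtain a s where as: "a \<in> N u" "a \<noteq> x" "Probe True s v \<in> got l a u"
    using assms by (auto simp: listed_def split: if_splits)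
  have au: "{a, u} \<in> E" using as by (simp add: N_iff insert_commute)
  have "Probe True s v \<in> due l a u" using got_sub[of l a u] au as by auto
  from probe_sound[OF _ au this] that as au show ?thesis using l1 by auto
qed

lemma lst_sub: "lst u x \<subseteq> V"
proof
  fix v assume "v \<in> lst u x"
  then obtain a s p where p: "rwalk E (u # a # p)" "length p = l" "v = (a # p) ! (l - 1)"
    by (rule lst_walk)
  have "{(u # a # p) ! (l - 1), (u # a # p) ! Suc (l - 1)} \<in> E"
    using p(1,2) l1 unfolding rwalk_iff_nth by simp
  thus "v \<in> V" using p edge_V by auto
qed

lemma fin_lst [simp]: "finite (lst u x)" using lst_sub finV finite_subset by blast

text \<open>An entry stems from a walk of length \<open>l + 1\<close> from a sampled node to
  \<open>u\<close> whose second vertex is \<open>v\<close>; without the sampled node it has length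
  \<open>l\<close>.\<close>

lemma listed_sound:
  assumes "{u, x} \<in> E" "Listed v \<in> got (Suc l) u x"
  shows "\<exists>p. rwalk E (x # u # p) \<and> length p = l \<and> last (u # p) = v"
proof -
  have "Listed v \<in> due (Suc l) u x" using got_sub[of "Suc l" u x] assms l1 by auto
  hence "v \<in> lst u x" by (auto simp: due_listed split: if_splits)
  then obtain a s p where p: "a \<noteq> x" "rwalk E (u # a # p)" "length p = l" "v = (a # p) ! (l - 1)"
    by (rule lst_walk)
  let ?q = "take l (a # p)"
  have "rwalk E (x # u # a # p)" using p assms by (simp add: insert_commute)
  hence "rwalk E (take (l + 2) (x # u # a # p))" by (rule rwalk_take) simp
  hence 1: "rwalk E (x # u # ?q)" by simp
  have "last ?q = v" using p l1 by (subst last_conv_nth) auto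
  thus ?thesis using 1 p l1 by (intro exI[of _ ?q]) auto
qed

lemma overflow_lst:
  assumes "{u, x} \<in> E" "Overflow \<in> got (Suc l) u x" shows "M < card (lst u x)"
proof -
  have "Overflow \<in> due (Suc l) u x" using got_sub[of "Suc l" u x] assms l1 by auto
  thus ?thesis by (auto simp: due_listed split: if_splits)
qed

text \<open>The vertex just before \<open>w\<close> started the relay. Its degree and the overflow
  it received are recorded because the load of the relay phases is bounded by counting such
  vertices.\<close>

lemma relay_sound:
  "i < l \<Longrightarrow> {u, x} \<in> E \<Longrightarrow> Relay w \<in> due (Suc (Suc l) + i) u x \<Longrightarrow>
   \<exists>p. rwalk E (x # u # p) \<and> length p = Suc i \<and> last p = w \<and> h1 \<le> deg ((u # p) ! i) \<and>
     Overflow \<in> got (Suc l) w ((u # p) ! i)"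
proof (induction i arbitrary: u x)
  case 0
  hence "h1 \<le> deg u" "w \<in> N u" "w \<noteq> x" "Overflow \<in> got (Suc l) w u"
    by (auto simp: due_relay_0)
  thus ?case using 0 by (intro exI[of _ "[w]"]) (auto simp: insert_commute N_iff)
next
  case (Suc i)
  obtain y where y: "y \<in> N u" "y \<noteq> x" "Relay w \<in> got (Suc (Suc l) + i) y u"
    using Suc.prems(3) unfolding due_relay_Suc by blast
  have yu: "{y, u} \<in> E" using y by (simp add: N_iff insert_commute)
  have "Relay w \<in> due (Suc (Suc l) + i) y u"
    using got_sub[of "Suc (Suc l) + i" y u] yu y Suc.prems by auto
  then obtain p where p: "rwalk E (u # y # p)" "length p = Suc i" "last p = w"
    "h1 \<le> deg ((y # p) ! i)" "Overflow \<in> got (Suc l) w ((y # p) ! i)"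
    using Suc.IH[OF _ yu] Suc.prems by auto
  show ?case
    by (rule exI[of _ "y # p"]) (use p y Suc.prems in \<open>auto simp: insert_commute\<close>)
qed

lemma evidence_sound:
  assumes "{y, x} \<in> E" "evidence l (seen x) z y j"
  shows "\<exists>p. rwalk E (x # y # p) \<and> length p = j \<and> last (y # p) = z"
  using assms(2) unfolding evidence_def
proof (elim disjE conjE exE)
  fix b v assume "j \<le> l" "Probe b z v \<in> got j y x"
  hence "Probe b z v \<in> due j y x" "j \<le> l" using got_sub[of j y x] assms by auto
  thus ?thesis using probe_sound[of j y x b z v] assms by blast
next
  fix b s assume j: "j < l" "Probe b s z \<in> got (Suc j) y x"
  then obtain p where p: "rwalk E (x # y # p)" "length p = Suc j" "z = (y # p) ! j"
    using probe_sound[of "Suc j" y x b s z] got_sub[of "Suc j" y x] assms by fastforce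
  \<comment> \<open>The first hop is one step nearer than the source, so the last vertex of the walk
    is cut off.\<close>
  have "rwalk E (take (j + 2) (x # y # p))" by (rule rwalk_take[OF p(1)]) simp
  moreover have "take (Suc j) (y # p) = take j (y # p) @ [(y # p) ! j]"
    by (rule take_Suc_conv_app_nth) (use p in simp)
  hence "last (y # take j p) = z" using p by simp
  ultimately show ?thesis using p by (intro exI[of _ "take j p"]) simp
next
  assume "j \<le> l" "Low z \<in> got j y x"
  thus ?thesis using low_sound[of j y x z] got_sub[of j y x] assms by fastforce
next
  assume "j = l" "Listed z \<in> got (Suc l) y x"
  thus ?thesis using listed_sound[OF assms(1)] by auto
next
  assume j: "1 \<le> j" "j \<le> l" "Relay z \<in> got (Suc l + j) y x"
  hence "Relay z \<in> got (Suc (Suc l) + (j - 1)) y x" by simp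
  hence "Relay z \<in> due (Suc (Suc l) + (j - 1)) y x"
    using got_sub[of "Suc (Suc l) + (j - 1)" y x] assms j by auto
  moreover have "j - 1 < l" "Suc (j - 1) = j" using j by auto
  ultimately obtain p where "rwalk E (x # y # p)" "length p = j" "last p = z"
    using relay_sound[OF _ assms(1)] by metis
  thus ?thesis using j by (intro exI[of _ p]) auto
qed

text \<open>The two walks from \<open>x\<close> already differ in their first step, so
  \<open>rwalk_unique\<close> applies.\<close>

lemma detects_sound:
  assumes "detects l k (seen x) (N x)" shows "girth E \<le> enat k"
proof -
  obtain z y y' j j' where y: "y \<in> N x" "y' \<in> N x" "y \<noteq> y'" and
    ev: "evidence l (seen x) z y j" "evidence l (seen x) z y' j'" and
    k: "j + j' + 2 \<le> k" using assms by (auto simp: detects_def)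
  have "{y, x} \<in> E" "{y', x} \<in> E" using y by (auto simp: N_iff insert_commute)
  then obtain p p' where p: "rwalk E (x # y # p)" "length p = j" "last (y # p) = z"
    "rwalk E (x # y' # p')" "length p' = j'" "last (y' # p') = z"
    using evidence_sound ev by meson
  have "girth E \<le> enat (length (x # y # p) + length (x # y' # p') - 2)"
    by (rule rwalk_unique[OF loopfree p(1) p(4)]) (use p y in auto)
  also have "\<dots> \<le> enat k" using k p by simp
  finally show ?thesis .
qed

end

section \<open>Descending walks along a cycle, from receiver to source\<close>

primrec down :: "(int \<Rightarrow> nat) \<Rightarrow> nat \<Rightarrow> nat list" where
  "down c 0 = [c 0]"
| "down c (Suc m) = c (int (Suc m)) # down c m"

lemma length_down [simp]: "length (down c m) = Suc m" by (induction m) auto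

lemma down_neq_Nil [simp]: "down c m \<noteq> []" by (cases m) auto

lemma hd_down [simp]: "hd (down c m) = c (int m)" by (cases m) auto

lemma last_down [simp]: "last (down c m) = c 0" by (induction m) auto

lemma nth_down_append [simp]: "(down c m @ q) ! m = c 0"
  by (induction m) auto

lemma set_down: "set (down c m) \<subseteq> range c" by (induction m) auto

lemma rwalk_down:
  assumes c: "cyc E g c" and q: "rwalk E (c 0 # q)" "q = [] \<or> hd q \<noteq> c 1"
  shows "rwalk E (down c m @ q)"
proof (induction m)
  case 0 thus ?case using q by simp
next
  case (Suc m)
  have e: "{c (int m + 1), c (int m)} \<in> E" using c by (simp add: cyc_def insert_commute)
  show ?case
  proof (cases m)
    case 0
    thus ?thesis using e q by (auto simp: rwalk_Cons)
  next
    case (Suc k)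
    have "c (int k) \<noteq> c (int k + 2)"
      by (rule cyc_neq[OF c]) (use c in \<open>auto simp: cyc_def\<close>)
    hence "c (int (Suc m)) \<noteq> hd (down c k @ q)" using Suc by (simp add: add.commute)
    thus ?thesis using Suc.IH e Suc by (simp add: rwalk_Cons add.commute)
  qed
qed

text \<open>\<open>hit_walks\<close> and \<open>hit_nbrs\<close> are what the random sample has to
  provide. \<open>XM\<close>, \<open>M_listed\<close> and \<open>M_relay\<close> bound in turn the
  load of the flooding phases, the lists of nodes of degree below \<open>h1\<close>, and the load of
  the relay phases.\<close>

locale stage_girth = stage +
  fixes g \<tau> :: nat
  assumes girth: "girth E = enat g" and gl: "2 * l + 1 \<le> g" "g \<le> 2 * l + 2"
    and XV: "X \<subseteq> V"
    and hit_walks: "\<And>v x w0. v \<in> V \<Longrightarrow> x \<in> V \<Longrightarrow> w0 \<in> V \<Longrightarrow>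
      \<tau> \<le> card ({w \<in> N v. \<exists>p. rwalk E (x # p) \<and> length p = l \<and> last p = w} - {w0}) \<Longrightarrow>
      \<exists>w\<in>X. w \<in> {w \<in> N v. \<exists>p. rwalk E (x # p) \<and> length p = l \<and> last p = w} - {w0}"
    and hit_nbrs: "\<And>v. v \<in> V \<Longrightarrow> \<tau> \<le> deg v \<Longrightarrow> N v \<inter> X \<noteq> {}"
    and XM: "card X + h2 ^ l \<le> M" and h: "\<tau> \<le> h1" "h1 \<le> h2" "2 \<le> h1"
    and M_listed: "h1 * card V \<le> M * (h2 - 1)"
    and M_relay: "card V * (card V * \<tau>) \<le> M * (M * (h1 - 1))"
begin

section \<open>Bounds on the number of tokens per edge\<close>

lemma uniq:
  assumes "rwalk E (u # p)" "rwalk E (u # q)" "last (u # p) = last (u # q)" "length p + length q < g"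
  shows "p = q"
  using rwalk_unique'[OF loopfree assms(1,2)] assms girth by auto

lemma M1: "1 \<le> M"
proof -
  have "1 \<le> h2 ^ l" using h by simp
  thus ?thesis using XM by linarith
qed

lemma finX: "finite X" using XV finV finite_subset by blast

text \<open>A probe on an edge is determined by its source, since \<open>2 * l < g\<close> allows
  only one reduced walk of length \<open>i\<close> from there to \<open>u\<close>.\<close>

lemma card_probes:
  assumes "i \<le> l" "{u, x} \<in> E"
  shows "finite {t \<in> due i u x. \<exists>b s v. t = Probe b s v}"
    and "card {t \<in> due i u x. \<exists>b s v. t = Probe b s v} \<le> card X"
proof -
  let ?P = "{t \<in> due i u x. \<exists>b s v. t = Probe b s v}"
  let ?f = "\<lambda>t. case t of Probe b s v \<Rightarrow> s | _ \<Rightarrow> 0"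
  have "inj_on ?f ?P"
  proof (rule inj_onI)
    fix t t' assume t: "t \<in> ?P" "t' \<in> ?P" "?f t = ?f t'"
    then obtain b s v b' v' where tt: "t = Probe b s v" "t' = Probe b' s v'" by auto
    obtain p where p: "rwalk E (x # u # p)" "length p = i" "last (u # p) = s"
      "v = (u # p) ! (i - 1)" "b = (i \<noteq> 0 \<and> h2 \<le> deg v)"
      using probe_sound[of i u x b s v] assms t tt by blast
    obtain p' where p': "rwalk E (x # u # p')" "length p' = i" "last (u # p') = s"
      "v' = (u # p') ! (i - 1)" "b' = (i \<noteq> 0 \<and> h2 \<le> deg v')"
      using probe_sound[of i u x b' s v'] assms t tt by blast
    have "p = p'"
    proof (rule uniq[of u])
      show "rwalk E (u # p)" "rwalk E (u # p')" using p(1) p'(1) rwalk_tl by blast+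
    qed (use p p' gl assms in auto)
    thus "t = t'" using p p' tt by simp
  qed
  moreover have "?f ` ?P \<subseteq> X"
  proof
    fix s assume "s \<in> ?f ` ?P"
    then obtain b v where "Probe b s v \<in> due i u x" by auto
    thus "s \<in> X" using probe_sound assms by blast
  qed
  ultimately show "finite ?P" "card ?P \<le> card X"
    using finX by (meson inj_on_finite, meson card_inj_on_le)
qed

lemma card_low_walks:
  fixes u :: nat
  defines "W \<equiv> \<lambda>i u. {p. rwalk E (u # p) \<and> length p = i \<and> (\<forall>w\<in>set (u # p). deg w < h2)}"
  shows "finite (W i u) \<and> card (W i u) \<le> h2 ^ i"
proof (induction i arbitrary: u)
  case 0
  have "W 0 u \<subseteq> {[]}" by (auto simp: W_def)
  hence "finite (W 0 u)" "card (W 0 u) \<le> card {[] :: nat list}"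
    by (auto intro: finite_subset card_mono simp del: card.insert)
  thus ?case by simp
next
  case (Suc i)
  show ?case
  proof (cases "deg u < h2")
    case True
    let ?U = "\<Union>w\<in>N u. (#) w ` W i w"
    have sub: "W (Suc i) u \<subseteq> ?U"
    proof
      fix p assume p: "p \<in> W (Suc i) u"
      then obtain w q where q: "p = w # q" by (cases p) (auto simp: W_def)
      have "w \<in> N u" using p q rwalk_edge by (auto simp: W_def N_iff)
      moreover have "q \<in> W i w" using p q rwalk_tl by (auto simp: W_def)
      ultimately show "p \<in> ?U" using q by blast
    qed
    have fin: "finite ?U" using Suc.IH by simp
    have "card ?U \<le> (\<Sum>w\<in>N u. card ((#) w ` W i w))"
      by (rule card_UN_le) simp
    also have "\<dots> \<le> (\<Sum>w\<in>N u. h2 ^ i)"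
    proof (rule sum_mono)
      fix w show "card ((#) w ` W i w) \<le> h2 ^ i"
        using Suc.IH[of w] card_image_le[of "W i w" "(#) w"] by linarith
    qed
    also have "\<dots> \<le> h2 ^ Suc i" using True by simp
    finally have "card ?U \<le> h2 ^ Suc i" .
    thus ?thesis using sub fin card_mono[OF fin sub] finite_subset[OF sub fin] by linarith
  next
    case False
    hence "W (Suc i) u = {}" by (auto simp: W_def)
    thus ?thesis by simp
  qed
qed

lemma card_lows:
  assumes "i \<le> l" "{u, x} \<in> E"
  shows "finite {t \<in> due i u x. \<exists>z. t = Low z} \<and> card {t \<in> due i u x. \<exists>z. t = Low z} \<le> h2 ^ i"
proof -
  let ?W = "{p. rwalk E (u # p) \<and> length p = i \<and> (\<forall>w\<in>set (u # p). deg w < h2)}"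
  have sub: "{t \<in> due i u x. \<exists>z. t = Low z} \<subseteq> (\<lambda>p. Low (last (u # p))) ` ?W"
  proof
    fix t assume "t \<in> {t \<in> due i u x. \<exists>z. t = Low z}"
    then obtain z where z: "t = Low z" "Low z \<in> due i u x" by auto
    obtain p where p: "rwalk E (x # u # p)" "length p = i" "last (u # p) = z" "\<forall>w\<in>set (u # p). deg w < h2"
      using low_sound[OF assms z(2)] by metis
    hence "p \<in> ?W" using rwalk_tl by blast
    thus "t \<in> (\<lambda>p. Low (last (u # p))) ` ?W" using p(3) z(1) by blast
  qed
  thus ?thesis using card_low_walks[of u i] finite_subset card_mono card_image_le
    by (meson finite_imageI order_trans)
qed

text \<open>At most \<open>card X\<close> probes and \<open>h2 ^ i\<close> tokens \<open>Low\<close>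
  cross an edge in a flooding phase, so nothing is truncated.\<close>

lemma got_due:
  assumes "i \<le> l" "{u, x} \<in> E" shows "got i u x = due i u x"
proof (rule got_eq)
  have "due i u x \<subseteq> {t \<in> due i u x. \<exists>b s v. t = Probe b s v} \<union> {t \<in> due i u x. \<exists>z. t = Low z}"
  proof (cases i)
    case 0 thus ?thesis by (auto simp: due_def stage_tokens_def split: if_splits)
  next
    case (Suc j)
    have "(\<exists>b s v. t = Probe b s v) \<or> (\<exists>z. t = Low z)" if "t \<in> due i u x" for t
      using that assms unfolding Suc due_Suc[OF assms(1)[unfolded Suc]] by blast
    thus ?thesis by blast
  qed
  hence "card (due i u x) \<le> card ({t \<in> due i u x. \<exists>b s v. t = Probe b s v} \<union> {t \<in> due i u x. \<exists>z. t = Low z})"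
    using card_probes[OF assms] card_lows[OF assms] by (intro card_mono) auto
  also have "\<dots> \<le> card X + h2 ^ i"
    using card_Un_le card_probes[OF assms] card_lows[OF assms] by (meson add_mono order_trans)
  also have "\<dots> \<le> card X + h2 ^ l" using assms h by (simp add: power_increasing)
  finally show "card (due i u x) \<le> M" using XM by simp
qed (use assms in auto)

lemma got_due_listed:
  assumes "{u, x} \<in> E" shows "got (Suc l) u x = due (Suc l) u x"
proof (rule got_eq)
  have "card (Listed ` lst u x) = card (lst u x)" by (rule card_image) (simp add: inj_on_def)
  thus "card (due (Suc l) u x) \<le> M" using M1 by (auto simp: due_listed)
qed (use assms l1 in auto)

lemma probe_complete:
  "i \<le> l \<Longrightarrow> rwalk E (x # u # p) \<Longrightarrow> length p = i \<Longrightarrow> last (u # p) \<in> X \<Longrightarrow>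
   Probe (i \<noteq> 0 \<and> h2 \<le> deg ((u # p) ! (i - 1))) (last (u # p)) ((u # p) ! (i - 1)) \<in> got i u x"
proof (induction i arbitrary: x u p)
  case 0
  thus ?case using got_due[of 0 u x] by (simp add: probe_due_0 insert_commute)
next
  case (Suc i)
  then obtain y q where q: "p = y # q" by (cases p) auto
  have ux: "{u, x} \<in> E" using Suc.prems rwalk_edge by (metis insert_commute)
  have y: "y \<in> N u" "y \<noteq> x" using Suc.prems q by (auto simp: N_iff dest: rwalk_edge)
  have "Probe (i \<noteq> 0 \<and> h2 \<le> deg ((y # q) ! (i - 1))) (last (y # q)) ((y # q) ! (i - 1)) \<in> got i y u"
    by (rule Suc.IH) (use Suc.prems q in auto)
  hence "Probe (Suc i \<noteq> 0 \<and> h2 \<le> deg ((u # p) ! (Suc i - 1))) (last (u # p)) ((u # p) ! (Suc i - 1)) \<in> due (Suc i) u x"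
    unfolding probe_due_Suc[OF Suc.prems(1)] using y q
    by (intro exI[of _ y] exI[of _ "i \<noteq> 0 \<and> h2 \<le> deg ((y # q) ! (i - 1))"] exI[of _ "(y # q) ! (i - 1)"])
      (auto simp: nth_Cons split: nat.splits)
  thus ?case using got_due[OF Suc.prems(1) ux] by simp
qed

lemma low_complete:
  "i \<le> l \<Longrightarrow> rwalk E (x # u # p) \<Longrightarrow> length p = i \<Longrightarrow> (\<forall>w\<in>set (u # p). deg w < h2) \<Longrightarrow>
   Low (last (u # p)) \<in> got i u x"
proof (induction i arbitrary: x u p)
  case 0
  thus ?case using got_due[of 0 u x] by (simp add: low_due_0 insert_commute)
next
  case (Suc i)
  then obtain y q where q: "p = y # q" by (cases p) auto
  have ux: "{u, x} \<in> E" using Suc.prems rwalk_edge by (metis insert_commute)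
  have y: "y \<in> N u" "y \<noteq> x" using Suc.prems q by (auto simp: N_iff dest: rwalk_edge)
  have "Low (last (y # q)) \<in> got i y u"
    by (rule Suc.IH) (use Suc.prems q in auto)
  hence "Low (last (u # p)) \<in> due (Suc i) u x"
    unfolding low_due_Suc[OF Suc.prems(1)] using y q Suc.prems by auto
  thus ?case using got_due[OF Suc.prems(1) ux] by simp
qed

lemma lst_uncovered:
  assumes "v \<in> lst u x" "a \<in> N u" "a \<noteq> x" "Probe b s v \<in> got l a u" "j \<le> l" "Probe b' s v' \<in> got j x u"
  shows False
proof -
  let ?R = "\<lambda>i y. if i < Suc l then got i y u else {}"
  have "Probe b s v \<in> ?R l a" "Probe b' s v' \<in> ?R j x" using assms by auto
  thus False using assms(1-3,5) unfolding listed_def by blast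
qed

definition heavy :: "nat \<Rightarrow> nat \<Rightarrow> nat \<Rightarrow> nat set" where
  "heavy h' i u = {w. h' \<le> deg w \<and> (\<exists>p. rwalk E (u # p) \<and> length p = i \<and> last (u # p) = w)}"

text \<open>Each such vertex has at least \<open>h' - 1\<close> neighbours that continue its walk
  without backtracking. Walks of length \<open>i + 1\<close> from \<open>u\<close> are determined by
  their ends, so these sets of neighbours are disjoint.\<close>

lemma card_heavy:
  assumes i: "Suc i \<le> l" and h': "2 \<le> h'"
  shows "finite (heavy h' i u)" "card (heavy h' i u) * (h' - 1) \<le> card V"
proof -
  define H where "H = heavy h' i u"
  note H_def = H_def[unfolded heavy_def]
  have fin: "finite H"
  proof (rule finite_subset[OF _ finV], rule)
    fix w assume "w \<in> H"
    hence "N w \<noteq> {}" using h' by (auto simp: H_def)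
    thus "w \<in> V" using edge_V by (auto simp: N_iff)
  qed
  obtain P where P: "rwalk E (u # P w)" "length (P w) = i" "last (u # P w) = w" if "w \<in> H" for w
  proof -
    have "\<forall>w\<in>H. \<exists>p. rwalk E (u # p) \<and> length p = i \<and> last (u # p) = w" by (simp add: H_def)
    from bchoice[OF this] that show ?thesis by blast
  qed
  define C where "C w = {y. rwalk E ((u # P w) @ [y])}" for w
  have card: "finite (C w) \<and> h' - 1 \<le> card (C w) \<and> C w \<subseteq> V" if w: "w \<in> H" for w
  proof -
    define q where "q = butlast (u # P w)"
    have q: "u # P w = q @ [w]" using P[OF w] by (metis append_butlast_last_id list.distinct(1) q_def)
    have C: "C w = {y \<in> N w. q = [] \<or> last q \<noteq> y}"
      using P(1)[OF w] unfolding C_def q by (auto simp: rwalk_snoc N_iff)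
    have "N w - {last q} \<subseteq> C w" unfolding C by auto
    hence "card (N w - {last q}) \<le> card (C w)" by (intro card_mono) (auto simp: C)
    moreover have "deg w - 1 \<le> card (N w - {last q})" by (simp add: card_Diff_singleton_if)
    moreover have "h' \<le> deg w" using w by (simp add: H_def)
    ultimately show ?thesis using C N_sub by auto
  qed
  have disj: "C w \<inter> C w' = {}" if w: "w \<in> H" "w' \<in> H" "w \<noteq> w'" for w w'
  proof (rule ccontr)
    assume "C w \<inter> C w' \<noteq> {}"
    then obtain y where y: "rwalk E (u # P w @ [y])" "rwalk E (u # P w' @ [y])" by (auto simp: C_def)
    have "P w @ [y] = P w' @ [y]"
      by (rule uniq[OF y]) (use P(2)[OF w(1)] P(2)[OF w(2)] i gl in auto)
    thus False using P(3)[OF w(1)] P(3)[OF w(2)] w(3) by simp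
  qed
  have "card H * (h' - 1) = (\<Sum>w\<in>H. h' - 1)" by simp
  also have "\<dots> \<le> (\<Sum>w\<in>H. card (C w))" using card by (intro sum_mono) auto
  also have "\<dots> = card (\<Union>w\<in>H. C w)"
  proof (rule card_UN_disjoint[symmetric])
    show "\<forall>w\<in>H. finite (C w)" using card by blast
    show "\<forall>w\<in>H. \<forall>w'\<in>H. w \<noteq> w' \<longrightarrow> C w \<inter> C w' = {}" using disj by blast
  qed (rule fin)
  also have "\<dots> \<le> card V" by (rule card_mono[OF finV]) (use card in blast)
  finally have "card H * (h' - 1) \<le> card V" .
  thus "finite (heavy h' i u)" "card (heavy h' i u) * (h' - 1) \<le> card V"
    using fin by (simp_all add: heavy_def H_def)
qed

text \<open>Every listed vertex has degree at least \<open>h2\<close> and lies \<open>l - 1\<close>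
  steps behind a neighbour of \<open>u\<close>, so \<open>card_heavy\<close> bounds the entries that
  each of the fewer than \<open>h1\<close> neighbours contributes. Conversely, an overflow forces
  degree at least \<open>h1\<close>.\<close>

lemma card_lst_low_degree:
  assumes "deg u < h1" shows "card (lst u x) \<le> M"
proof -
  let ?H = "heavy h2 (l - 1)"
  have l: "Suc (l - 1) \<le> l" "2 \<le> h2" using l1 h by auto
  have "lst u x \<subseteq> (\<Union>a\<in>N u. ?H a)"
  proof
    fix v assume "v \<in> lst u x"
    then obtain a s p where p: "{a, u} \<in> E" "rwalk E (u # a # p)" "length p = l"
      "v = (a # p) ! (l - 1)" "h2 \<le> deg v" by (rule lst_walk)
    have "rwalk E (take l (a # p))" by (rule rwalk_take[OF rwalk_tl[OF p(2)]]) (use l1 in simp)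
    moreover have t: "take l (a # p) = a # take (l - 1) p" using l1 by (cases l) auto
    moreover have "take l (a # p) = take (l - 1) (a # p) @ [v]"
      using p l1 take_Suc_conv_app_nth[of "l - 1" "a # p"] by simp
    hence "last (a # take (l - 1) p) = v" unfolding t by (metis last_snoc)
    ultimately have "rwalk E (a # take (l - 1) p)" "last (a # take (l - 1) p) = v" by simp_all
    moreover have "length (take (l - 1) p) = l - 1" using p by simp
    ultimately have "v \<in> ?H a" using p unfolding heavy_def by blast
    thus "v \<in> (\<Union>a\<in>N u. ?H a)" using p by (auto simp: N_iff insert_commute)
  qed
  hence "card (lst u x) \<le> card (\<Union>a\<in>N u. ?H a)"
    by (rule card_mono[rotated]) (use card_heavy(1)[OF l] in auto)
  also have "\<dots> \<le> (\<Sum>a\<in>N u. card (?H a))" by (rule card_UN_le) simp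
  finally have "card (lst u x) * (h2 - 1) \<le> (\<Sum>a\<in>N u. card (?H a)) * (h2 - 1)" by (rule mult_right_mono) simp
  also have "\<dots> = (\<Sum>a\<in>N u. card (?H a) * (h2 - 1))" by (rule sum_distrib_right)
  also have "\<dots> \<le> (\<Sum>a\<in>N u. card V)" by (rule sum_mono) (rule card_heavy(2)[OF l])
  also have "\<dots> \<le> h1 * card V" using assms by simp
  also have "\<dots> \<le> M * (h2 - 1)" by (rule M_listed)
  finally show ?thesis using l by simp
qed

text \<open>The predecessors of \<open>v\<close> on the walks from different \<open>y\<close> to \<open>x\<close> are distinct; if there were more than
  \<open>\<tau>\<close> of them, \<open>X\<close> would contain one that covers \<open>v\<close>.\<close>

lemma card_listing_nbrs:
  assumes x: "x \<in> V" and v: "v \<in> V"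
  shows "card {y \<in> N x. v \<in> lst y x} \<le> \<tau>"
proof (rule ccontr)
  define Y where "Y = {y \<in> N x. v \<in> lst y x}"
  assume "\<not> ?thesis"
  hence large: "\<tau> < card Y" by (simp add: Y_def)
  define Q where "Q y a p \<longleftrightarrow> a \<noteq> x \<and> {a, y} \<in> E \<and> rwalk E (x # y # a # p) \<and> length p = l \<and>
    v = (a # p) ! (l - 1)" for y a p
  have "\<exists>a p. Q y a p" if y: "y \<in> Y" for y
  proof -
    have v: "v \<in> lst y x" and xy: "{x, y} \<in> E" using y by (auto simp: Y_def N_iff)
    show ?thesis
    proof (rule lst_walk[OF v])
      fix a s p assume "{a, y} \<in> E" "a \<noteq> x" "rwalk E (y # a # p)" "length p = l" "v = (a # p) ! (l - 1)"
      hence "Q y a p" using xy by (simp add: Q_def)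
      thus ?thesis by blast
    qed
  qed
  hence "\<forall>y\<in>Y. \<exists>r. Q y (fst r) (snd r)" by simp
  from bchoice[OF this] obtain F where F: "\<forall>y\<in>Y. Q y (fst (F y)) (snd (F y))" by blast
  define A P where "A y = fst (F y)" and "P y = snd (F y)" for y
  have AP: "A y \<noteq> x" "{A y, y} \<in> E" "rwalk E (x # y # A y # P y)" "length (P y) = l"
    "v = (A y # P y) ! (l - 1)" if "y \<in> Y" for y
    using F that by (simp_all add: Q_def A_def P_def)
  \<comment> \<open>In \<open>y # A y # P y\<close> the vertex \<open>v\<close> has index
    \<open>l\<close>, so \<open>w y\<close> is its predecessor, reached from \<open>x\<close> after
    \<open>l\<close> steps.\<close>
  define w where "w y = (y # A y # P y) ! (l - 1)" for y
  have w: "rwalk E (x # take l (y # A y # P y))" "last (take l (y # A y # P y)) = w y"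
    "{w y, v} \<in> E" if y: "y \<in> Y" for y
  proof -
    have "rwalk E (take (Suc l) (x # y # A y # P y))" by (rule rwalk_take[OF AP(3)[OF y]]) simp
    thus "rwalk E (x # take l (y # A y # P y))" by simp
    show "last (take l (y # A y # P y)) = w y"
      using AP(4)[OF y] l1 take_Suc_conv_app_nth[of "l - 1" "y # A y # P y"] by (simp add: w_def)
    have "{(y # A y # P y) ! (l - 1), (y # A y # P y) ! Suc (l - 1)} \<in> E"
      using AP(3,4)[OF y] rwalk_tl[OF AP(3)[OF y]] l1 unfolding rwalk_iff_nth by simp
    thus "{w y, v} \<in> E" using AP(5)[OF y] l1 by (simp add: w_def)
  qed
  \<comment> \<open>Walks of length \<open>l\<close> from \<open>x\<close> are determined by their
    ends, and \<open>y\<close> is the first step.\<close>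
  have injw: "inj_on w Y"
  proof (rule inj_onI)
    fix y y' assume y: "y \<in> Y" "y' \<in> Y" "w y = w y'"
    have "take l (y # A y # P y) = take l (y' # A y' # P y')"
    proof (rule uniq[OF w(1)[OF y(1)] w(1)[OF y(2)]])
      show "last (x # take l (y # A y # P y)) = last (x # take l (y' # A y' # P y'))"
        using w(2)[OF y(1)] w(2)[OF y(2)] y(3) l1 by simp
    qed (use AP(4) y gl in simp)
    thus "y = y'" using l1 by (cases l) auto
  qed
  obtain y0 where y0: "y0 \<in> Y" using large by (metis card.empty equals0I not_less_zero)
  \<comment> \<open>Removing \<open>w y0\<close> allows the walk from \<open>y0\<close> to
    \<open>v\<close> to be extended to a sampled \<open>s\<close> without backtracking. As
    \<open>card Y\<close> exceeds \<open>\<tau>\<close> strictly, enough vertices remain.\<close>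
  let ?S = "{u \<in> N v. \<exists>p. rwalk E (x # p) \<and> length p = l \<and> last p = u} - {w y0}"
  have "w ` Y - {w y0} \<subseteq> ?S"
  proof
    fix u assume "u \<in> w ` Y - {w y0}"
    then obtain y where y: "y \<in> Y" "u = w y" "u \<noteq> w y0" by auto
    have "u \<in> N v" using w(3)[OF y(1)] y by (simp add: N_iff insert_commute)
    moreover have "length (take l (y # A y # P y)) = l" using AP(4)[OF y(1)] by simp
    ultimately show "u \<in> ?S" using w(1,2)[OF y(1)] y by blast
  qed
  hence "card (w ` Y - {w y0}) \<le> card ?S" by (rule card_mono[rotated]) simp
  moreover have "card (w ` Y - {w y0}) = card Y - 1" using y0 injw by (simp add: card_image)
  ultimately have "\<tau> \<le> card ?S" using large by linarith
  moreover have "w y0 \<in> V" using w(3)[OF y0] edge_V by blast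
  ultimately have "\<exists>s\<in>X. s \<in> ?S" using hit_walks[OF v x] by blast
  then obtain s p where s: "s \<in> X" "{v, s} \<in> E" "s \<noteq> w y0"
    and p: "rwalk E (x # p)" "length p = l" "last p = s" by (auto simp: N_iff)
  have pne: "p \<noteq> []" using p l1 by auto
  obtain q0 where q0: "q0 = take l (y0 # A y0 # P y0)" by simp
  have full: "take (Suc l) (y0 # A y0 # P y0) = q0 @ [v]"
    using AP(4,5)[OF y0] l1 take_Suc_conv_app_nth[of l "y0 # A y0 # P y0"] by (simp add: q0 nth_Cons')
  have "rwalk E (take (Suc l) (y0 # A y0 # P y0))" by (rule rwalk_take[OF rwalk_tl[OF AP(3)[OF y0]]]) simp
  hence "rwalk E (q0 @ [v])" using full by simp
  moreover have q0l: "length q0 = l" "q0 \<noteq> []" using AP(4)[OF y0] l1 by (auto simp: q0)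
  ultimately have vs: "rwalk E (q0 @ [v, s])"
    using s w(2)[OF y0] by (simp add: rwalk_snoc q0)
  have tl: "q0 = y0 # tl q0" using l1 by (cases l) (auto simp: q0)
  \<comment> \<open>Otherwise two walks of different lengths \<open>l - 1\<close> and
    \<open>l + 1\<close>, less than \<open>g\<close> in total, would join \<open>y0\<close> to
    \<open>s\<close>.\<close>
  have "hd p \<noteq> y0"
  proof
    assume "hd p = y0"
    then obtain p' where p': "p = y0 # p'" using pne by (cases p) auto
    have "rwalk E (y0 # p')" using p(1) p' rwalk_tl by blast
    moreover have "rwalk E (y0 # tl q0 @ [v, s])" using vs tl by (metis append_Cons)
    ultimately have "p' = tl q0 @ [v, s]"
      by (rule uniq) (use p p' q0l gl l1 in auto)
    thus False using p p' q0l by auto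
  qed
  moreover have xy0: "{x, y0} \<in> E" using y0 by (simp add: Y_def N_iff)
  ultimately have "rwalk E (y0 # x # p)" using p(1) pne by (simp add: rwalk_Cons insert_commute)
  hence 1: "\<exists>b v'. Probe b s v' \<in> got l x y0"
    using probe_complete[of l y0 x p] p pne s by (metis last_ConsR order_refl)
  define r where "r = tl (tl (q0 @ [v, s]))"
  have r: "q0 @ [v, s] = y0 # A y0 # r"
  proof (cases "l = 1")
    case True
    have "q0 = [y0]" unfolding q0 True by simp
    moreover have "A y0 = v" using AP(5)[OF y0] unfolding True by (simp only: diff_self_eq_0 nth_Cons_0)
    ultimately show ?thesis unfolding r_def by (simp only: append.simps list.sel)
  next
    case False
    hence "l = Suc (Suc (l - 2))" using l1 by simp
    then obtain m where m: "l = Suc (Suc m)" by blast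
    show ?thesis unfolding r_def q0 m by simp
  qed
  have rl: "length r = l" using arg_cong[OF r, of length] q0l by simp
  have "last (A y0 # r) = s" using arg_cong[OF r, of last] by simp
  moreover have "(A y0 # r) ! (l - 1) = v"
  proof -
    have "(q0 @ [v, s]) ! l = v" using q0l by (simp add: nth_append)
    thus ?thesis using r l1 by (simp add: nth_Cons')
  qed
  ultimately obtain b where b: "Probe b s v \<in> got l (A y0) y0"
    using probe_complete[of l y0 "A y0" r] vs r rl s by auto
  obtain b' v' where b': "Probe b' s v' \<in> got l x y0" using 1 by blast
  \<comment> \<open>Now \<open>s\<close> has reached \<open>y0\<close> both with first hop
    \<open>v\<close> and through \<open>x\<close>, which removes \<open>v\<close> from the
    list.\<close>
  have "v \<in> lst y0 x" using y0 by (simp add: Y_def)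
  moreover have "A y0 \<in> N y0" using AP(2)[OF y0] by (simp add: N_iff insert_commute)
  ultimately show False by (rule lst_uncovered[OF _ _ AP(1)[OF y0] b order_refl b'])
qed

lemma sum_card_swap_le:
  assumes "finite A" "finite B" "\<And>a. a \<in> A \<Longrightarrow> L a \<subseteq> B" "\<And>b. b \<in> B \<Longrightarrow> card {a \<in> A. b \<in> L a} \<le> t"
  shows "(\<Sum>a\<in>A. card (L a)) \<le> card B * t"
proof -
  have "(\<Sum>a\<in>A. card (L a)) = card (Sigma A L)"
    by (rule card_SigmaI[symmetric]) (use assms finite_subset in blast)+
  also have "\<dots> = card (prod.swap ` Sigma A L)" by (rule card_image[symmetric]) simp
  also have "\<dots> \<le> card (Sigma B (\<lambda>b. {a \<in> A. b \<in> L a}))"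
  proof (rule card_mono)
    show "prod.swap ` Sigma A L \<subseteq> (SIGMA b:B. {a \<in> A. b \<in> L a})" using assms(3) by fastforce
  qed (use assms(1,2) in auto)
  also have "\<dots> = (\<Sum>b\<in>B. card {a \<in> A. b \<in> L a})"
    by (rule card_SigmaI) (use assms in auto)
  also have "\<dots> \<le> (\<Sum>b\<in>B. t)" by (rule sum_mono) (rule assms(4))
  finally show ?thesis by simp
qed

text \<open>Double counting: an overflowing neighbour lists more than \<open>M\<close> vertices to
  \<open>x\<close>, and each vertex is listed by at most \<open>\<tau>\<close> neighbours.\<close>

lemma card_overflow:
  assumes x: "x \<in> V"
  shows "card {y \<in> N x. Overflow \<in> got (Suc l) y x} * M \<le> card V * \<tau>"
proof -
  define B where "B = {y \<in> N x. Overflow \<in> got (Suc l) y x}"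
  define L where "L y = lst y x" for y
  have B: "B \<subseteq> N x" by (auto simp: B_def)
  have "card B * M = (\<Sum>y\<in>B. M)" by simp
  also have "\<dots> \<le> (\<Sum>y\<in>B. card (L y))"
  proof (rule sum_mono)
    fix y assume "y \<in> B"
    hence "{y, x} \<in> E" "Overflow \<in> got (Suc l) y x" by (auto simp: B_def N_iff insert_commute)
    from overflow_lst[OF this] show "M \<le> card (L y)" by (simp add: L_def)
  qed
  also have "\<dots> \<le> (\<Sum>y\<in>N x. card (L y))" by (rule sum_mono2[OF finN B]) simp
  also have "\<dots> \<le> card V * \<tau>"
  proof (rule sum_card_swap_le[OF finN finV])
    show "L y \<subseteq> V" for y unfolding L_def by (rule lst_sub)
    show "card {y \<in> N x. v \<in> L y} \<le> \<tau>" if "v \<in> V" for v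
      unfolding L_def by (rule card_listing_nbrs[OF x that])
  qed
  finally show ?thesis by (simp add: B_def)
qed

text \<open>A relayed name belongs to an overflowing neighbour of a vertex of degree at least
  \<open>h1\<close> that is \<open>i\<close> steps away from \<open>u\<close>. The bounds of
  \<open>card_heavy\<close> and \<open>card_overflow\<close> are multiplied; carrying the factor
  \<open>M * (h1 - 1)\<close> avoids division.\<close>

lemma got_due_relay:
  assumes i: "i < l" and ux: "{u, x} \<in> E"
  shows "got (Suc (Suc l) + i) u x = due (Suc (Suc l) + i) u x"
proof (rule got_eq)
  let ?H = "heavy h1 i u"
  let ?B = "\<lambda>w. {y \<in> N w. Overflow \<in> got (Suc l) y w}"
  have il: "Suc i \<le> l" using i by simp
  have "due (Suc (Suc l) + i) u x \<subseteq> (\<Union>w\<in>?H. Relay ` ?B w)"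
  proof
    fix t assume t: "t \<in> due (Suc (Suc l) + i) u x"
    then obtain p where tp: "t = Relay p"
      by (cases i) (auto simp: due_relay_0 due_relay_Suc[simplified])
    obtain q where q: "rwalk E (x # u # q)" "length q = Suc i" "last q = p" "h1 \<le> deg ((u # q) ! i)"
      "Overflow \<in> got (Suc l) p ((u # q) ! i)"
      using relay_sound[OF i ux] t tp by blast
    let ?w = "(u # q) ! i"
    have "rwalk E (take (Suc i) (u # q))" by (rule rwalk_take[OF rwalk_tl[OF q(1)]]) simp
    moreover have "take (Suc i) (u # q) = take i (u # q) @ [?w]"
      by (rule take_Suc_conv_app_nth) (use q in simp)
    hence "last (u # take i q) = ?w" by simp
    moreover have "length (take i q) = i" using q by simp
    ultimately have "rwalk E (u # take i q) \<and> length (take i q) = i \<and> last (u # take i q) = ?w" by simp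
    hence "?w \<in> ?H" using q(4) unfolding heavy_def by blast
    moreover have "{?w, (u # q) ! Suc i} \<in> E"
      using rwalk_tl[OF q(1)] q(2) unfolding rwalk_iff_nth by simp
    moreover have "(u # q) ! Suc i = p" using q by (metis last_conv_nth diff_Suc_1 length_0_conv nat.distinct(1) nth_Cons_Suc)
    ultimately have "?w \<in> ?H" "p \<in> ?B ?w" using q by (auto simp: N_iff)
    thus "t \<in> (\<Union>w\<in>?H. Relay ` ?B w)" using tp by blast
  qed
  hence "card (due (Suc (Suc l) + i) u x) \<le> card (\<Union>w\<in>?H. Relay ` ?B w)"
    by (rule card_mono[rotated]) (use card_heavy(1)[OF il h(3)] in auto)
  also have "\<dots> \<le> (\<Sum>w\<in>?H. card (Relay ` ?B w))" by (rule card_UN_le) (use card_heavy(1)[OF il h(3)] in auto)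
  also have "\<dots> \<le> (\<Sum>w\<in>?H. card (?B w))" by (rule sum_mono) (rule card_image_le, simp)
  finally have "card (due (Suc (Suc l) + i) u x) * M \<le> (\<Sum>w\<in>?H. card (?B w)) * M" by (rule mult_right_mono) simp
  also have "\<dots> = (\<Sum>w\<in>?H. card (?B w) * M)" by (rule sum_distrib_right)
  also have "\<dots> \<le> (\<Sum>w\<in>?H. card V * \<tau>)"
  proof (rule sum_mono)
    fix w assume "w \<in> ?H"
    hence "N w \<noteq> {}" using h by (auto simp: heavy_def)
    hence "w \<in> V" using edge_V by (auto simp: N_iff)
    thus "card (?B w) * M \<le> card V * \<tau>" by (rule card_overflow)
  qed
  finally have "card (due (Suc (Suc l) + i) u x) * M * (h1 - 1) \<le> card ?H * (card V * \<tau>) * (h1 - 1)"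
    by (intro mult_right_mono) auto
  also have "\<dots> = (card ?H * (h1 - 1)) * (card V * \<tau>)" by (simp only: ac_simps)
  also have "\<dots> \<le> card V * (card V * \<tau>)" by (intro mult_right_mono card_heavy(2)[OF il h(3)]) simp
  also have "\<dots> \<le> M * (M * (h1 - 1))" by (rule M_relay)
  finally have "card (due (Suc (Suc l) + i) u x) * (M * (h1 - 1)) \<le> M * (M * (h1 - 1))" by (simp only: ac_simps)
  moreover have "0 < M * (h1 - 1)" using M1 h by simp
  ultimately show "card (due (Suc (Suc l) + i) u x) \<le> M" by (simp only: mult_le_cancel2)
qed (use assms in auto)

section \<open>Completeness of a stage: a shortest cycle is detected\<close>

abbreviation "unsampled \<equiv> \<forall>c. cyc E g c \<longrightarrow> c 0 \<notin> X"

text \<open>If no shortest cycle meets the sample, uniqueness of walks to a sampled node extends to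
  total length \<open>g\<close>: the closed walk would be a shortest cycle through that
  node.\<close>

lemma rwalk_to_X_unique:
  assumes free: "\<And>p. is_cycle E p \<Longrightarrow> length p = g \<Longrightarrow> set p \<inter> X = {}"
    and a: "rwalk E (x # a)" and b: "rwalk E (x # b)" and ne: "a \<noteq> []" "b \<noteq> []" "hd a \<noteq> hd b"
    and s: "last a = s" "last b = s" "s \<in> X" and len: "length a + length b \<le> g"
  shows False
proof -
  have "rwalk E (rev (x # a))" using a by (simp only: rwalk_rev)
  hence "rwalk E (rev a @ [x])" by simp
  hence w: "rwalk E (rev a @ x # b)" by (rule rwalk_join[OF _ b]) (use ne in \<open>simp add: last_rev\<close>)
  have hd: "hd (rev a @ x # b) = s" using ne s by (simp add: hd_append hd_rev)
  have l2: "2 \<le> length (rev a @ x # b)" using ne by (cases a) auto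
  have c: "is_cycle E (butlast (rev a @ x # b))"
    by (rule short_closed_rwalk_is_cycle[OF loopfree w l2])
       (use hd ne s len girth in auto)
  have "girth E \<le> enat (length (butlast (rev a @ x # b)))" by (rule is_cycle_girth[OF c])
  hence "length (butlast (rev a @ x # b)) = g" using len girth by simp
  from free[OF c this] have "s \<notin> set (butlast (rev a @ x # b))" using s by auto
  moreover have "s \<in> set (butlast (rev a @ x # b))"
  proof -
    have "s \<in> set (rev a)" using s ne by (metis last_in_set set_rev)
    thus ?thesis using ne by (auto simp: butlast_append)
  qed
  ultimately show False by simp
qed

lemma cyc_edge: "cyc E g c \<Longrightarrow> {c i, c (i + 1)} \<in> E" by (simp add: cyc_def)

lemma cyc_V: "cyc E g c \<Longrightarrow> c i \<in> V" using cyc_edge edge_V by blast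

lemma cyc_not_X:
  assumes free: unsampled and c: "cyc E g c" shows "c i \<notin> X"
  using free cyc_shift[OF c, of i] by fastforce

lemma free_cycles:
  assumes free: unsampled shows "is_cycle E p \<Longrightarrow> length p = g \<Longrightarrow> set p \<inter> X = {}"
  using is_cycle_cyc free by (metis disjoint_iff)

lemma detectsI:
  assumes c: "cyc E g c" and l: "evidence l (seen (c (int l + 1))) z (c (int l)) l"
    and j: "evidence l (seen (c (int l + 1))) z (c (int l + 2)) j" "l + j + 2 \<le> g"
  shows "detects l g (seen (c (int l + 1))) (N (c (int l + 1)))"
proof -
  have "c (int l) \<in> N (c (int l + 1))" "c (int l + 2) \<in> N (c (int l + 1))"
    using cyc_edge[OF c, of "int l"] cyc_edge[OF c, of "int l + 1"]
    by (auto simp: N_iff insert_commute algebra_simps)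
  moreover have "c (int l) \<noteq> c (int l + 2)"
    by (rule cyc_neq[OF c]) (use c in \<open>auto simp: cyc_def\<close>)
  ultimately show ?thesis unfolding detects_def using l j by blast
qed

text \<open>Counted in the other direction from \<open>c 0\<close>, the detecting vertex is
  \<open>l + 1\<close> steps away for even \<open>g\<close> but only \<open>l\<close> steps for odd
  \<open>g\<close>.\<close>

lemma cyc_opposite:
  assumes c: "cyc E g c"
  shows "g = 2 * l + 2 \<Longrightarrow> c (- (int l + 1)) = c (int l + 1) \<and> c (- int l) = c (int l + 2)"
    and "g = 2 * l + 1 \<Longrightarrow> c (- int l) = c (int l + 1) \<and> c (- (int l - 1)) = c (int l + 2)"
proof -
  have p: "c (i - int g) = c i" for i using cyc_period[OF c, of "i - int g"] by simp
  show "g = 2 * l + 2 \<Longrightarrow> c (- (int l + 1)) = c (int l + 1) \<and> c (- int l) = c (int l + 2)"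
    and "g = 2 * l + 1 \<Longrightarrow> c (- int l) = c (int l + 1) \<and> c (- (int l - 1)) = c (int l + 2)"
    using p[of "int l + 1"] p[of "int l + 2"] by (simp_all add: algebra_simps)
qed

lemma detects_symmetric:
  assumes c: "cyc E g c" and ev: "\<And>d i. d = c \<or> d = (\<lambda>i. c (- i)) \<Longrightarrow> i \<le> l \<Longrightarrow>
      evidence l (seen (d (int i + 1))) (c 0) (d (int i)) i"
  shows "detects l g (seen (c (int l + 1))) (N (c (int l + 1)))"
proof -
  have 1: "evidence l (seen (c (int l + 1))) (c 0) (c (int l)) l" using ev[of c l] by simp
  show ?thesis
  proof (cases "g = 2 * l + 2")
    case True
    show ?thesis
      using ev[of "\<lambda>i. c (- i)" l] cyc_opposite(1)[OF c True] True by (intro detectsI[OF c 1, of l]) auto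
  next
    case False
    hence g: "g = 2 * l + 1" using gl by simp
    show ?thesis
      using ev[of "\<lambda>i. c (- i)" "l - 1"] cyc_opposite(2)[OF c g] g l1
      by (intro detectsI[OF c 1, of "l - 1"]) (auto simp: of_nat_diff)
  qed
qed

lemma rwalk_down_Suc: "cyc E g c \<Longrightarrow> rwalk E (down c m)"
  using rwalk_down[of E g c "[]" m] by simp

lemma complete_sampled:
  assumes c: "cyc E g c" and X: "c 0 \<in> X"
  shows "detects l g (seen (c (int l + 1))) (N (c (int l + 1)))"
proof (rule detects_symmetric[OF c])
  fix d i assume d: "d = c \<or> d = (\<lambda>i. c (- i))" and i: "i \<le> l"
  have dc: "cyc E g d" using d c cyc_reflect by auto
  have d0: "d 0 = c 0" using d by auto
  obtain p where p: "down d i = d (int i) # p" by (cases i) auto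
  have "rwalk E (d (int i + 1) # d (int i) # p)"
    using rwalk_down_Suc[OF dc, of "Suc i"] p by (simp add: add.commute)
  moreover have "length p = i" using arg_cong[OF p, of length] by simp
  moreover have "last (d (int i) # p) = c 0" using d0 p last_down[of d i] by simp
  ultimately have "\<exists>b v. Probe b (c 0) v \<in> got i (d (int i)) (d (int i + 1))"
    using probe_complete[OF i, of "d (int i + 1)" "d (int i)" p] X by metis
  thus "evidence l (seen (d (int i + 1))) (c 0) (d (int i)) i"
    using i by (auto simp: evidence_def)
qed

lemma complete_low:
  assumes c: "cyc E g c" and low: "\<And>i. deg (c i) < h2"
  shows "detects l g (seen (c (int l + 1))) (N (c (int l + 1)))"
proof (rule detects_symmetric[OF c])
  fix d i assume d: "d = c \<or> d = (\<lambda>i. c (- i))" and i: "i \<le> l"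
  have dc: "cyc E g d" using d c cyc_reflect by auto
  have d0: "d 0 = c 0" using d by auto
  obtain p where p: "down d i = d (int i) # p" by (cases i) auto
  have "rwalk E (d (int i + 1) # d (int i) # p)"
    using rwalk_down_Suc[OF dc, of "Suc i"] p by (simp add: add.commute)
  moreover have "length p = i" using arg_cong[OF p, of length] by simp
  moreover have "last (d (int i) # p) = c 0" using d0 p last_down[of d i] by simp
  moreover have "\<forall>w\<in>set (d (int i) # p). deg w < h2"
    using set_down[of d i] d low unfolding p by (auto simp del: set_simps)
  ultimately have "Low (c 0) \<in> got i (d (int i)) (d (int i + 1))"
    using low_complete[OF i, of "d (int i + 1)" "d (int i)" p] by metis
  thus "evidence l (seen (d (int i + 1))) (c 0) (d (int i)) i"
    using i by (auto simp: evidence_def)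
qed

text \<open>Starting outside the cycle costs a step: after \<open>l\<close> steps the token of
  \<open>s\<close> is at \<open>c (l - 1)\<close>, which sends it to \<open>c l\<close> only. This
  is why \<open>c l\<close> has to name \<open>c 0\<close> to \<open>c (l + 1)\<close> in a further
  phase.\<close>

lemma probe_along:
  assumes c: "cyc E g c" and s: "s \<in> X" "{c 0, s} \<in> E" "s \<noteq> c 1"
  shows "Probe (h2 \<le> deg (c 0)) s (c 0) \<in> got l (c (int l - 1)) (c (int l))"
proof -
  obtain m where m: "l = Suc m" using l1 by (cases l) auto
  have w: "rwalk E (down c l @ [s])" by (rule rwalk_down[OF c]) (use s in auto)
  obtain p where p: "down c m @ [s] = c (int m) # p" by (cases m) auto
  have "rwalk E (c (int l) # c (int m) # p)" using w m p by simp
  moreover have "length p = l" using arg_cong[OF p, of length] m by simp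
  moreover have "last (c (int m) # p) = s" unfolding p[symmetric] by simp
  moreover have "(c (int m) # p) ! (l - 1) = c 0" unfolding p[symmetric] m by simp
  ultimately show ?thesis using probe_complete[of l "c (int l)" "c (int m)" p] s l1 m by simp
qed

lemma sampled_nbr:
  assumes free: unsampled and c: "cyc E g c" and d: "h1 \<le> deg (c 0)"
  obtains s where "s \<in> X" "{c 0, s} \<in> E" "\<And>i. s \<noteq> c i"
proof -
  have "N (c 0) \<inter> X \<noteq> {}" by (rule hit_nbrs[OF cyc_V[OF c]]) (use d h in simp)
  then obtain s where s: "s \<in> X" "{c 0, s} \<in> E" by (auto simp: N_iff)
  moreover have "s \<noteq> c i" for i using cyc_not_X[OF free c] s by metis
  ultimately show ?thesis by (rule that)
qed

text \<open>If a sampled neighbour \<open>s'\<close> of \<open>c 0\<close> caused \<open>c 0\<close>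
  to be dropped, two walks of total length at most \<open>g\<close> would lead from
  \<open>c (l + 1)\<close> to \<open>s'\<close>, one along the cycle and one traced by the probe.
  Then \<open>s'\<close> would lie on a shortest cycle.\<close>

lemma listed_along:
  assumes free: unsampled and c: "cyc E g c" and d: "h2 \<le> deg (c 0)"
  shows "c 0 \<in> lst (c (int l)) (c (int l + 1))"
proof -
  let ?y = "c (int l)" and ?x = "c (int l + 1)" and ?a = "c (int l - 1)"
  have xy: "{?x, ?y} \<in> E" using cyc_edge[OF c, of "int l"] by (simp add: insert_commute)
  have ay: "?a \<in> N ?y" using cyc_edge[OF c, of "int l - 1"] by (simp add: N_iff insert_commute)
  have ax: "?a \<noteq> ?x" by (rule cyc_neq[OF c]) (use c in \<open>auto simp: cyc_def\<close>)
  obtain s where s: "s \<in> X" "{c 0, s} \<in> E" "\<And>i. s \<noteq> c i"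
    using sampled_nbr[OF free c] d h by (metis order_trans)
  have pr: "Probe True s (c 0) \<in> got l ?a ?y" using probe_along[OF c s(1,2) s(3)] d by simp
  have "False" if a: "a \<in> N ?y" "a \<noteq> ?x" and P: "Probe b s' (c 0) \<in> got l a ?y" and j: "j \<le> l"
    and P': "Probe b' s' v' \<in> got j ?x ?y" for a b s' j b' v'
  proof -
    have ae: "{a, ?y} \<in> E" using a by (simp add: N_iff insert_commute)
    have "Probe b s' (c 0) \<in> due l a ?y" using P got_due[OF order_refl ae] by simp
    then obtain p where p: "rwalk E (?y # a # p)" "length p = l" "last (a # p) = s'" "s' \<in> X"
      "c 0 = (a # p) ! (l - 1)" using probe_sound[OF order_refl ae] by blast
    have "Probe b' s' v' \<in> due j ?x ?y" using P' got_due[OF j xy] by simp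
    then obtain q where q: "rwalk E (?y # ?x # q)" "length q = j" "last (?x # q) = s'"
      using probe_sound[OF j xy] by blast
    have qne: "q \<noteq> []"
    proof
      assume "q = []"
      hence "s' = ?x" using q by simp
      thus False using p(4) cyc_not_X[OF free c] by simp
    qed
    have hdq: "hd q \<noteq> ?y" using q(1) qne by (cases q) auto
    have xq: "rwalk E (?x # q)" using q(1) rwalk_tl by blast
    obtain m where m: "l = Suc m" using l1 by (cases l) auto
    have tk: "take l (a # p) = take m (a # p) @ [c 0]"
      using p(2,5) m take_Suc_conv_app_nth[of m "a # p"] by simp
    have "rwalk E (take (Suc l) (?y # a # p))" by (rule rwalk_take[OF p(1)]) simp
    hence 1: "rwalk E (?y # take l (a # p))" by simp
    have 2: "rwalk E (?y # down c m)" using rwalk_down_Suc[OF c, of l] m by simp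
    have eq: "take l (a # p) = down c m"
      by (rule uniq[OF 1 2]) (use tk p(2) m gl in simp_all)
    have "a # p = take l (a # p) @ [s']"
    proof -
      have "drop l (a # p) = [s']"
        using p(2,3) by (metis Cons_nth_drop_Suc append_butlast_last_id butlast_conv_take diff_Suc_1 length_Cons list.distinct(1) append_take_drop_id same_append_eq)
      thus ?thesis by (metis append_take_drop_id)
    qed
    hence ap: "a # p = down c m @ [s']" using eq by simp
    have s'C: "s' \<noteq> c i" for i using p(4) cyc_not_X[OF free c] by metis
    have s'e: "{c 0, s'} \<in> E"
    proof -
      have "{(a # p) ! m, (a # p) ! Suc m} \<in> E"
        using rwalk_tl[OF p(1)] p(2) m unfolding rwalk_iff_nth by simp
      thus ?thesis using nth_down_append[of c m "[]"] unfolding ap by (simp add: nth_append)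
    qed
    have yl: "last q = s'" using q(3) qne by simp
    show False
    proof (cases "g = 2 * l + 2")
      case True
      \<comment> \<open>For even \<open>g\<close> the walk through \<open>c l\<close> has
        \<open>l + 2\<close> edges and the other one at most \<open>l\<close>.\<close>
      have "rwalk E (down c (Suc l) @ [s'])" by (rule rwalk_down[OF c]) (use s'e s'C in auto)
      hence w: "rwalk E (?x # down c l @ [s'])" by (simp add: add.commute)
      show False
        by (rule rwalk_to_X_unique[OF free_cycles[OF free] w xq _ qne _ _ yl p(4)])
           (use hdq q(2) j True in \<open>auto simp: hd_append\<close>)
    next
      case False
      hence g: "g = 2 * l + 1" using gl by simp
      \<comment> \<open>For odd \<open>g\<close> that walk is one edge too long, so the cycle is
        followed in the other direction, which gives \<open>l + 1\<close> edges.\<close>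
      define c' where "c' = (\<lambda>i. c (- i))"
      have c': "cyc E g c'" unfolding c'_def by (rule cyc_reflect[OF c])
      have "c' (int l) = ?x" using cyc_period[OF c, of "- int l"] g by (simp add: c'_def algebra_simps)
      hence x: "c' (int (Suc m)) = ?x" using m by simp
      have c'0: "c' 0 = c 0" and s'C': "s' \<noteq> c' i" for i using s'C by (simp_all add: c'_def)
      have e': "rwalk E (c' 0 # [s'])" using s'e c'0 by simp
      have w: "rwalk E (?x # down c' m @ [s'])"
        using rwalk_down[OF c' e', of "Suc m"] s'C' x by simp
      \<comment> \<open>Walks with the same first step would coincide by uniqueness, but one has
        \<open>l + 1\<close> edges and the other at most \<open>l\<close>.\<close>
      have "hd q \<noteq> c' (int m)"
      proof
        assume h: "hd q = c' (int m)"
        have "rwalk E q" using xq qne rwalk_tl by (cases q) auto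
        moreover have "rwalk E (down c' m @ [s'])" using rwalk_down[OF c' e', of m] s'C' by simp
        ultimately have "q = down c' m @ [s']"
          by (rule rwalk_unique'[OF loopfree])
             (use h yl q(2) j g girth m in \<open>auto simp: hd_append\<close>)
        thus False using q(2) j m by simp
      qed
      thus False
        by (intro rwalk_to_X_unique[OF free_cycles[OF free] w xq _ qne _ _ yl p(4)])
           (use q(2) j g m in \<open>auto simp: hd_append\<close>)
    qed
  qed
  thus ?thesis unfolding listed_def using ay ax pr by auto
qed

lemma listed_complete:
  assumes free: unsampled and c: "cyc E g c" and d: "h2 \<le> deg (c 0)"
    and M: "card (lst (c (int l)) (c (int l + 1))) \<le> M"
  shows "evidence l (seen (c (int l + 1))) (c 0) (c (int l)) l"
proof -
  have "Listed (c 0) \<in> got (Suc l) (c (int l)) (c (int l + 1))"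
    using listed_along[OF free c d] M got_due_listed[OF cyc_edge[OF c]] by (simp add: due_listed)
  thus ?thesis by (simp add: evidence_def)
qed

text \<open>Two walks with \<open>l + 1\<close> edges from \<open>u\<close> to a sampled node have
  total length \<open>g\<close>. So different entries come from different sampled nodes, and there
  are at most \<open>card X\<close> of them.\<close>

lemma card_lst_even:
  assumes free: unsampled and g: "g = 2 * l + 2"
  shows "card (lst u x) \<le> M"
proof -
  define Q where "Q v s \<longleftrightarrow> s \<in> X \<and> (\<exists>a p. rwalk E (u # a # p) \<and> length p = l \<and> last (a # p) = s \<and>
    v = (a # p) ! (l - 1))" for v s
  have "\<exists>s. Q v s" if "v \<in> lst u x" for v
    by (rule lst_walk[OF that]) (unfold Q_def, blast)
  hence "\<forall>v\<in>lst u x. \<exists>s. Q v s" by blast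
  from bchoice[OF this] obtain S where QS: "\<forall>v\<in>lst u x. Q v (S v)" by blast
  have S: "S v \<in> X" "\<exists>a p. rwalk E (u # a # p) \<and> length p = l \<and> last (a # p) = S v \<and> v = (a # p) ! (l - 1)"
    if "v \<in> lst u x" for v using QS that by (auto simp only: Q_def)
  have "inj_on S (lst u x)"
  proof (rule inj_onI)
    fix v v' assume v: "v \<in> lst u x" "v' \<in> lst u x" "S v = S v'"
    obtain a p where p: "rwalk E (u # a # p)" "length p = l" "last (a # p) = S v" "v = (a # p) ! (l - 1)"
      using S(2)[OF v(1)] by blast
    obtain a' p' where p': "rwalk E (u # a' # p')" "length p' = l" "last (a' # p') = S v" "v' = (a' # p') ! (l - 1)"
      using S(2)[OF v(2)] v(3) by metis
    show "v = v'"
    proof (cases "a = a'")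
      case True
      have "p = p'"
        by (rule uniq[OF rwalk_tl[OF p(1)]]) (use rwalk_tl[OF p'(1)] p p' g True in auto)
      thus ?thesis using p p' True by simp
    next
      case False
      have False
        by (rule rwalk_to_X_unique[OF free_cycles[OF free] p(1) p'(1) _ _ _ p(3) p'(3) S(1)[OF v(1)]])
           (use p p' g False in auto)
      thus ?thesis ..
    qed
  qed
  hence "card (lst u x) \<le> card X" by (rule card_inj_on_le) (use S finX in auto)
  thus ?thesis using XM by simp
qed

lemma complete_even:
  assumes free: unsampled and g: "g = 2 * l + 2"
    and c: "cyc E g c" and d: "h2 \<le> deg (c 0)"
  shows "detects l g (seen (c (int l + 1))) (N (c (int l + 1)))"
proof (rule detectsI[OF c listed_complete[OF free c d card_lst_even[OF free g]]])
  have "h2 \<le> deg ((\<lambda>i. c (- i)) 0)" using d by simp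
  from listed_complete[OF free cyc_reflect[OF c] this card_lst_even[OF free g]]
  show "evidence l (seen (c (int l + 1))) (c 0) (c (int l + 2)) l"
    using cyc_opposite(1)[OF c g] by simp
qed (use g in simp)

lemma first_hop_evidence:
  assumes free: unsampled and g: "g = 2 * l + 1"
    and c: "cyc E g c" and d: "h1 \<le> deg (c 0)"
  shows "evidence l (seen (c (int l + 1))) (c 0) (c (int l + 2)) (l - 1)"
proof -
  define c' where "c' = (\<lambda>i. c (- i))"
  have c': "cyc E g c'" and d': "h1 \<le> deg (c' 0)" using cyc_reflect[OF c] d by (simp_all add: c'_def)
  obtain s where s: "s \<in> X" "{c' 0, s} \<in> E" "\<And>i. s \<noteq> c' i"
    using sampled_nbr[OF free c' d'] by metis
  have "c' (int l) = c (int l + 1)" "c' (int l - 1) = c (int l + 2)"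
    using cyc_opposite(2)[OF c g] by (simp_all add: c'_def)
  hence "\<exists>b. Probe b s (c 0) \<in> got l (c (int l + 2)) (c (int l + 1))"
    using probe_along[OF c' s(1,2) s(3)] by (auto simp: c'_def)
  moreover obtain m where "l = Suc m" using l1 by (cases l) auto
  ultimately show ?thesis by (auto simp: evidence_def)
qed

lemma complete_odd_listed:
  assumes free: unsampled and g: "g = 2 * l + 1"
    and c: "cyc E g c" and d: "h2 \<le> deg (c 0)"
    and M: "card (lst (c (int l)) (c (int l + 1))) \<le> M"
  shows "detects l g (seen (c (int l + 1))) (N (c (int l + 1)))"
  using detectsI[OF c listed_complete[OF free c d M] first_hop_evidence[OF free g c]] d h g l1 by simp

lemma relay_along:
  assumes c: "cyc E g c" and d: "h1 \<le> deg (c 1)" and ov: "Overflow \<in> got (Suc l) (c 0) (c 1)"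
  shows "i < l \<Longrightarrow> Relay (c 0) \<in> got (Suc (Suc l) + i) (c (int i + 1)) (c (int i + 2))"
proof (induction i)
  case 0
  have ne: "c 0 \<noteq> c 2" by (rule cyc_neq[OF c]) (use c in \<open>auto simp: cyc_def\<close>)
  have "c 0 \<in> N (c 1)" using cyc_edge[OF c, of 0] by (simp add: N_iff insert_commute)
  moreover have "{c 1, c 2} \<in> E" using cyc_edge[OF c, of 1] by simp
  ultimately show ?case using got_due_relay[OF 0, of "c 1" "c 2"] d ov ne by (simp add: due_relay_0)
next
  case (Suc i)
  have ne: "c (int i + 1) \<noteq> c (int i + 3)" by (rule cyc_neq[OF c]) (use c in \<open>auto simp: cyc_def\<close>)
  have "c (int i + 1) \<in> N (c (int i + 2))"
    using cyc_edge[OF c, of "int i + 1"] by (simp add: N_iff insert_commute algebra_simps)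
  moreover have "{c (int i + 2), c (int i + 3)} \<in> E"
    using cyc_edge[OF c, of "int i + 2"] by (simp add: algebra_simps)
  moreover have "Relay (c 0) \<in> got (Suc (Suc l) + i) (c (int i + 1)) (c (int i + 2))"
    using Suc by simp
  ultimately have "Relay (c 0) \<in> due (Suc (Suc l) + Suc i) (c (int i + 2)) (c (int i + 3))"
    unfolding due_relay_Suc using ne by blast
  hence "Relay (c 0) \<in> got (Suc (Suc l) + Suc i) (c (int i + 2)) (c (int i + 3))"
    using got_due_relay[OF Suc.prems] \<open>{c (int i + 2), c (int i + 3)} \<in> E\<close> by blast
  thus ?case by (simp add: algebra_simps)
qed

text \<open>The relayed name of \<open>c 0\<close> runs along the cycle from \<open>c 1\<close> to
  \<open>c (l + 1)\<close>, where it meets the first hop \<open>c 0\<close> arriving from the other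
  side.\<close>

lemma complete_odd_overflow:
  assumes free: unsampled and g: "g = 2 * l + 1" and c: "cyc E g c"
    and d: "h1 \<le> deg (c 0)" "h1 \<le> deg (c 1)" and ov: "Overflow \<in> got (Suc l) (c 0) (c 1)"
  shows "detects l g (seen (c (int l + 1))) (N (c (int l + 1)))"
proof (rule detectsI[OF c _ first_hop_evidence[OF free g c d(1)]])
  obtain m where m: "l = Suc m" using l1 by (cases l) auto
  have "Relay (c 0) \<in> got (Suc (Suc l) + m) (c (int m + 1)) (c (int m + 2))"
    by (rule relay_along[OF c d(2) ov]) (use m in simp)
  hence "Relay (c 0) \<in> got (Suc l + l) (c (int l)) (c (int l + 1))"
    using m by (simp add: algebra_simps)
  thus "evidence l (seen (c (int l + 1))) (c 0) (c (int l)) l"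
    using l1 by (simp add: evidence_def)
qed (use g l1 in simp)

lemma complete_odd:
  assumes free: unsampled and g: "g = 2 * l + 1"
    and c: "cyc E g c" and d: "h2 \<le> deg (c 0)"
  shows "\<exists>x\<in>V. detects l g (seen x) (N x)"
proof -
  define c' where "c' = (\<lambda>i. c (- i))"
  have c': "cyc E g c'" and d': "h2 \<le> deg (c' 0)" using cyc_reflect[OF c] d by (simp_all add: c'_def)
  have p: "c (i - int g) = c i" for i using cyc_period[OF c, of "i - int g"] by simp
  have eq: "c' (int l) = c (int l + 1)" "c' (int l + 1) = c (int l)"
    using p[of "int l + 1"] p[of "int l"] g by (simp_all add: c'_def algebra_simps)
  show ?thesis
  proof (cases "card (lst (c (int l)) (c (int l + 1))) \<le> M")
    case True
    thus ?thesis using complete_odd_listed[OF free g c d] cyc_V[OF c] by blast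
  next
    case F1: False
    show ?thesis
    proof (cases "card (lst (c' (int l)) (c' (int l + 1))) \<le> M")
      case True
      thus ?thesis using complete_odd_listed[OF free g c' d'] cyc_V[OF c'] by blast
    next
      case F2: False
      \<comment> \<open>Both lists along the edge opposite to \<open>c 0\<close> are too long, so
        both its ends have large degree; after a rotation \<open>c l\<close> takes the role of
        \<open>c 0\<close>.\<close>
      have "h1 \<le> deg (c (int l))" "h1 \<le> deg (c (int l + 1))"
        using F1 F2 card_lst_low_degree unfolding eq by (meson not_le)+
      moreover have "Overflow \<in> got (Suc l) (c (int l)) (c (int l + 1))"
        using F1 got_due_listed[OF cyc_edge[OF c]] by (simp add: due_listed)
      ultimately show ?thesis
        using complete_odd_overflow[OF free g cyc_shift[OF c, of "int l"]] cyc_V[OF c]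
        by (simp add: add.commute) blast
    qed
  qed
qed

theorem stage_complete: "\<exists>x\<in>V. detects l g (seen x) (N x)"
proof (cases unsampled)
  case False
  thus ?thesis using complete_sampled cyc_V by blast
next
  case free: True
  obtain p where p: "is_cycle E p" "length p = g" by (rule girth_cycle[OF girth])
  hence "hd p \<in> set p" by (intro hd_in_set) (auto simp: is_cycle_def)
  then obtain c where c: "cyc E g c" using is_cycle_cyc[OF p(1)] p(2) by metis
  show ?thesis
  proof (cases "\<exists>i. h2 \<le> deg (c i)")
    case False
    thus ?thesis using complete_low[OF c] cyc_V[OF c] by (meson not_le)
  next
    case True
    then obtain i where "h2 \<le> deg (c i)" by blast
    hence d: "h2 \<le> deg ((\<lambda>j. c (j + i)) 0)" by simp
    note ci = cyc_shift[OF c, of i]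
    show ?thesis
    proof (cases "g = 2 * l + 2")
      case True
      thus ?thesis using complete_even[OF free True ci d] cyc_V[OF ci] by blast
    next
      case False
      hence "g = 2 * l + 1" using gl by simp
      thus ?thesis by (rule complete_odd[OF free _ ci d])
    qed
  qed
qed

end

section \<open>Pipelined breadth-first search\<close>

text \<open>\<open>Dist d s p\<close> carries a distance, its source and the parent from which it
  was learnt. Tokens with parent \<open>v\<close> are ignored, which keeps the underlying walks
  non-backtracking.\<close>

definition bfs_known :: "nat \<Rightarrow> nat set \<Rightarrow> (nat \<Rightarrow> token set) \<Rightarrow> (nat \<times> nat \<times> nat) set" where
  "bfs_known v N R = insert (0, v, v) {(Suc d, s, y) | d s y. \<exists>p. y \<in> N \<and> p \<noteq> v \<and> Dist d s p \<in> R y}"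

definition bfs_cands :: "nat \<Rightarrow> nat set \<Rightarrow> (nat \<Rightarrow> token set) \<Rightarrow> token set \<Rightarrow> (nat \<times> nat) set" where
  "bfs_cands v N R sent = {(d, s). (\<exists>y. (d, s, y) \<in> bfs_known v N R) \<and>
     (\<forall>d' y. (d', s, y) \<in> bfs_known v N R \<longrightarrow> d \<le> d') \<and> (\<forall>p. Dist d s p \<notin> sent)}"

definition bfs_next :: "nat \<Rightarrow> nat set \<Rightarrow> (nat \<Rightarrow> token set) \<Rightarrow> token set \<Rightarrow> token option" where
  "bfs_next v N R sent = (let C = bfs_cands v N R sent in
     if C = {} then None
     else let d = (LEAST d. \<exists>s. (d, s) \<in> C); s = (LEAST s. (d, s) \<in> C) in
       Some (Dist d s (SOME y. (d, s, y) \<in> bfs_known v N R)))"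

definition bfs_cycle :: "nat \<Rightarrow> nat set \<Rightarrow> (nat \<Rightarrow> token set) \<Rightarrow> nat \<Rightarrow> bool" where
  "bfs_cycle x N R k \<longleftrightarrow> (\<exists>y y' d d' s p p'. y \<in> N \<and> y' \<in> N \<and> y \<noteq> y' \<and> p \<noteq> x \<and> p' \<noteq> x \<and>
     Dist d s p \<in> R y \<and> Dist d' s p' \<in> R y' \<and> k = d + d' + 2)"

lemma bfs_next_Some:
  assumes "bfs_next v N R sent = Some t"
  obtains d s y where "t = Dist d s y" "(d, s, y) \<in> bfs_known v N R" "(d, s) \<in> bfs_cands v N R sent"
    "\<And>d' s'. (d', s') \<in> bfs_cands v N R sent \<Longrightarrow> d < d' \<or> d = d' \<and> s \<le> s'"
proof -
  define C where "C = bfs_cands v N R sent"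
  define d where "d = (LEAST d. \<exists>s. (d, s) \<in> C)"
  define s where "s = (LEAST s. (d, s) \<in> C)"
  define y where "y = (SOME y. (d, s, y) \<in> bfs_known v N R)"
  have ne: "C \<noteq> {}" and t: "t = Dist d s y"
    using assms by (auto simp: bfs_next_def C_def d_def s_def y_def Let_def split: if_splits)
  have "\<exists>d s. (d, s) \<in> C" using ne by auto
  hence "\<exists>s. (d, s) \<in> C" unfolding d_def by (rule LeastI_ex)
  hence ds: "(d, s) \<in> C" unfolding s_def by (rule LeastI_ex)
  hence "\<exists>y. (d, s, y) \<in> bfs_known v N R" by (auto simp: C_def bfs_cands_def)
  hence y: "(d, s, y) \<in> bfs_known v N R" unfolding y_def by (rule someI_ex)
  have "d < d' \<or> d = d' \<and> s \<le> s'" if "(d', s') \<in> C" for d' s'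
  proof -
    have "d \<le> d'" unfolding d_def by (rule Least_le) (use that in blast)
    moreover have "s \<le> s'" if "d = d'"
      unfolding s_def by (rule Least_le) (use that \<open>(d', s') \<in> C\<close> in blast)
    ultimately show ?thesis by linarith
  qed
  with t y ds show ?thesis unfolding C_def by (rule that)
qed

lemma bfs_next_None: "bfs_next v N R sent = None \<longleftrightarrow> bfs_cands v N R sent = {}"
  by (simp add: bfs_next_def Let_def)

abbreviation past :: "(nat \<Rightarrow> nat \<Rightarrow> 'a option) \<Rightarrow> nat \<Rightarrow> nat \<Rightarrow> 'a set" where
  "past b t \<equiv> \<lambda>y. {m. \<exists>t'<t. b t' y = Some m}"

text \<open>\<open>b t v\<close> is the broadcast of \<open>v\<close> in round \<open>t\<close>, and
  \<open>W\<close> stands for the tokens that can be encoded. The second assumption serves to show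
  that no broadcast is suppressed during the \<open>T\<close> rounds.\<close>

locale bfs_run = graph +
  fixes T :: nat and b :: "nat \<Rightarrow> nat \<Rightarrow> token option" and W :: "token set"
  assumes b: "\<And>t v. t < T \<Longrightarrow> v \<in> V \<Longrightarrow>
      b t v = (case bfs_next v (neighbours E v) (past b t)
                 (past b t v) of
               None \<Rightarrow> None | Some m \<Rightarrow> if m \<in> W then Some m else None)"
    and W: "\<And>d s p. d < T \<Longrightarrow> s \<in> V \<Longrightarrow> p \<in> V \<Longrightarrow> Dist d s p \<in> W"
begin

definition known :: "nat \<Rightarrow> nat \<Rightarrow> (nat \<times> nat \<times> nat) set" where
  "known t v = bfs_known v (N v) (past b t)"

definition cands :: "nat \<Rightarrow> nat \<Rightarrow> (nat \<times> nat) set" where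
  "cands t v = bfs_cands v (N v) (past b t) (past b t v)"

lemma known_iff: "(d, s, y) \<in> known t v \<longleftrightarrow> (d = 0 \<and> s = v \<and> y = v) \<or>
    (\<exists>e p t'. d = Suc e \<and> y \<in> N v \<and> p \<noteq> v \<and> t' < t \<and> b t' y = Some (Dist e s p))"
  by (auto simp: known_def bfs_known_def)

lemma cands_iff: "(d, s) \<in> cands t v \<longleftrightarrow> (\<exists>y. (d, s, y) \<in> known t v) \<and> (\<forall>d' y. (d', s, y) \<in> known t v \<longrightarrow> d \<le> d') \<and>
    (\<forall>p t'. t' < t \<longrightarrow> b t' v \<noteq> Some (Dist d s p))"
  unfolding cands_def known_def bfs_cands_def by auto

lemma known_mono: "t \<le> t' \<Longrightarrow> known t v \<subseteq> known t' v"
  by (auto simp: known_iff) (meson order_less_le_trans)+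

lemma message_cases:
  assumes "t < T" "v \<in> V" "b t v = Some m"
  obtains d s y where "m = Dist d s y" "(d, s, y) \<in> known t v" "(d, s) \<in> cands t v"
    "\<And>d' s'. (d', s') \<in> cands t v \<Longrightarrow> d < d' \<or> d = d' \<and> s \<le> s'"
proof -
  have "bfs_next v (N v) (past b t) (past b t v) = Some m"
    using b[OF assms(1,2)] assms(3) by (auto split: option.splits if_splits)
  thus ?thesis
  proof (rule bfs_next_Some)
    fix d s y
    assume "m = Dist d s y"
      "(d, s, y) \<in> bfs_known v (N v) (past b t)"
      "(d, s) \<in> bfs_cands v (N v) (past b t) (past b t v)"
      "\<And>d' s'. (d', s') \<in> bfs_cands v (N v) (past b t)
        (past b t v) \<Longrightarrow> d < d' \<or> d = d' \<and> s \<le> s'"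
    thus ?thesis unfolding known_def[symmetric] cands_def[symmetric] by (rule that)
  qed
qed

lemma message_known:
  assumes "t < T" "v \<in> V" "b t v = Some (Dist d s p)" shows "(d, s, p) \<in> known t v"
  by (rule message_cases[OF assms]) simp

text \<open>A distance cannot exceed the number of rounds it has travelled; this places all tokens
  in \<open>W\<close>.\<close>

lemma known_bound: "t < T \<Longrightarrow> v \<in> V \<Longrightarrow> (d, s, p) \<in> known t v \<Longrightarrow> d \<le> t \<and> s \<in> V \<and> p \<in> V"
proof -
  have "(\<forall>v\<in>V. \<forall>d s p. (d, s, p) \<in> known t v \<longrightarrow> d \<le> t \<and> s \<in> V \<and> p \<in> V) \<and>
    (\<forall>v\<in>V. \<forall>d s p. b t v = Some (Dist d s p) \<longrightarrow> d \<le> t \<and> s \<in> V \<and> p \<in> V)" if "t < T" for t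
    using that
  proof (induction t rule: less_induct)
    case (less t)
    have 1: "d \<le> t \<and> s \<in> V \<and> p \<in> V" if v: "v \<in> V" and k: "(d, s, p) \<in> known t v" for v d s p
      using k unfolding known_iff
    proof (elim disjE conjE exE)
      assume "d = 0" "s = v" "p = v" thus ?thesis using v by simp
    next
      fix e q t' assume e: "d = Suc e" "p \<in> N v" "t' < t" "b t' p = Some (Dist e s q)"
      have "p \<in> V" using e(2) edge_V by (auto simp: N_iff)
      thus ?thesis using less.IH[OF e(3)] e less.prems by fastforce
    qed
    moreover have "d \<le> t \<and> s \<in> V \<and> p \<in> V" if v: "v \<in> V" and bs: "b t v = Some (Dist d s p)" for v d s p
      using v
      by (rule 1) (rule message_cases[OF less.prems v bs], simp)
    ultimately show ?case by blast
  qed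
  thus "t < T \<Longrightarrow> v \<in> V \<Longrightarrow> (d, s, p) \<in> known t v \<Longrightarrow> d \<le> t \<and> s \<in> V \<and> p \<in> V" by blast
qed

lemma message_exists:
  assumes t: "t < T" and v: "v \<in> V" and ds: "(d, s) \<in> cands t v"
  obtains d1 s1 y1 where "b t v = Some (Dist d1 s1 y1)" "(d1, s1) \<in> cands t v"
    "d1 < d \<or> d1 = d \<and> s1 \<le> s"
proof -
  let ?n = "bfs_next v (N v) (past b t) (past b t v)"
  have "?n \<noteq> None" using ds unfolding bfs_next_None cands_def by auto
  then obtain m where m: "?n = Some m" by auto
  obtain d1 s1 y1 where 1: "m = Dist d1 s1 y1" "(d1, s1, y1) \<in> known t v"
    "(d1, s1) \<in> cands t v" "\<And>d' s'. (d', s') \<in> cands t v \<Longrightarrow> d1 < d' \<or> d1 = d' \<and> s1 \<le> s'"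
    by (rule bfs_next_Some[OF m, folded known_def cands_def]) blast
  have "m \<in> W" using known_bound[OF t v 1(2)] t 1(1) W by simp
  hence "b t v = Some (Dist d1 s1 y1)" using b[OF t v] m 1(1) by simp
  thus ?thesis using 1(3) 1(4)[OF ds] that by blast
qed

text \<open>The parents lead back to the source, and the filter in \<open>bfs_known\<close> prevents
  backtracking.\<close>

lemma bfs_walk:
  "t < T \<Longrightarrow> b t y = Some (Dist d s p) \<Longrightarrow> {x, y} \<in> E \<Longrightarrow> p \<noteq> x \<Longrightarrow>
   \<exists>q. rwalk E (x # y # q) \<and> length q = d \<and> last (y # q) = s"
proof (induction d arbitrary: t x y p)
  case (0 t)
  have yV: "y \<in> V" using 0 edge_V by blast
  have "(0, s, p) \<in> known t y" by (rule message_known[OF 0(1) yV 0(2)])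
  hence "s = y" by (simp add: known_iff)
  thus ?case using 0 by (intro exI[of _ "[]"]) simp
next
  case (Suc d t)
  have yV: "y \<in> V" using Suc.prems edge_V by blast
  have "(Suc d, s, p) \<in> known t y" by (rule message_known[OF Suc.prems(1) yV Suc.prems(2)])
  then obtain q t' where q: "p \<in> N y" "q \<noteq> y" "t' < t" "b t' p = Some (Dist d s q)" by (auto simp: known_iff)
  have "t' < T" using q Suc.prems by simp
  then obtain r where "rwalk E (y # p # r)" "length r = d" "last (p # r) = s"
    using Suc.IH[of t' p q y] q by (auto simp: N_iff)
  thus ?case using Suc.prems by (intro exI[of _ "p # r"]) auto
qed

lemma bfs_cycle_sound:
  assumes "bfs_cycle x (N x) (past b T) k"
  shows "girth E \<le> enat k"
proof -
  obtain y y' d d' s p p' t t' where 1: "y \<in> N x" "y' \<in> N x" "y \<noteq> y'" "p \<noteq> x" "p' \<noteq> x"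
    "t < T" "b t y = Some (Dist d s p)" "t' < T" "b t' y' = Some (Dist d' s p')" "k = d + d' + 2"
    using assms unfolding bfs_cycle_def by blast
  obtain q where q: "rwalk E (x # y # q)" "length q = d" "last (y # q) = s"
    using bfs_walk[OF 1(6,7) _ 1(4)] 1(1) by (auto simp: N_iff)
  obtain q' where q': "rwalk E (x # y' # q')" "length q' = d'" "last (y' # q') = s"
    using bfs_walk[OF 1(8,9) _ 1(5)] 1(2) by (auto simp: N_iff)
  have "girth E \<le> enat (length (x # y # q) + length (x # y' # q') - 2)"
    by (rule rwalk_unique[OF loopfree q(1) q'(1)]) (use q q' 1 in auto)
  thus ?thesis using q q' 1 by simp
qed

section \<open>Graph distances and the delay of the broadcasts\<close>

definition arcs :: "(nat \<times> nat) set" where "arcs = {(x, y). {x, y} \<in> E}"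

definition reach :: "nat \<Rightarrow> nat \<Rightarrow> bool" where "reach s v \<longleftrightarrow> (\<exists>d. (s, v) \<in> arcs ^^ d)"

definition hops :: "nat \<Rightarrow> nat \<Rightarrow> nat" where "hops s v = (LEAST d. (s, v) \<in> arcs ^^ d)"

lemma hops_le: "(s, v) \<in> arcs ^^ d \<Longrightarrow> hops s v \<le> d"
  unfolding hops_def by (rule Least_le)

lemma hops_walk: "reach s v \<Longrightarrow> (s, v) \<in> arcs ^^ hops s v"
  unfolding hops_def reach_def by (rule LeastI_ex)

lemma reach_step: "reach s v \<Longrightarrow> {v, w} \<in> E \<Longrightarrow> reach s w \<and> hops s w \<le> Suc (hops s v)"
proof -
  assume "reach s v" "{v, w} \<in> E"
  hence "(s, w) \<in> arcs ^^ Suc (hops s v)" using hops_walk by (auto simp: arcs_def intro: relcompI)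
  thus ?thesis using hops_le unfolding reach_def by blast
qed

lemma hops_pred:
  assumes "reach s v" "hops s v = Suc d"
  obtains w where "{w, v} \<in> E" "reach s w" "hops s w = d"
proof -
  have "(s, v) \<in> arcs ^^ Suc d" using hops_walk[OF assms(1)] assms(2) by simp
  then obtain w where w: "(s, w) \<in> arcs ^^ d" "{w, v} \<in> E" by (auto simp: arcs_def)
  have r: "reach s w" using w by (auto simp: reach_def)
  have "hops s w = d" using hops_le[OF w(1)] reach_step[OF r w(2)] assms(2) by simp
  thus ?thesis using that w r by blast
qed

lemma hops_0 [simp]: "hops v v = 0" and reach_refl [simp]: "reach v v"
  using hops_le[of v v 0] by (auto simp: reach_def intro: exI[of _ 0])

lemma hops_eq_0: "reach s v \<Longrightarrow> hops s v = 0 \<Longrightarrow> s = v"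
  using hops_walk[of s v] by simp

text \<open>A shortest path visits vertices at every distance from 0 to
  \<open>hops s v\<close>.\<close>

lemma hops_less_card: "reach s v \<Longrightarrow> v \<in> V \<Longrightarrow> hops s v < card V"
proof -
  have "reach s v \<Longrightarrow> v \<in> V \<Longrightarrow> {..hops s v} \<subseteq> hops s ` V" for v
  proof (induction "hops s v" arbitrary: v)
    case 0
    thus ?case by (metis atMost_0 hops_0 hops_eq_0 image_eqI empty_subsetI insert_subset)
  next
    case (Suc d)
    then obtain w where w: "{w, v} \<in> E" "reach s w" "hops s w = d" using hops_pred by metis
    have "{..d} \<subseteq> hops s ` V" using Suc.hyps(1)[of w] w edge_V by blast
    moreover have "{..hops s v} = insert (hops s v) {..d}" using Suc.hyps(2) by auto
    ultimately show ?case using Suc.prems by auto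
  qed
  moreover assume "reach s v" "v \<in> V"
  ultimately have "card {..hops s v} \<le> card V"
    using finV by (meson card_image_le card_mono finite_imageI order_trans)
  thus ?thesis by simp
qed

lemma known_hops: "t < T \<Longrightarrow> v \<in> V \<Longrightarrow> (d, s, y) \<in> known t v \<Longrightarrow> reach s v \<and> hops s v \<le> d"
proof (induction d arbitrary: t v y)
  case 0 thus ?case by (simp add: known_iff)
next
  case (Suc d)
  then obtain q t' where q: "y \<in> N v" "q \<noteq> v" "t' < t" "b t' y = Some (Dist d s q)" by (auto simp: known_iff)
  have yV: "y \<in> V" and yv: "{y, v} \<in> E" using q edge_V by (auto simp: N_iff insert_commute)
  have t': "t' < T" using q Suc.prems by simp
  have "(d, s, q) \<in> known t' y" by (rule message_known[OF t' yV q(4)])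
  from Suc.IH[OF t' yV this] have "reach s y" "hops s y \<le> d" by auto
  thus ?case using reach_step[OF _ yv] by force
qed

text \<open>Used to show that tokens are accepted: a vertex \<open>x\<close> is not the parent in a
  token \<open>Dist d s p\<close> of a neighbour if \<open>d \<le> hops s x\<close>.\<close>

lemma parent_closer:
  assumes "t < T" "v \<in> V" "b t v = Some (Dist d s p)" shows "p = v \<and> d = 0 \<or> hops s p < d"
proof -
  have k: "(d, s, p) \<in> known t v" by (rule message_known[OF assms])
  show ?thesis
  proof (cases d)
    case 0 thus ?thesis using k by (simp add: known_iff)
  next
    case (Suc e)
    then obtain q t' where q: "p \<in> N v" "t' < t" "b t' p = Some (Dist e s q)" using k by (auto simp: known_iff)
    have pV: "p \<in> V" using q edge_V by (auto simp: N_iff)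
    have t': "t' < T" using q assms by simp
    have "(e, s, q) \<in> known t' p" by (rule message_known[OF t' pV q(3)])
    from known_hops[OF t' pV this] Suc show ?thesis by simp
  qed
qed

text \<open>\<open>card (before v s)\<close> is the rank of \<open>s\<close> among the sources at
  \<open>v\<close>, ordered by distance and then by identifier.\<close>

definition before :: "nat \<Rightarrow> nat \<Rightarrow> nat set" where
  "before v s = {s' \<in> V. reach s' v \<and> (hops s' v < hops s v \<or> hops s' v = hops s v \<and> s' < s)}"

lemma fin_before: "finite (before v s)" using finV by (simp add: before_def)

lemma card_before: "s \<in> V \<Longrightarrow> card (before v s) < card V"
  by (rule psubset_card_mono[OF finV]) (auto simp: before_def)

text \<open>From \<open>w\<close> to \<open>v\<close> the distance of \<open>s\<close> grows by
  exactly one and every other distance by at most one, so no source loses its lead over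
  \<open>s\<close>.\<close>

lemma before_step:
  assumes "{w, v} \<in> E" "hops s v = Suc (hops s w)" shows "card (before w s) \<le> card (before v s)"
proof (rule card_mono[OF fin_before], rule)
  fix s' assume "s' \<in> before w s"
  thus "s' \<in> before v s" using reach_step[OF _ assms(1), of s'] assms(2) by (auto simp: before_def)
qed

lemma before_psubset:
  assumes "s' \<in> before v s" shows "card (before v s') < card (before v s)"
  by (rule psubset_card_mono[OF fin_before]) (use assms in \<open>auto simp: before_def\<close>)

text \<open>The pairs that precede \<open>(hops s v, s)\<close> at \<open>v\<close> have a smaller sum of distance and rank, and so does
  the pair of \<open>s\<close> at a neighbour of \<open>v\<close> closer to \<open>s\<close>; hence by the time of that sum everything that
  could delay the pair has been sent.\<close>

lemma bfs_sent:
  "v \<in> V \<Longrightarrow> s \<in> V \<Longrightarrow> reach s v \<Longrightarrow> hops s v + card (before v s) < T \<Longrightarrow>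
   \<exists>t \<le> hops s v + card (before v s). \<exists>p. b t v = Some (Dist (hops s v) s p)"
proof (induction "hops s v + card (before v s)" arbitrary: v s rule: less_induct)
  case less
  define m where "m = hops s v + card (before v s)"
  have mT: "m < T" using less.prems by (simp add: m_def)
  show ?case
  proof (rule ccontr)
    assume "\<not> ?thesis"
    hence not_sent: "b t v \<noteq> Some (Dist (hops s v) s p)" if "t \<le> m" for t p
      using that unfolding m_def by blast
    have "\<exists>y. (hops s v, s, y) \<in> known m v"
    proof (cases "hops s v")
      case 0
      thus ?thesis using hops_eq_0 less.prems by (auto simp: known_iff)
    next
      case (Suc e)
      obtain w where w: "{w, v} \<in> E" "reach s w" "hops s w = e" using hops_pred[OF less.prems(3) Suc] by metis
      have wV: "w \<in> V" using w edge_V by blast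
      have "card (before w s) \<le> card (before v s)" using before_step[OF w(1)] w Suc by simp
      hence lt: "hops s w + card (before w s) < m" using w Suc by (simp add: m_def)
      have "\<exists>t \<le> hops s w + card (before w s). \<exists>p. b t w = Some (Dist (hops s w) s p)"
        by (rule less.hyps) (use lt mT wV w less.prems in \<open>auto simp: m_def\<close>)
      then obtain t p where t: "t < m" "b t w = Some (Dist e s p)"
        using lt w(3) by (metis order_le_less_trans)
      have tT: "t < T" using t mT by simp
      have "p \<noteq> v"
      proof
        assume "p = v"
        with parent_closer[OF tT wV t(2)] have "v = w \<and> e = 0 \<or> hops s v < e" by simp
        thus False using Suc w by auto
      qed
      moreover have "w \<in> N v" using w by (simp add: N_iff insert_commute)
      ultimately have "(Suc e, s, w) \<in> known m v" using t unfolding known_iff by blast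
      thus ?thesis using Suc by auto
    qed
    moreover have "hops s v \<le> d'" if "(d', s, y) \<in> known m v" for d' y
      using known_hops[OF mT less.prems(1) that] by simp
    ultimately have "(hops s v, s) \<in> cands m v" using not_sent unfolding cands_iff by auto
    \<comment> \<open>The pair of \<open>s\<close> is a candidate in round \<open>m\<close> but is
      not sent, so a lexicographically smaller pair is sent instead.\<close>
    from message_exists[OF mT less.prems(1) this] obtain d1 s1 y1 where 1: "b m v = Some (Dist d1 s1 y1)"
      "(d1, s1) \<in> cands m v" "d1 < hops s v \<or> d1 = hops s v \<and> s1 \<le> s" by metis
    obtain z where z: "(d1, s1, z) \<in> known m v" using 1(2) by (auto simp: cands_iff)
    have g1: "reach s1 v" "hops s1 v \<le> d1" using known_hops[OF mT less.prems(1) z] by auto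
    have s1V: "s1 \<in> V" using known_bound[OF mT less.prems(1) z] by simp
    have "d1 = hops s v \<longrightarrow> s1 \<noteq> s" using not_sent[OF order_refl] 1(1) by auto
    hence bf: "s1 \<in> before v s" using g1 s1V 1(3) by (auto simp: before_def)
    have "card (before v s1) < card (before v s)" by (rule before_psubset[OF bf])
    moreover have "hops s1 v \<le> hops s v" using bf by (auto simp: before_def)
    ultimately have lt: "hops s1 v + card (before v s1) < m" by (simp add: m_def)
    \<comment> \<open>By induction the pair of \<open>s1\<close> with its true distance was sent
      before round \<open>m\<close>. Then \<open>d1\<close> is that distance, and a pair already
      sent is no candidate.\<close>
    have "\<exists>t \<le> hops s1 v + card (before v s1). \<exists>p. b t v = Some (Dist (hops s1 v) s1 p)"
      by (rule less.hyps) (use lt mT g1 s1V less.prems in \<open>auto simp: m_def\<close>)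
    then obtain t p where t: "t < m" "b t v = Some (Dist (hops s1 v) s1 p)"
      using lt by (metis order_le_less_trans)
    have tT: "t < T" using t mT by simp
    have "(hops s1 v, s1, p) \<in> known t v" by (rule message_known[OF tT less.prems(1) t(2)])
    hence "(hops s1 v, s1, p) \<in> known m v" using known_mono[of t m v] t by auto
    hence "d1 \<le> hops s1 v" using 1(2) by (auto simp: cands_iff)
    hence "d1 = hops s1 v" using g1 by simp
    thus False using 1(2) t by (auto simp: cands_iff)
  qed
qed

lemma hops_cyc:
  assumes c: "cyc E g c" shows "reach (c 0) (c (int i)) \<and> hops (c 0) (c (int i)) \<le> i"
proof (induction i)
  case 0 thus ?case by simp
next
  case (Suc i)
  have "{c (int i), c (int i + 1)} \<in> E" using c unfolding cyc_def by blast
  hence "{c (int i), c (int (Suc i))} \<in> E" by (simp add: add.commute)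
  thus ?case using reach_step[of "c 0" "c (int i)" "c (int (Suc i))"] Suc by auto
qed

text \<open>Let \<open>c i\<close> be a vertex of a shortest cycle at the greatest distance from
  \<open>c 0\<close>. Its two neighbours on the cycle are no farther, so it accepts both their
  tokens; their distances are bounded by the lengths of the two arcs, which add up to
  \<open>g - 2\<close>.\<close>

lemma bfs_cycle_complete:
  assumes T: "2 * card V \<le> T" and g: "girth E = enat g"
  shows "\<exists>x\<in>V. \<exists>k\<le>g. bfs_cycle x (N x) (past b T) k"
proof -
  obtain p where p: "is_cycle E p" "length p = g" by (rule girth_cycle[OF g])
  have "p \<noteq> []" using p by (auto simp: is_cycle_def)
  then obtain c where c: "cyc E g c" using is_cycle_cyc[OF p(1)] p(2) by (metis hd_in_set)
  have g3: "g \<ge> 3" using c by (simp add: cyc_def)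
  have e: "{c i, c (i + 1)} \<in> E" for i using c by (simp add: cyc_def)
  have V: "c i \<in> V" for i using e edge_V by blast
  define D where "D i = hops (c 0) (c (int i))" for i
  have D1: "D i \<le> i" for i using hops_cyc[OF c] by (simp add: D_def)
  have D2: "D i \<le> g - i" if "i \<le> g" for i
  proof -
    have "hops (c 0) (c (- int (g - i))) \<le> g - i" using hops_cyc[OF cyc_reflect[OF c], of "g - i"] by simp
    moreover have "c (- int (g - i)) = c (int i)"
      using cyc_period[OF c, of "int i - int g"] that by (simp add: of_nat_diff)
    ultimately show ?thesis by (simp add: D_def)
  qed
  have reach: "reach (c 0) (c (int i))" for i using hops_cyc[OF c] by simp
  have fin: "finite (D ` {..<g})" "D ` {..<g} \<noteq> {}" using g3 by (auto simp: lessThan_empty_iff)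
  obtain i where i: "i < g" "D i = Max (D ` {..<g})" using Max_in[OF fin] by auto
  have max: "D j \<le> D i" if "j < g" for j using that i(2) fin by (metis Max_ge imageI lessThan_iff)
  have maxg: "D j \<le> D i" if "j \<le> g" for j
    using max[of j] D2[of g] that by (cases "j = g") auto
  have "D 1 \<noteq> 0"
  proof
    assume "D 1 = 0"
    hence "c 0 = c 1" using hops_eq_0[OF reach[of 1]] by (simp add: D_def)
    thus False using cyc_neq[OF c, of 0 1] g3 by simp
  qed
  hence "D i \<noteq> 0" using max[of 1] g3 by simp
  hence i1: "1 \<le> i" using D1[of i] by simp
  have sent: "\<exists>t<T. \<exists>q. b t (c (int j)) = Some (Dist (D j) (c 0) q) \<and> q \<noteq> c (int i)"
    if j: "j \<le> g" "{c (int i), c (int j)} \<in> E" for j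
  proof -
    \<comment> \<open>Distance and rank are both less than the number of nodes, so twice that number
      of rounds is enough.\<close>
    have "hops (c 0) (c (int j)) + card (before (c (int j)) (c 0)) < T"
      using hops_less_card[OF reach[of j] V] card_before[OF V, of "c (int j)" 0] T by linarith
    from bfs_sent[OF V V reach this] this
    obtain t q where t: "t < T" "b t (c (int j)) = Some (Dist (D j) (c 0) q)"
      unfolding D_def by (meson order_le_less_trans)
    have "q \<noteq> c (int i)"
    proof
      assume "q = c (int i)"
      with parent_closer[OF t(1) V t(2)] have "c (int i) = c (int j) \<or> D i < D j" by (auto simp: D_def)
      thus False using j maxg[OF j(1)] loopfree by (auto simp: loopfree_def)
    qed
    thus ?thesis using t by blast
  qed
  have ei: "{c (int i), c (int (i - 1))} \<in> E" "{c (int i), c (int (i + 1))} \<in> E"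
    using e[of "int (i - 1)"] e[of "int i"] i1 by (auto simp: insert_commute add.commute of_nat_diff)
  have ig: "i - 1 \<le> g" "i + 1 \<le> g" using i by auto
  obtain t q where 1: "t < T" "b t (c (int (i - 1))) = Some (Dist (D (i - 1)) (c 0) q)" "q \<noteq> c (int i)"
    using sent[OF ig(1) ei(1)] by blast
  obtain t' q' where 2: "t' < T" "b t' (c (int (i + 1))) = Some (Dist (D (i + 1)) (c 0) q')" "q' \<noteq> c (int i)"
    using sent[OF ig(2) ei(2)] by blast
  have ne: "c (int (i - 1)) \<noteq> c (int (i + 1))"
    by (rule cyc_neq[OF c]) (use i1 g3 in \<open>auto simp: of_nat_diff\<close>)
  have "bfs_cycle (c (int i)) (N (c (int i))) (past b T) (D (i - 1) + D (i + 1) + 2)"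
    unfolding bfs_cycle_def using 1 2 ne ei by (simp add: N_iff) blast
  moreover have "D (i - 1) + D (i + 1) + 2 \<le> g"
    using D1[of "i - 1"] D2[of "i + 1"] i i1 by simp
  ultimately show ?thesis using V by blast
qed

end

section \<open>Runs of full-information programs\<close>

text \<open>A node remembers everything: its identifier, its neighbours, its random number and, for each round
  and neighbour, the messages sent and received. Each round also records the message that the node
  would send to itself, which is how it recalls its own broadcasts.\<close>

type_synonym view = "nat \<times> nat list \<times> nat \<times> (nat \<times> message \<times> message) list list"

definition vid :: "view \<Rightarrow> nat" where "vid x = fst x"
definition nbrs :: "view \<Rightarrow> nat list" where "nbrs x = fst (snd x)"
definition rnd :: "view \<Rightarrow> nat" where "rnd x = fst (snd (snd x))"
definition hist :: "view \<Rightarrow> (nat \<times> message \<times> message) list list" where "hist x = snd (snd (snd x))"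
definition clock :: "view \<Rightarrow> nat" where "clock x = length (hist x)"

definition received :: "view \<Rightarrow> nat \<Rightarrow> nat \<Rightarrow> message" where
  "received x t u = (if t < clock x then case map_of (hist x ! t) u of Some (_, m) \<Rightarrow> m | None \<Rightarrow> [] else [])"

definition sent :: "view \<Rightarrow> nat \<Rightarrow> message" where
  "sent x t = (if t < clock x then case map_of (hist x ! t) (vid x) of Some (m, _) \<Rightarrow> m | None \<Rightarrow> [] else [])"

definition extend :: "nat \<Rightarrow> (view \<Rightarrow> nat \<Rightarrow> message) \<Rightarrow> view \<Rightarrow> (nat \<Rightarrow> message) \<Rightarrow> view" where
  "extend B out x m = (vid x, nbrs x, rnd x,
     hist x @ [map (\<lambda>u. (u, take B (out x u), m u)) (vid x # nbrs x)])"

text \<open>Cutting messages to \<open>B\<close> bits enforces the bandwidth for any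
  \<open>out\<close>. One number below \<open>n\<close> per node, drawn at the start, is the only
  randomness.\<close>

definition prog ::
  "nat \<Rightarrow> nat \<Rightarrow> (view \<Rightarrow> nat \<Rightarrow> message) \<Rightarrow> (view \<Rightarrow> enat option) \<Rightarrow> nat program" where
  "prog n B out res =
     \<lparr> init = \<lambda>v N. map_pmf (\<lambda>r. to_nat ((v, sorted_list_of_set N, r, []) :: view)) (pmf_of_set {..<n}),
       send = \<lambda>s u. take B (out (from_nat s) u),
       recv = \<lambda>s m. return_pmf (to_nat (extend B out (from_nat s) m)),
       result = \<lambda>s. res (from_nat s) \<rparr>"

locale prog_run = graph +
  fixes n B :: nat and out :: "view \<Rightarrow> nat \<Rightarrow> message" and res :: "view \<Rightarrow> enat option"
  assumes n1: "1 \<le> n"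
begin

text \<open>The run in which nobody halts. It agrees with the execution up to the first halt, and
  \<open>first_halting_outputs\<close> depends on nothing later.\<close>

primrec view :: "(nat \<Rightarrow> nat) \<Rightarrow> nat \<Rightarrow> nat \<Rightarrow> view" where
  "view r 0 = (\<lambda>v. (v, sorted_list_of_set (N v), r v, []))"
| "view r (Suc t) = (\<lambda>v. extend B out (view r t v)
     (\<lambda>u. if u \<in> N v then take B (out (view r t u) v) else []))"

lemma vid_view [simp]: "vid (view r t v) = v"
  and nbrs_view [simp]: "nbrs (view r t v) = sorted_list_of_set (N v)"
  and rnd_view [simp]: "rnd (view r t v) = r v"
  and clock_view [simp]: "clock (view r t v) = t"
  by (induction t) (simp_all add: vid_def nbrs_def rnd_def hist_def clock_def extend_def)

lemma hist_view:
  "s < t \<Longrightarrow> hist (view r t v) ! s = map (\<lambda>u. (u, take B (out (view r s v) u),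
     if u \<in> N v then take B (out (view r s u) v) else [])) (v # sorted_list_of_set (N v))"
proof (induction t)
  case (Suc t)
  have len: "length (hist (view r t v)) = t" using clock_view[of r t v] by (simp add: clock_def)
  have hist: "hist (view r (Suc t) v) = hist (view r t v) @ [map (\<lambda>u. (u, take B (out (view r t v) u),
     if u \<in> N v then take B (out (view r t u) v) else [])) (v # sorted_list_of_set (N v))]"
    by (simp add: hist_def extend_def)
  show ?case
    unfolding hist using Suc len by (cases "s = t") (auto simp: nth_append less_Suc_eq simp del: list.map)
qed simp

lemma received_view:
  assumes "s < t"
  shows "received (view r t v) s u = (if u \<in> N v then take B (out (view r s u) v) else [])"
proof -
  have "map_of (map (\<lambda>u. (u, f u)) xs) u = (if u \<in> set xs then Some (f u) else None)" for f :: "nat \<Rightarrow> message \<times> message" and xs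
    by (induction xs) auto
  thus ?thesis unfolding received_def hist_view[OF assms] using assms not_self[of v] by auto
qed

lemma sent_view: "s < t \<Longrightarrow> sent (view r t v) s = take B (out (view r s v) v)"
  unfolding sent_def by (simp add: hist_view)

abbreviation "P \<equiv> prog n B out res"

definition step :: "(nat \<Rightarrow> nat) \<Rightarrow> nat \<Rightarrow> nat" where
  "step \<sigma> = (\<lambda>v. if v \<in> V then (if result P (\<sigma> v) = None
     then to_nat (extend B out (from_nat (\<sigma> v)) (inbox P E \<sigma> v)) else \<sigma> v) else undefined)"

lemma round_step: "round_step P V E \<sigma> = return_pmf (step \<sigma>)"
proof -
  have "round_step P V E \<sigma> = Pi_pmf V undefined (\<lambda>v. return_pmf (if result P (\<sigma> v) = None
     then to_nat (extend B out (from_nat (\<sigma> v)) (inbox P E \<sigma> v)) else \<sigma> v))"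
    unfolding round_step_def by (rule arg_cong[where f = "Pi_pmf V undefined"]) (auto simp: prog_def)
  thus ?thesis by (simp add: finV step_def)
qed

definition trace :: "nat \<Rightarrow> (nat \<Rightarrow> nat) \<Rightarrow> (nat \<Rightarrow> nat) list" where
  "trace T \<sigma> = map (\<lambda>t. (step ^^ t) \<sigma>) [0..<Suc T]"

text \<open>Given the initial states, all rounds are deterministic.\<close>

lemma execution_eq: "execution P V E T = map_pmf (trace T) (initial_config P V E)"
  by (induction T) (simp_all add: trace_def[abs_def] round_step map_pmf_def[symmetric] pmf.map_comp o_def
      bind_map_pmf bind_return_pmf)

definition random :: "(nat \<Rightarrow> nat) \<Rightarrow> nat \<Rightarrow> nat" where "random \<sigma> v = rnd (from_nat (\<sigma> v))"

lemma initial_support: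
  assumes "\<sigma> \<in> set_pmf (initial_config P V E)" "v \<in> V"
  shows "\<sigma> v = to_nat (view (random \<sigma>) 0 v)"
proof -
  have "{..<n} \<noteq> {}" using n1 by (simp add: lessThan_empty_iff)
  hence "\<sigma> v \<in> (\<lambda>r. to_nat ((v, sorted_list_of_set (N v), r, []) :: view)) ` {..<n}"
    using assms unfolding initial_config_def set_Pi_pmf[OF finV] by (auto simp: PiE_dflt_def prog_def)
  thus ?thesis by (auto simp: random_def rnd_def)
qed

lemma run_view:
  assumes "\<And>v. v \<in> V \<Longrightarrow> \<sigma> v = to_nat (view r 0 v)"
    and "\<And>s v. s < t \<Longrightarrow> v \<in> V \<Longrightarrow> res (view r s v) = None"
  shows "v \<in> V \<Longrightarrow> (step ^^ t) \<sigma> v = to_nat (view r t v)"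
  using assms(2)
proof (induction t arbitrary: v)
  case 0 thus ?case using assms(1) by simp
next
  case (Suc t)
  let ?\<sigma> = "(step ^^ t) \<sigma>"
  have IH: "?\<sigma> u = to_nat (view r t u)" if "u \<in> V" for u using Suc.IH[OF that] Suc.prems by simp
  have none: "result P (?\<sigma> u) = None" if "u \<in> V" for u using IH[OF that] Suc.prems(2)[of t u] that by (simp add: prog_def)
  have NV: "u \<in> V" if "u \<in> N w" for u w using that N_sub by blast
  have "inbox P E ?\<sigma> v = (\<lambda>u. if u \<in> N v then take B (out (view r t u) v) else [])"
    unfolding inbox_def using none NV IH by (auto simp: prog_def fun_eq_iff)
  moreover have "step ?\<sigma> v = to_nat (extend B out (from_nat (?\<sigma> v)) (inbox P E ?\<sigma> v))"
    unfolding step_def[of ?\<sigma>] using Suc.prems(1) none by simp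
  ultimately have "step ?\<sigma> v = to_nat (view r (Suc t) v)" using IH[OF Suc.prems(1)] by simp
  thus ?case by simp
qed

lemma first_halting_run:
  assumes \<sigma>: "\<sigma> \<in> set_pmf (initial_config P V E)" and t: "t \<le> T"
    and none: "\<And>s v. s < t \<Longrightarrow> v \<in> V \<Longrightarrow> res (view (random \<sigma>) s v) = None"
    and some: "\<exists>v\<in>V. res (view (random \<sigma>) t v) \<noteq> None"
    and out: "\<And>v. v \<in> V \<Longrightarrow> res (view (random \<sigma>) t v) \<noteq> None \<Longrightarrow> res (view (random \<sigma>) t v) = Some x"
  shows "first_halting_outputs P V (trace T \<sigma>) x"
proof -
  have r: "result P ((step ^^ s) \<sigma> v) = res (view (random \<sigma>) s v)" if "s \<le> t" "v \<in> V" for s v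
  proof -
    have "(step ^^ s) \<sigma> v = to_nat (view (random \<sigma>) s v)"
      by (rule run_view) (use initial_support[OF \<sigma>] none that in auto)
    thus ?thesis by (simp add: prog_def)
  qed
  have nth: "trace T \<sigma> ! s = (step ^^ s) \<sigma>" if "s \<le> t" for s
    using that t unfolding trace_def by (simp del: upt_Suc)
  show ?thesis unfolding first_halting_outputs_def
  proof (intro exI[of _ t] conjI allI impI ballI)
    fix s v assume "s < t" "v \<in> V"
    thus "result P ((trace T \<sigma> ! s) v) = None" using nth[of s] r[of s v] none by simp
  next
    show "\<exists>v\<in>V. result P ((trace T \<sigma> ! t) v) \<noteq> None"
      unfolding nth[OF order_refl] using some r[OF order_refl] by auto
  next
    fix v assume "v \<in> V" "result P ((trace T \<sigma> ! t) v) \<noteq> None"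
    thus "result P ((trace T \<sigma> ! t) v) = Some x"
      unfolding nth[OF order_refl] using out r[OF order_refl] by auto
  qed (use t in \<open>simp add: trace_def\<close>)
qed

lemma prob_first_halting:
  assumes "p \<le> measure_pmf.prob (initial_config P V E) {\<sigma>. good (random \<sigma>)}"
    and "\<And>r. good r \<Longrightarrow> \<exists>t\<le>T. (\<forall>s<t. \<forall>v\<in>V. res (view r s v) = None) \<and>
      (\<exists>v\<in>V. res (view r t v) \<noteq> None) \<and> (\<forall>v\<in>V. res (view r t v) \<noteq> None \<longrightarrow> res (view r t v) = Some x)"
  shows "p \<le> measure_pmf.prob (execution P V E T) {\<sigma>s. first_halting_outputs P V \<sigma>s x}"
proof -
  let ?I = "initial_config P V E"
  have "p \<le> measure_pmf.prob ?I {\<sigma>. good (random \<sigma>)}" by (rule assms)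
  also have "\<dots> \<le> measure_pmf.prob ?I (trace T -` {\<sigma>s. first_halting_outputs P V \<sigma>s x})"
  proof (rule measure_pmf.finite_measure_mono_AE)
    show "AE \<sigma> in measure_pmf ?I. \<sigma> \<in> {\<sigma>. good (random \<sigma>)} \<longrightarrow>
      \<sigma> \<in> trace T -` {\<sigma>s. first_halting_outputs P V \<sigma>s x}"
      unfolding AE_measure_pmf_iff
    proof (intro ballI impI)
      fix \<sigma> assume \<sigma>: "\<sigma> \<in> set_pmf ?I" "\<sigma> \<in> {\<sigma>. good (random \<sigma>)}"
      have "good (random \<sigma>)" using \<sigma>(2) by simp
      from assms(2)[OF this] obtain t where t: "t \<le> T"
        and none: "\<forall>s<t. \<forall>v\<in>V. res (view (random \<sigma>) s v) = None"
        and some: "\<exists>v\<in>V. res (view (random \<sigma>) t v) \<noteq> None"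
        and out: "\<forall>v\<in>V. res (view (random \<sigma>) t v) \<noteq> None \<longrightarrow> res (view (random \<sigma>) t v) = Some x"
        by (elim exE conjE)
      have "first_halting_outputs P V (trace T \<sigma>) x"
        by (rule first_halting_run[OF \<sigma>(1) t _ some]) (rule none[rule_format], assumption+, rule out[rule_format])
      thus "\<sigma> \<in> trace T -` {\<sigma>s. first_halting_outputs P V \<sigma>s x}"
        by simp
    qed
  qed simp
  finally show ?thesis by (simp add: execution_eq)
qed

lemma prob_random:
  assumes "A \<subseteq> V"
  shows "measure_pmf.prob (initial_config P V E) {\<sigma>. \<forall>v\<in>A. random \<sigma> v \<in> S} =
    (real (card (S \<inter> {..<n})) / real n) ^ card A"
proof -
  let ?I = "\<lambda>v. init P v (N v)"
  let ?S = "\<lambda>v. if v \<in> A then {s. rnd (from_nat s) \<in> S} else UNIV"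
  have ne: "{..<n} \<noteq> {}" using n1 by (simp add: lessThan_empty_iff)
  have one: "measure_pmf.prob (?I v) {s. rnd (from_nat s) \<in> S} = real (card (S \<inter> {..<n})) / real n" for v
  proof -
    have "measure_pmf.prob (?I v) {s. rnd (from_nat s) \<in> S} = measure_pmf.prob (pmf_of_set {..<n}) S"
      unfolding prog_def by (simp add: rnd_def vimage_def)
    also have "\<dots> = real (card (S \<inter> {..<n})) / real n"
      using ne by (subst measure_pmf_of_set) (auto simp: Int_commute)
    finally show ?thesis .
  qed
  have "{\<sigma>. \<forall>v\<in>A. random \<sigma> v \<in> S} = Pi V ?S"
    using assms by (auto simp: random_def Pi_def split: if_splits)
  hence "measure_pmf.prob (initial_config P V E) {\<sigma>. \<forall>v\<in>A. random \<sigma> v \<in> S} =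
      (\<Prod>v\<in>V. measure_pmf.prob (?I v) (?S v))"
    by (simp add: initial_config_def measure_Pi_pmf_Pi[OF finV])
  also have "\<dots> = (\<Prod>v\<in>A. measure_pmf.prob (?I v) (?S v))"
    by (rule prod.mono_neutral_right[OF finV assms]) auto
  also have "\<dots> = (real (card (S \<inter> {..<n})) / real n) ^ card A" using one by simp
  finally show ?thesis .
qed

end

section \<open>The girth algorithm\<close>

fun token_bound :: "nat \<Rightarrow> token \<Rightarrow> bool" where
  "token_bound m (Probe b s v) \<longleftrightarrow> s < m \<and> v < m"
| "token_bound m (Low z) \<longleftrightarrow> z < m"
| "token_bound m (Listed z) \<longleftrightarrow> z < m"
| "token_bound m Overflow \<longleftrightarrow> True"
| "token_bound m (Relay z) \<longleftrightarrow> z < m"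
| "token_bound m (Dist d s p) \<longleftrightarrow> d < m \<and> s < m \<and> p < m"

definition tokens :: "nat \<Rightarrow> token set" where "tokens m = {t. token_bound m t}"

lemma tokens_card: "finite (tokens m)" "card (tokens m) \<le> 7 * (m + 1) ^ 3"
proof -
  let ?f = "\<lambda>(k, x, y, z). [Probe True x y, Probe False x y, Low x, Listed x, Overflow, Relay x, Dist x y z] ! k"
  \<comment> \<open>Seven kinds of tokens with at most three numbers each. The range is one larger
    than \<open>m\<close> so that the padding value 0 exists even for \<open>m = 0\<close>.\<close>
  let ?S = "{..<7::nat} \<times> {..<m + 1} \<times> {..<m + 1} \<times> {..<m + 1}"
  have sub: "tokens m \<subseteq> ?f ` ?S"
  proof
    fix t assume t: "t \<in> tokens m"
    have "\<exists>k x y z. k < 7 \<and> x < m + 1 \<and> y < m + 1 \<and> z < m + 1 \<and> t = ?f (k, x, y, z)"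
    proof (cases t)
      case (Probe b s v)
      thus ?thesis using t
        by (intro exI[of _ "if b then 0 else 1"] exI[of _ s] exI[of _ v] exI[of _ 0]) (auto simp: tokens_def)
    next
      case (Low z) thus ?thesis using t
        by (intro exI[of _ 2] exI[of _ z] exI[of _ 0]) (auto simp: tokens_def)
    next
      case (Listed z) thus ?thesis using t
        by (intro exI[of _ 3] exI[of _ z] exI[of _ 0]) (auto simp: tokens_def)
    next
      case Overflow thus ?thesis
        by (intro exI[of _ 4] exI[of _ 0]) auto
    next
      case (Relay z) thus ?thesis using t
        by (intro exI[of _ 5] exI[of _ z] exI[of _ 0]) (auto simp: tokens_def)
    next
      case (Dist d s p) thus ?thesis using t
        by (intro exI[of _ 6] exI[of _ d] exI[of _ s] exI[of _ p]) (auto simp: tokens_def)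
    qed
    thus "t \<in> ?f ` ?S" by blast
  qed
  thus "finite (tokens m)" by (rule finite_subset) simp
  have "card (tokens m) \<le> card (?f ` ?S)" by (rule card_mono[OF _ sub]) simp
  also have "\<dots> \<le> card ?S" by (rule card_image_le) simp
  also have "card ?S = 7 * (m + 1) ^ 3"
    by (simp only: card_cartesian_product card_lessThan power3_eq_cube mult.assoc)
  finally show "card (tokens m) \<le> 7 * (m + 1) ^ 3" .
qed

definition enumerate :: "token set \<Rightarrow> token list" where
  "enumerate S = (SOME xs. set xs = S \<and> distinct xs)"

lemma enumerate: "finite S \<Longrightarrow> set (enumerate S) = S" "finite S \<Longrightarrow> length (enumerate S) = card S"
proof -
  assume "finite S"
  hence "\<exists>xs. set xs = S \<and> distinct xs" using finite_distinct_list by blast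
  hence "set (enumerate S) = S \<and> distinct (enumerate S)" unfolding enumerate_def by (rule someI_ex)
  thus "set (enumerate S) = S" "length (enumerate S) = card S" using distinct_card by fastforce+
qed

locale sched =
  fixes n m :: nat and act :: "nat \<Rightarrow> bool" and M q h1 h2 :: "nat \<Rightarrow> nat" and enc :: "token \<Rightarrow> message"
begin

abbreviation "radius k \<equiv> (k - 1) div 2"

text \<open>There are \<open>2 * l + 2\<close> phases of \<open>M k\<close> rounds, and a round
  carries one token per edge and direction.\<close>

definition duration :: "nat \<Rightarrow> nat" where
  "duration k = (if act k then (2 * radius k + 2) * M k else 0)"

definition start :: "nat \<Rightarrow> nat" where "start k = (\<Sum>j<k. duration j)"

definition bfs_start :: nat where "bfs_start = start (Suc n)"

definition bfs_end :: nat where "bfs_end = bfs_start + 2 * n"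

text \<open>Stages that are not run have duration 0 and are skipped by \<open>LEAST\<close>.\<close>

definition stage_at :: "nat \<Rightarrow> nat" where "stage_at t = (LEAST k. t < start (Suc k))"

definition heard :: "view \<Rightarrow> nat \<Rightarrow> nat \<Rightarrow> nat \<Rightarrow> token set" where
  "heard x k i y = {w \<in> tokens m. \<exists>j<M k. received x (start k + i * M k + j) y = enc w}"

definition stage_out :: "view \<Rightarrow> nat \<Rightarrow> nat \<Rightarrow> nat \<Rightarrow> token set" where
  "stage_out x k i u = stage_tokens (radius k) (h1 k) (h2 k) (M k) i (vid x) (set (nbrs x)) (rnd x < q k)
     (\<lambda>i' y. if i' < i then heard x k i' y else {}) u \<inter> tokens m"

definition bfs_heard :: "view \<Rightarrow> nat \<Rightarrow> token set" where
  "bfs_heard x y = {w \<in> tokens m. \<exists>t\<ge>bfs_start. t < bfs_end \<and> t < clock x \<and> received x t y = enc w}"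

definition bfs_token :: "view \<Rightarrow> token option" where
  "bfs_token x = (case bfs_next (vid x) (set (nbrs x)) (bfs_heard x)
       {w \<in> tokens m. \<exists>t\<ge>bfs_start. t < clock x \<and> sent x t = enc w} of
     None \<Rightarrow> None | Some w \<Rightarrow> if w \<in> tokens m then Some w else None)"

definition out :: "view \<Rightarrow> nat \<Rightarrow> message" where
  "out x u = (let t = clock x in
     if t < bfs_start then
       let k = stage_at t; i = (t - start k) div M k; j = (t - start k) mod M k;
           ws = enumerate (stage_out x k i u)
       in if j < length ws then enc (ws ! j) else []
     else case bfs_token x of None \<Rightarrow> [] | Some w \<Rightarrow> enc w)"

definition stage_detects :: "view \<Rightarrow> nat \<Rightarrow> bool" where
  "stage_detects x k \<longleftrightarrow> act k \<and> start (Suc k) \<le> clock x \<and>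
     detects (radius k) k (heard x k) (set (nbrs x))"

definition bfs_detects :: "view \<Rightarrow> nat \<Rightarrow> bool" where
  "bfs_detects x k \<longleftrightarrow> bfs_end + k \<le> clock x \<and> bfs_cycle (vid x) (set (nbrs x)) (bfs_heard x) k"

text \<open>A stage halts at its end. The final phase halts with output \<open>k\<close> only \<open>k\<close> rounds after its end, so
  that shorter cycles are reported first, also in other components of the graph.\<close>

definition res :: "view \<Rightarrow> enat option" where
  "res x = (if \<exists>k. stage_detects x k then Some (enat (LEAST k. stage_detects x k))
     else if \<exists>k. bfs_detects x k then Some (enat (LEAST k. bfs_detects x k))
     else if bfs_end + n + 1 \<le> clock x then Some \<infinity> else None)"

lemma res_stage:
  assumes "\<And>j. stage_detects x j \<longleftrightarrow> j = g" shows "res x = Some (enat g)"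
proof -
  have "stage_detects x = (\<lambda>j. j = g)" using assms by blast
  moreover have "(LEAST j. j = g) = g" by (rule Least_equality) auto
  ultimately show ?thesis by (simp add: res_def)
qed

lemma res_bfs:
  assumes "\<And>j. \<not> stage_detects x j" "\<And>j. bfs_detects x j \<longleftrightarrow> j = g" shows "res x = Some (enat g)"
proof -
  have "bfs_detects x = (\<lambda>j. j = g)" using assms by blast
  moreover have "(LEAST j. j = g) = g" by (rule Least_equality) auto
  ultimately show ?thesis using assms(1) by (simp add: res_def)
qed

lemma res_undetected:
  assumes "\<And>j. \<not> stage_detects x j" "\<And>j. \<not> bfs_detects x j"
  shows "res x = (if bfs_end + n + 1 \<le> clock x then Some \<infinity> else None)"
  using assms by (simp add: res_def)

end

lemma bfs_known_cong:
  "(\<And>y. y \<in> N \<Longrightarrow> R y = R' y) \<Longrightarrow> bfs_known v N R = bfs_known v N R'"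
  unfolding bfs_known_def by (rule arg_cong[where f = "insert (0, v, v)"]) auto

lemma bfs_next_cong:
  assumes "\<And>y. y \<in> N \<Longrightarrow> R y = R' y" shows "bfs_next v N R S = bfs_next v N R' S"
proof -
  have eq: "bfs_known v N R = bfs_known v N R'" by (rule bfs_known_cong) (rule assms)
  show ?thesis unfolding bfs_next_def bfs_cands_def eq by (rule refl)
qed

lemma bfs_cycle_cong:
  "(\<And>y. y \<in> N \<Longrightarrow> R y = R' y) \<Longrightarrow> bfs_cycle v N R k = bfs_cycle v N R' k"
  unfolding bfs_cycle_def by (intro iff_exI conj_cong refl) auto

text \<open>\<open>n_m\<close> makes the distances that occur in the \<open>2 * n\<close> rounds of
  the final phase encodable, besides the identifiers.\<close>

locale sched_run = sched n m act M q h1 h2 enc + prog_run V E n B "sched.out n m act M q h1 h2 enc"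
    "sched.res n m act M enc"
  for n m act M q h1 h2 enc V E B +
  fixes r :: "nat \<Rightarrow> nat"
  assumes act: "\<And>k. act k \<Longrightarrow> 3 \<le> k \<and> k \<le> n" and M_pos: "\<And>k. act k \<Longrightarrow> 0 < M k"
    and card_V: "card V = n" and V_m: "V \<subseteq> {..<m}" and n_m: "2 * n \<le> m"
    and enc: "inj_on enc (tokens m)" "\<And>w. w \<in> tokens m \<Longrightarrow> enc w \<noteq> [] \<and> length (enc w) \<le> B"
begin

section \<open>The rounds of a run as phases and broadcasts\<close>

lemma set_nbrs [simp]: "set (sorted_list_of_set (N v)) = N v"
  by simp

lemma start_Suc: "start (Suc k) = start k + duration k"
  by (simp add: start_def)

lemma start_mono: "k \<le> k' \<Longrightarrow> start k \<le> start k'"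
  unfolding start_def by (rule sum_mono2) auto

lemma start_le_bfs: "act k \<Longrightarrow> start (Suc k) \<le> bfs_start"
  unfolding bfs_start_def using act[of k] by (intro start_mono) simp

lemma stage_at: "start k \<le> t \<Longrightarrow> t < start (Suc k) \<Longrightarrow> stage_at t = k"
  unfolding stage_at_def
  by (rule Least_equality) (use start_mono in \<open>auto simp: not_less_eq_eq[symmetric] intro: ccontr, meson leD le_trans not_less_eq_eq\<close>)

lemma length_out: "length (out x u) \<le> B"
proof -
  have fin: "finite (stage_out x k i u)" for k i
    using tokens_card(1) by (simp add: stage_out_def)
  have "enumerate (stage_out x k i u) ! j \<in> tokens m" if "j < length (enumerate (stage_out x k i u))" for k i j
    using nth_mem[OF that] enumerate(1)[OF fin] by (auto simp: stage_out_def)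
  moreover have "bfs_token x = Some w \<Longrightarrow> w \<in> tokens m" for w
    by (auto simp: bfs_token_def split: option.splits if_splits)
  ultimately show ?thesis using enc(2) by (auto simp: out_def Let_def split: option.split)
qed

lemma received_out: "s < t \<Longrightarrow> received (view r t v) s u = (if u \<in> N v then out (view r s u) v else [])"
  by (simp add: received_view length_out)

lemma sent_out: "s < t \<Longrightarrow> sent (view r t v) s = out (view r s v) v"
  by (simp add: sent_view length_out)

definition got :: "nat \<Rightarrow> nat \<Rightarrow> nat \<Rightarrow> nat \<Rightarrow> token set" where
  "got k i u v = (if {u, v} \<in> E then
     {w \<in> tokens m. \<exists>j<M k. out (view r (start k + i * M k + j) u) v = enc w} else {})"

lemma phase_time:
  assumes "act k" "i < 2 * radius k + 2" "j < M k"
  shows "start k + i * M k + j < start k + Suc i * M k" "start k + Suc i * M k \<le> start (Suc k)"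
    "start k + i * M k + j < start (Suc k)"
proof -
  have "Suc i * M k \<le> (2 * radius k + 2) * M k" using assms by (intro mult_right_mono) auto
  thus 1: "start k + Suc i * M k \<le> start (Suc k)" using assms by (simp add: start_Suc duration_def)
  show 2: "start k + i * M k + j < start k + Suc i * M k" using assms by simp
  show "start k + i * M k + j < start (Suc k)" using 1 2 by linarith
qed

lemma heard_got:
  assumes "act k" "i < 2 * radius k + 2" "start k + Suc i * M k \<le> t"
  shows "heard (view r t v) k i y = got k i y v"
proof -
  have "received (view r t v) (start k + i * M k + j) y =
      (if y \<in> N v then out (view r (start k + i * M k + j) y) v else [])" if "j < M k" for j
    by (rule received_out) (use phase_time[OF assms(1,2) that] assms(3) in linarith)
  moreover have "y \<in> N v \<longleftrightarrow> {y, v} \<in> E" by (simp add: N_iff insert_commute)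
  moreover have "enc w \<noteq> []" if "w \<in> tokens m" for w using enc(2)[OF that] by simp
  ultimately show ?thesis unfolding heard_def got_def by (auto, metis)
qed

definition due :: "nat \<Rightarrow> nat \<Rightarrow> nat \<Rightarrow> nat \<Rightarrow> token set" where
  "due k i u x = stage_tokens (radius k) (h1 k) (h2 k) (M k) i u (N u) (u \<in> {v \<in> V. r v < q k})
     (\<lambda>i' y. if i' < i then got k i' y u else {}) x"

text \<open>A node recomputes its tokens in every round of a phase, with the same result, because
  they depend on earlier phases only.\<close>

lemma stage_out_due:
  assumes k: "act k" "i < 2 * radius k + 2" "j < M k" and u: "u \<in> V"
  shows "stage_out (view r (start k + i * M k + j) u) k i x = due k i u x \<inter> tokens m"
proof -
  have "heard (view r (start k + i * M k + j) u) k i' y = got k i' y u" if "i' < i" for i' y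
  proof (rule heard_got[OF k(1)])
    have "Suc i' * M k \<le> i * M k" using that by (intro mult_right_mono) auto
    thus "start k + Suc i' * M k \<le> start k + i * M k + j" by simp
  qed (use that k in simp)
  hence "(\<lambda>i' y. if i' < i then heard (view r (start k + i * M k + j) u) k i' y else {}) =
    (\<lambda>i' y. if i' < i then got k i' y u else {})" by (intro ext) simp
  thus ?thesis using u unfolding stage_out_def due_def by simp
qed

lemma out_during_stage:
  assumes "clock x = t" "t < bfs_start" "stage_at t = k" "(t - start k) div M k = i" "(t - start k) mod M k = j"
  shows "out x u = (let ws = enumerate (stage_out x k i u) in if j < length ws then enc (ws ! j) else [])"
  unfolding out_def Let_def using assms by simp

lemma out_stage:
  assumes k: "act k" "i < 2 * radius k + 2" "j < M k" and u: "u \<in> V"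
  shows "out (view r (start k + i * M k + j) u) x =
    (let ws = enumerate (due k i u x \<inter> tokens m) in if j < length ws then enc (ws ! j) else [])"
proof -
  let ?t = "start k + i * M k + j"
  have t: "?t < start (Suc k)" by (rule phase_time(3)[OF k])
  have 1: "?t < bfs_start" using t start_le_bfs[OF k(1)] by simp
  have 2: "stage_at ?t = k" by (rule stage_at[OF _ t]) simp
  have 3: "(?t - start k) div M k = i" "(?t - start k) mod M k = j" using k by auto
  show ?thesis unfolding out_during_stage[OF clock_view 1 2 3] stage_out_due[OF k u] ..
qed

text \<open>Round \<open>j\<close> of the phase carries the \<open>j\<close>-th token; as
  \<open>enc\<close> is injective and never empty, the receiver can tell tokens from each other and
  from silence.\<close>

lemma got_take:
  assumes k: "act k" "i < 2 * radius k + 2" and ux: "{u, x} \<in> E"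
  shows "got k i u x = set (take (M k) (enumerate (due k i u x \<inter> tokens m)))"
proof -
  let ?ws = "enumerate (due k i u x \<inter> tokens m)"
  have fin: "finite (due k i u x \<inter> tokens m)" using tokens_card(1) by simp
  have u: "u \<in> V" using edge_V[OF ux] by simp
  have ws: "?ws ! j \<in> tokens m" if "j < length ?ws" for j
    using nth_mem[OF that] enumerate(1)[OF fin] by auto
  have eq: "out (view r (start k + i * M k + j) u) x = enc w \<longleftrightarrow> j < length ?ws \<and> ?ws ! j = w"
    if "j < M k" "w \<in> tokens m" for j w
    unfolding out_stage[OF k that(1) u] Let_def
    using enc(2)[OF that(2)] inj_onD[OF enc(1) _ ws that(2)] by auto
  have "w \<in> got k i u x \<longleftrightarrow> w \<in> set (take (M k) ?ws)" for w
  proof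
    assume "w \<in> got k i u x"
    then obtain j where "w \<in> tokens m" "j < M k" "out (view r (start k + i * M k + j) u) x = enc w"
      using ux by (auto simp: got_def)
    thus "w \<in> set (take (M k) ?ws)" using eq by (auto simp: in_set_conv_nth intro!: exI[of _ j])
  next
    assume "w \<in> set (take (M k) ?ws)"
    then obtain j where j: "j < M k" "j < length ?ws" "?ws ! j = w" by (auto simp: in_set_conv_nth)
    hence "w \<in> tokens m" using ws by auto
    thus "w \<in> got k i u x" using j eq ux by (auto simp: got_def)
  qed
  thus ?thesis by blast
qed

lemma V_bound: "v \<in> V \<Longrightarrow> v < m" using V_m by auto

lemma stage_tokens_bound:
  assumes R: "\<And>i y. R i y \<subseteq> tokens m" and u: "u < m" and N': "N' \<subseteq> {..<m}"
  shows "stage_tokens l h1' h2' M' i u N' smp R x \<subseteq> tokens m"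
proof
  fix t assume t: "t \<in> stage_tokens l h1' h2' M' i u N' smp R x"
  have tok: "t \<in> R i y \<Longrightarrow> token_bound m t" for t i y using R by (auto simp: tokens_def)
  consider "i = 0" | "i \<noteq> 0" "i \<le> l" | "i = Suc l" | "i = Suc (Suc l)" | "i > Suc (Suc l)" by linarith
  hence "token_bound m t"
  proof cases
    case 1
    thus ?thesis using t u by (auto simp: stage_tokens_def split: if_splits)
  next
    case 2
    hence "(\<exists>b b' s v y. t = Probe b s (if i = 1 then u else v) \<and> Probe b' s v \<in> R (i - 1) y) \<or>
      (\<exists>z y. t = Low z \<and> Low z \<in> R (i - 1) y)"
      using t unfolding stage_tokens_def by (simp split del: if_split) blast
    thus ?thesis using tok u by fastforce
  next
    case 3
    hence "t = Overflow \<or> (\<exists>v s a. t = Listed v \<and> Probe True s v \<in> R l a)"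
      using t unfolding stage_tokens_def listed_def by (auto split: if_splits)
    thus ?thesis using tok by fastforce
  next
    case 4
    thus ?thesis using t N' by (auto simp: stage_tokens_def)
  next
    case 5
    hence "\<exists>p y. t = Relay p \<and> Relay p \<in> R (i - 1) y"
      using t by (auto simp: stage_tokens_def)
    thus ?thesis using tok by fastforce
  qed
  thus "t \<in> tokens m" by (simp add: tokens_def)
qed

lemma due_tokens:
  assumes ux: "{u, x} \<in> E"
  shows "due k i u x \<subseteq> tokens m"
  unfolding due_def
proof (rule stage_tokens_bound)
  show "u < m" using edge_V[OF ux] V_bound by simp
  show "N u \<subseteq> {..<m}" using edge_V V_bound by (auto simp: N_iff)
  show "(if i' < i then got k i' y u else {}) \<subseteq> tokens m" for i' y by (auto simp: got_def)
qed

lemma stage: "act k \<Longrightarrow> stage V E {v \<in> V. r v < q k} (radius k) (h1 k) (h2 k) (M k) (got k)"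
proof -
  assume k: "act k"
  interpret s: stage_run V E "{v \<in> V. r v < q k}" "radius k" "h1 k" "h2 k" "M k" "got k"
    by unfold_locales (use graph act[OF k] in auto)
  have S: "s.due i u x = due k i u x" for i u x unfolding s.due_def due_def by (rule refl)
  show ?thesis
  proof unfold_locales
    fix i u x assume i: "i < 2 * radius k + 2" "{u, x} \<in> E"
    have fin: "finite (due k i u x \<inter> tokens m)" using tokens_card(1) by simp
    show "got k i u x \<subseteq> s.due i u x"
      unfolding S got_take[OF k i] using set_take_subset enumerate(1)[OF fin] by fastforce
    assume "card (s.due i u x) \<le> M k"
    thus "got k i u x = s.due i u x"
      unfolding S got_take[OF k i] using enumerate[OF fin] due_tokens[OF i(2), of k i] by (simp add: Int_absorb2)
  qed
qed

lemma stage_detects_view: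
  "stage_detects (view r t v) k \<longleftrightarrow> act k \<and> start (Suc k) \<le> t \<and> detects (radius k) k (\<lambda>i y. got k i y v) (N v)"
proof (cases "act k \<and> start (Suc k) \<le> t")
  case True
  have "heard (view r t v) k i y = got k i y v" if "i < 2 * radius k + 2" for i y
    by (rule heard_got) (use True that phase_time(2)[of k i 0] M_pos[of k] in auto)
  hence "evidence (radius k) (heard (view r t v) k) z y j = evidence (radius k) (\<lambda>i y. got k i y v) z y j" for z y j
    unfolding evidence_def by (intro disj_cong conj_cong refl) auto
  thus ?thesis using True unfolding stage_detects_def detects_def by simp
next
  case False
  thus ?thesis by (auto simp: stage_detects_def)
qed

definition bfs_msg :: "nat \<Rightarrow> nat \<Rightarrow> token option" where "bfs_msg t v = bfs_token (view r (bfs_start + t) v)"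

lemma bfs_msg_tokens: "bfs_msg t v = Some w \<Longrightarrow> w \<in> tokens m"
  by (auto simp: bfs_msg_def bfs_token_def split: option.splits if_splits)

lemma out_bfs: "out (view r (bfs_start + t) v) u = (case bfs_msg t v of None \<Rightarrow> [] | Some w \<Rightarrow> enc w)"
  unfolding out_def clock_view bfs_msg_def Let_def by simp

lemma out_bfs_enc:
  assumes "w \<in> tokens m" shows "out (view r (bfs_start + t) v) u = enc w \<longleftrightarrow> bfs_msg t v = Some w"
proof (cases "bfs_msg t v")
  case None
  thus ?thesis using enc(2)[OF assms] by (auto simp: out_bfs)
next
  case (Some w')
  thus ?thesis using inj_onD[OF enc(1), of w' w] bfs_msg_tokens[OF Some] assms by (auto simp: out_bfs)
qed

lemma bfs_rounds: "(\<exists>s\<ge>bfs_start. s < bfs_start + t \<and> Q s) \<longleftrightarrow> (\<exists>t'<t. Q (bfs_start + t'))"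
  by (metis add_less_cancel_left le_add1 le_add_diff_inverse)

lemma bfs_heard_view:
  assumes "y \<in> N v" "t \<le> 2 * n"
  shows "bfs_heard (view r (bfs_start + t) v) y = past bfs_msg t y"
proof -
  have "(\<exists>s\<ge>bfs_start. s < bfs_end \<and> s < bfs_start + t \<and> received (view r (bfs_start + t) v) s y = enc w)
     \<longleftrightarrow> (\<exists>t'<t. bfs_msg t' y = Some w)" if w: "w \<in> tokens m" for w
  proof -
    have "s < bfs_end \<and> s < bfs_start + t \<and> received (view r (bfs_start + t) v) s y = enc w
      \<longleftrightarrow> s < bfs_start + t \<and> out (view r s y) v = enc w" for s
      using assms received_out[of s "bfs_start + t" v y] by (auto simp: bfs_end_def)
    thus ?thesis by (simp add: bfs_rounds out_bfs_enc[OF w])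
  qed
  moreover have "\<exists>t'<t. bfs_msg t' y = Some w \<Longrightarrow> w \<in> tokens m" for w using bfs_msg_tokens by blast
  ultimately show ?thesis unfolding bfs_heard_def clock_view by blast
qed

lemma bfs_sent_view:
  "{w \<in> tokens m. \<exists>s\<ge>bfs_start. s < bfs_start + t \<and> sent (view r (bfs_start + t) v) s = enc w}
    = past bfs_msg t v"
proof -
  have "(\<exists>s\<ge>bfs_start. s < bfs_start + t \<and> sent (view r (bfs_start + t) v) s = enc w)
     \<longleftrightarrow> (\<exists>t'<t. bfs_msg t' v = Some w)" if w: "w \<in> tokens m" for w
  proof -
    have "(\<exists>s\<ge>bfs_start. s < bfs_start + t \<and> sent (view r (bfs_start + t) v) s = enc w)
      \<longleftrightarrow> (\<exists>s\<ge>bfs_start. s < bfs_start + t \<and> out (view r s v) v = enc w)"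
      by (intro iff_exI conj_cong refl) (use sent_out in auto)
    thus ?thesis by (simp add: bfs_rounds out_bfs_enc[OF w])
  qed
  moreover have "\<exists>t'<t. bfs_msg t' v = Some w \<Longrightarrow> w \<in> tokens m" for w using bfs_msg_tokens by blast
  ultimately show ?thesis by blast
qed

lemma bfs: "bfs_run V E (2 * n) bfs_msg (tokens m)"
proof
  fix t v assume t: "t < 2 * n" and v: "v \<in> V"
  have 1: "bfs_next v (N v) (bfs_heard (view r (bfs_start + t) v)) S
      = bfs_next v (N v) (past bfs_msg t) S" for S
    by (rule bfs_next_cong) (use bfs_heard_view t in simp)
  show "bfs_msg t v = (case bfs_next v (N v) (past bfs_msg t)
                 (past bfs_msg t v) of
               None \<Rightarrow> None | Some w \<Rightarrow> if w \<in> tokens m then Some w else None)"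
    unfolding bfs_msg_def[of t v] bfs_token_def vid_view nbrs_view set_nbrs clock_view bfs_sent_view 1 ..
next
  fix d s p assume "d < 2 * n" "s \<in> V" "p \<in> V"
  thus "Dist d s p \<in> tokens m" using n_m V_bound by (auto simp: tokens_def)
qed

lemma bfs_detects_view:
  "bfs_detects (view r t v) k \<longleftrightarrow> bfs_end + k \<le> t \<and> bfs_cycle v (N v) (past bfs_msg (2 * n)) k"
proof (cases "bfs_end + k \<le> t")
  case True
  have "bfs_heard (view r t v) y = {w. \<exists>t'<2 * n. bfs_msg t' y = Some w}" if y: "y \<in> N v" for y
  proof -
    have "received (view r t v) s y = received (view r (bfs_start + 2 * n) v) s y" if "s < bfs_end" for s
      using received_out[of s t v y] received_out[of s "bfs_start + 2 * n" v y] that True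
      by (simp add: bfs_end_def)
    hence "bfs_heard (view r t v) y = bfs_heard (view r (bfs_start + 2 * n) v) y"
      unfolding bfs_heard_def clock_view using True by (auto simp: bfs_end_def)
    thus ?thesis using bfs_heard_view[OF y order_refl] by simp
  qed
  hence "bfs_cycle v (N v) (bfs_heard (view r t v)) k =
      bfs_cycle v (N v) (past bfs_msg (2 * n)) k"
    by (rule bfs_cycle_cong)
  thus ?thesis using True by (simp add: bfs_detects_def)
next
  case False
  thus ?thesis by (simp add: bfs_detects_def)
qed

lemma stage_detects_girth: "stage_detects (view r t v) k \<Longrightarrow> girth E \<le> enat k"
  unfolding stage_detects_view using stage.detects_sound[OF stage] by blast

lemma bfs_detects_girth: "bfs_detects (view r t v) k \<Longrightarrow> girth E \<le> enat k"
  unfolding bfs_detects_view using bfs_run.bfs_cycle_sound[OF bfs] by blast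

section \<open>The first output\<close>

definition outputs_at :: "nat \<Rightarrow> enat \<Rightarrow> bool" where
  "outputs_at t x \<longleftrightarrow> (\<forall>s<t. \<forall>v\<in>V. res (view r s v) = None) \<and> (\<exists>v\<in>V. res (view r t v) \<noteq> None) \<and>
     (\<forall>v\<in>V. res (view r t v) \<noteq> None \<longrightarrow> res (view r t v) = Some x)"

lemma outputs_atI:
  assumes "\<And>s v. s \<le> t \<Longrightarrow> res (view r s v) = (if s = t \<and> D v then Some x else None)" "\<exists>v\<in>V. D v"
  shows "outputs_at t x"
  using assms unfolding outputs_at_def by auto

text \<open>By soundness no stage before \<open>g\<close> detects anything, and later stages end
  strictly later, so the first nodes to halt do so at the end of stage \<open>g\<close>.\<close>

lemma outputs_stage:
  assumes g: "girth E = enat g" and a: "act g"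
    and s: "stage_girth V E {v \<in> V. r v < q g} (radius g) (h1 g) (h2 g) (M g) (got g) g \<tau>"
  shows "outputs_at (start (Suc g)) (enat g)"
proof (rule outputs_atI)
  let ?D = "\<lambda>v. detects (radius g) g (\<lambda>i y. got g i y v) (N v)"
  show "\<exists>v\<in>V. ?D v" by (rule stage_girth.stage_complete[OF s])
  fix t v assume t: "t \<le> start (Suc g)"
  have only: "stage_detects (view r t v) k \<Longrightarrow> k = g" for k
  proof -
    assume d: "stage_detects (view r t v) k"
    hence k: "act k" "start (Suc k) \<le> start (Suc g)" using t unfolding stage_detects_view by auto
    have "\<not> g < k"
    proof
      assume "g < k"
      hence "start (Suc g) \<le> start k" by (intro start_mono) simp
      moreover have "0 < duration k" using k(1) M_pos[OF k(1)] by (simp add: duration_def)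
      ultimately show False using k(2) by (simp add: start_Suc[of k])
    qed
    thus "k = g" using stage_detects_girth[OF d] g by simp
  qed
  have "stage_detects (view r t v) g \<longleftrightarrow> t = start (Suc g) \<and> ?D v"
    using t a unfolding stage_detects_view by auto
  hence sd: "stage_detects (view r t v) k \<longleftrightarrow> k = g \<and> t = start (Suc g) \<and> ?D v" for k
    using only by blast
  have le: "t \<le> bfs_end" using t start_le_bfs[OF a] by (simp add: bfs_end_def)
  \<comment> \<open>Up to time \<open>bfs_end\<close> only the value 0 passes the waiting condition,
    and it is below the girth.\<close>
  have "\<not> bfs_detects (view r t v) k" for k
  proof
    assume d: "bfs_detects (view r t v) k"
    hence "k = 0" using le unfolding bfs_detects_view by simp
    thus False using bfs_detects_girth[OF d] g act[OF a] by simp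
  qed
  thus "res (view r t v) = (if t = start (Suc g) \<and> ?D v then Some (enat g) else None)"
    using res_stage[of "view r t v" g] res_undetected[of "view r t v"] sd le by auto
qed

lemma girth_le_n: "girth E = enat g \<Longrightarrow> g \<le> n"
proof -
  assume "girth E = enat g"
  then obtain p where p: "is_cycle E p" "length p = g" by (rule girth_cycle)
  have "set p \<subseteq> V"
  proof
    fix v assume "v \<in> set p"
    then obtain i where i: "i < length p" "v = p ! i" by (auto simp: in_set_conv_nth)
    hence "{v, p ! (Suc i mod length p)} \<in> E" using p by (simp add: is_cycle_def)
    thus "v \<in> V" using edge_V by blast
  qed
  hence "card (set p) \<le> card V" using finV card_mono by blast
  thus "g \<le> n" using p card_V by (simp add: is_cycle_def distinct_card)
qed

text \<open>Soundness excludes values below \<open>g\<close>, some vertex finds exactly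
  \<open>g\<close>, and \<open>g \<le> n\<close> makes this output precede the default output at
  time \<open>bfs_end + n + 1\<close>.\<close>

lemma outputs_bfs:
  assumes g: "girth E = enat g" and a: "\<And>k. act k \<Longrightarrow> k < g"
  shows "outputs_at (bfs_end + g) (enat g)"
proof (rule outputs_atI)
  let ?D = "\<lambda>v. bfs_cycle v (N v) (past bfs_msg (2 * n)) g"
  have le: "g \<le> k" if "bfs_cycle v (N v) (past bfs_msg (2 * n)) k" for v k
    using bfs_run.bfs_cycle_sound[OF bfs that] g by simp
  obtain v k where v: "v \<in> V" "k \<le> g" "bfs_cycle v (N v) (past bfs_msg (2 * n)) k"
    using bfs_run.bfs_cycle_complete[OF bfs _ g] card_V by auto
  hence "k = g" using le[OF v(3)] by simp
  thus "\<exists>v\<in>V. ?D v" using v by blast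
  fix t v assume t: "t \<le> bfs_end + g"
  have sd: "\<not> stage_detects (view r t v) k" for k
    using stage_detects_girth[of t v k] a[of k] g unfolding stage_detects_view by fastforce
  have "bfs_detects (view r t v) k \<longleftrightarrow> k = g \<and> t = bfs_end + g \<and> ?D v" for k
  proof (cases "k = g")
    case True thus ?thesis using t unfolding bfs_detects_view by auto
  next
    case False thus ?thesis using t le[of v k] unfolding bfs_detects_view by auto
  qed
  thus "res (view r t v) = (if t = bfs_end + g \<and> ?D v then Some (enat g) else None)"
    using res_bfs[OF sd, of g] res_undetected[OF sd] t girth_le_n[OF g] by auto
qed

lemma outputs_acyclic:
  assumes g: "girth E = \<infinity>"
  shows "outputs_at (bfs_end + n + 1) \<infinity>"
proof -
  have nostage: "\<not> stage_detects (view r t v) k" for t v k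
    using stage_detects_girth[of t v k] g by auto
  have nobfs: "\<not> bfs_detects (view r t v) k" for t v k
    using bfs_detects_girth[of t v k] g by auto
  have "V \<noteq> {}" using card_V n1 by auto
  moreover have "res (view r (bfs_end + n + 1) v) = Some \<infinity>" for v
    unfolding res_undetected[OF nostage nobfs] clock_view by simp
  moreover have "res (view r s v) = None" if "s < bfs_end + n + 1" for s v
    using that unfolding res_undetected[OF nostage nobfs] clock_view by simp
  ultimately show ?thesis unfolding outputs_at_def by auto
qed

end

section \<open>Sampling\<close>

text \<open>Since \<open>s ^ s / s!\<close> is at most \<open>e ^ s\<close>, the left side is at
  most \<open>(e * Q / s) ^ s\<close>; and 8 exceeds \<open>e ^ 2\<close>.\<close>

lemma power_div_fact_le: 
  assumes "8 * Q \<le> s" shows "real Q ^ s / fact s \<le> exp (- real s)"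
proof (cases "Q = 0")
  case True
  thus ?thesis by (cases s) auto
next
  case False
  hence s: "0 < s" using assms by simp
  have "real s ^ s / fact s \<le> exp (real s)"
  proof -
    have "(\<Sum>k\<in>{s}. real s ^ k / fact k) \<le> (\<Sum>k. real s ^ k / fact k)"
      using summable_exp_generic[of "real s"]
      by (intro sum_le_suminf) (auto simp: divide_inverse mult.commute scaleR_conv_of_real)
    also have "\<dots> = exp (real s)" by (simp add: exp_def divide_inverse mult.commute)
    finally show ?thesis by simp
  qed
  hence 1: "real s ^ s \<le> exp (real s) * fact s" by (simp add: field_simps)
  have "exp 2 = exp 1 * exp (1::real)" by (simp add: exp_add[symmetric])
  also have "\<dots> \<le> 2.75 * 2.75" using e_less_272 by (intro mult_mono) auto
  finally have e2: "exp 2 \<le> (8::real)" by simp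
  have "real Q * exp 2 \<le> real Q * 8" using e2 by (intro mult_left_mono) auto
  also have "\<dots> \<le> real s" using assms by (metis mult.commute of_nat_le_iff of_nat_mult of_nat_numeral)
  finally have "(real Q * exp 2) ^ s \<le> real s ^ s" by (intro power_mono) auto
  also note 1
  finally have "real Q ^ s * exp (2 * real s) \<le> exp (real s) * fact s"
    by (simp add: power_mult_distrib exp_of_nat_mult[symmetric] mult.commute)
  hence "real Q ^ s * (exp (real s) * exp (real s)) \<le> exp (real s) * fact s"
    by (simp add: exp_add[symmetric])
  hence "real Q ^ s * exp (real s) \<le> fact s" by simp
  thus ?thesis by (simp add: exp_minus field_simps)
qed

context prog_run begin

definition sampled :: "nat \<Rightarrow> (nat \<Rightarrow> nat) \<Rightarrow> nat set" where "sampled Q r = {v \<in> V. r v < Q}"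

definition prob_r :: "(nat \<Rightarrow> nat) set \<Rightarrow> real" where
  "prob_r S = measure_pmf.prob (initial_config P V E) {\<sigma>. random \<sigma> \<in> S}"

lemma prob_r_mono: "S \<subseteq> S' \<Longrightarrow> prob_r S \<le> prob_r S'"
  unfolding prob_r_def by (intro measure_pmf.finite_measure_mono) auto

lemma prob_r_UN: "finite I \<Longrightarrow> prob_r (\<Union>i\<in>I. F i) \<le> (\<Sum>i\<in>I. prob_r (F i))"
proof -
  assume "finite I"
  moreover have "{\<sigma>. random \<sigma> \<in> (\<Union>i\<in>I. F i)} = (\<Union>i\<in>I. {\<sigma>. random \<sigma> \<in> F i})" by auto
  ultimately show ?thesis unfolding prob_r_def by (simp add: measure_UNION_le)
qed

lemma prob_r_Un: "prob_r (S \<union> S') \<le> prob_r S + prob_r S'"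
proof -
  have "{\<sigma>. random \<sigma> \<in> S \<union> S'} = {\<sigma>. random \<sigma> \<in> S} \<union> {\<sigma>. random \<sigma> \<in> S'}" by auto
  thus ?thesis unfolding prob_r_def by (simp add: measure_Un_le)
qed

lemma prob_r_Compl: "prob_r (- S) = 1 - prob_r S"
proof -
  have "{\<sigma>. random \<sigma> \<in> - S} = UNIV - {\<sigma>. random \<sigma> \<in> S}" by auto
  thus ?thesis unfolding prob_r_def using measure_pmf.prob_compl[of "{\<sigma>. random \<sigma> \<in> S}"] by simp
qed

lemma prob_r_all: "A \<subseteq> V \<Longrightarrow> prob_r {r. \<forall>v\<in>A. r v \<in> S} = (real (card (S \<inter> {..<n})) / real n) ^ card A"
  using prob_random[of A S] by (simp add: prob_r_def)

lemma prob_r_miss: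
  assumes "A \<subseteq> V" "Q \<le> n" "\<tau> \<le> card A"
  shows "prob_r {r. sampled Q r \<inter> A = {}} \<le> exp (- (real Q * real \<tau> / real n))"
proof -
  have "{r. sampled Q r \<inter> A = {}} = {r. \<forall>v\<in>A. r v \<in> {Q..}}"
    using assms(1) by (auto simp: sampled_def)
  moreover have "{Q..} \<inter> {..<n} = {Q..<n}" by auto
  ultimately have "prob_r {r. sampled Q r \<inter> A = {}} = (real (n - Q) / real n) ^ card A"
    using prob_r_all[OF assms(1), of "{Q..}"] by simp
  also have "real (n - Q) / real n = 1 - real Q / real n" using assms(2) n1 by (simp add: field_simps of_nat_diff)
  also have "(1 - real Q / real n) ^ card A \<le> exp (- (real Q / real n)) ^ card A"
    using assms(2) n1 exp_ge_add_one_self[of "- (real Q / real n)"] by (intro power_mono) (auto simp: field_simps)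
  also have "\<dots> \<le> exp (- (real Q / real n)) ^ \<tau>" using assms(3) by (intro power_decreasing) auto
  also have "\<dots> = exp (- (real Q * real \<tau> / real n))" by (simp add: exp_of_nat_mult[symmetric] mult.commute)
  finally show ?thesis .
qed

text \<open>Union bound over the subsets of size \<open>s = 8 * Q\<close>: the expected number of
  those that are sampled entirely is at most \<open>Q ^ s / s!\<close>.\<close>

lemma prob_r_many:
  assumes "card V = n" "Q \<le> n"
  shows "prob_r {r. 8 * Q \<le> card (sampled Q r)} \<le> exp (- real (8 * Q))"
proof -
  let ?s = "8 * Q"
  let ?F = "{A. A \<subseteq> V \<and> card A = ?s}"
  have fin: "finite ?F" using finV by simp
  have "{r. ?s \<le> card (sampled Q r)} \<subseteq> (\<Union>A\<in>?F. {r. \<forall>v\<in>A. r v \<in> {..<Q}})"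
  proof
    fix r assume "r \<in> {r. ?s \<le> card (sampled Q r)}"
    then obtain A where "A \<subseteq> sampled Q r" "card A = ?s" using obtain_subset_with_card_n by (metis mem_Collect_eq)
    thus "r \<in> (\<Union>A\<in>?F. {r. \<forall>v\<in>A. r v \<in> {..<Q}})" by (auto simp: sampled_def)
  qed
  hence "prob_r {r. ?s \<le> card (sampled Q r)} \<le> prob_r (\<Union>A\<in>?F. {r. \<forall>v\<in>A. r v \<in> {..<Q}})" by (rule prob_r_mono)
  also have "\<dots> \<le> (\<Sum>A\<in>?F. prob_r {r. \<forall>v\<in>A. r v \<in> {..<Q}})" by (rule prob_r_UN[OF fin])
  also have "\<dots> = (\<Sum>A\<in>?F. (real Q / real n) ^ ?s)"
  proof (rule sum.cong[OF refl])
    fix A assume A: "A \<in> ?F"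
    have "{..<Q} \<inter> {..<n} = {..<Q}" using assms by auto
    thus "prob_r {r. \<forall>v\<in>A. r v \<in> {..<Q}} = (real Q / real n) ^ ?s" using A prob_r_all[of A "{..<Q}"] by simp
  qed
  also have "\<dots> = real (n choose ?s) * (real Q / real n) ^ ?s" using n_subsets[OF finV] assms by simp
  also have "\<dots> \<le> (real n ^ ?s / fact ?s) * (real Q / real n) ^ ?s"
  proof (rule mult_right_mono)
    have "fact ?s * (n choose ?s) \<le> n ^ ?s" using binomial_fact_pow[of n ?s] by (simp only: mult.commute)
    hence "real (fact ?s * (n choose ?s)) \<le> real (n ^ ?s)" by (simp only: of_nat_le_iff)
    thus "real (n choose ?s) \<le> real n ^ ?s / fact ?s" by (simp add: field_simps)
  qed simp
  also have "\<dots> = real Q ^ ?s / fact ?s" using n1 by (simp add: power_divide)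
  also have "\<dots> \<le> exp (- real ?s)" by (rule power_div_fact_le) simp
  finally show ?thesis .
qed

text \<open>There are at most \<open>n ^ 3 + n + 1 \<le> n ^ 4\<close> bad events, each of
  probability at most \<open>1 / n ^ (c + 4)\<close>.\<close>

lemma prob_r_hitting:
  assumes "card V = n" "2 \<le> n" "Q \<le> n" "\<tau> \<le> n" and F: "finite F" "card F \<le> n ^ 3 + n"
    "\<And>A. A \<in> F \<Longrightarrow> A \<subseteq> V \<and> \<tau> \<le> card A"
    and Q\<tau>: "real (c + 4) * ln (real n) \<le> real Q * real \<tau> / real n"
  shows "1 - 1 / real n ^ c \<le> prob_r {r. card (sampled Q r) \<le> 8 * Q \<and> (\<forall>A\<in>F. sampled Q r \<inter> A \<noteq> {})}"
proof -
  let ?G = "{r. card (sampled Q r) \<le> 8 * Q \<and> (\<forall>A\<in>F. sampled Q r \<inter> A \<noteq> {})}"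
  let ?e = "1 / real n ^ (c + 4)"
  have n0: "0 < real n" using assms by simp
  have e: "exp (- (real (c + 4) * ln (real n))) = ?e"
    using n0 by (simp add: exp_minus exp_of_nat_mult inverse_eq_divide del: of_nat_add)
  have bound: "exp (- x) \<le> ?e" if "real (c + 4) * ln (real n) \<le> x" for x
    unfolding e[symmetric] using that by simp
  have "- ?G \<subseteq> {r. 8 * Q \<le> card (sampled Q r)} \<union> (\<Union>A\<in>F. {r. sampled Q r \<inter> A = {}})" by auto
  hence "prob_r (- ?G) \<le> prob_r ({r. 8 * Q \<le> card (sampled Q r)} \<union> (\<Union>A\<in>F. {r. sampled Q r \<inter> A = {}}))" by (rule prob_r_mono)
  also have "\<dots> \<le> prob_r {r. 8 * Q \<le> card (sampled Q r)} + prob_r (\<Union>A\<in>F. {r. sampled Q r \<inter> A = {}})" by (rule prob_r_Un)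
  also have "prob_r {r. 8 * Q \<le> card (sampled Q r)} \<le> ?e"
  proof -
    have "real Q * real \<tau> / real n \<le> real Q * real n / real n"
      using assms(4) by (intro divide_right_mono mult_left_mono) auto
    also have "\<dots> = real Q" using n0 by simp
    finally have "exp (- real (8 * Q)) \<le> ?e" using Q\<tau> by (intro bound) simp
    thus ?thesis using prob_r_many[OF assms(1,3)] by simp
  qed
  also have "prob_r (\<Union>A\<in>F. {r. sampled Q r \<inter> A = {}}) \<le> (\<Sum>A\<in>F. prob_r {r. sampled Q r \<inter> A = {}})" by (rule prob_r_UN[OF F(1)])
  also have "\<dots> \<le> (\<Sum>A\<in>F. ?e)"
  proof (rule sum_mono)
    fix A assume "A \<in> F"
    hence "prob_r {r. sampled Q r \<inter> A = {}} \<le> exp (- (real Q * real \<tau> / real n))" using F(3) assms(3) prob_r_miss by blast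
    also have "\<dots> \<le> ?e" by (rule bound[OF Q\<tau>])
    finally show "prob_r {r. sampled Q r \<inter> A = {}} \<le> ?e" .
  qed
  also have "\<dots> = real (card F) * ?e" by simp
  also have "\<dots> \<le> real (n ^ 3 + n) * ?e" using F(2) by (intro mult_right_mono) (simp_all only: of_nat_le_iff, simp)
  also have "?e + real (n ^ 3 + n) * ?e = real (n ^ 3 + n + 1) * ?e" by (simp add: algebra_simps add_divide_distrib)
  also have "\<dots> \<le> real (n ^ 4) * ?e"
  proof (rule mult_right_mono)
    have "4 \<le> n * n" using mult_mono[of 2 n 2 n] assms(2) by simp
    hence "n * 4 \<le> n * (n * n)" by (rule mult_le_mono2)
    hence "n + 1 \<le> n ^ 3" unfolding power3_eq_cube mult.assoc using assms(2) by linarith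
    moreover have "2 * n ^ 3 \<le> n * n ^ 3" using assms(2) by (rule mult_le_mono1)
    ultimately have "n ^ 3 + n + 1 \<le> n ^ 4" by (simp add: eval_nat_numeral)
    thus "real (n ^ 3 + n + 1) \<le> real (n ^ 4)" by (simp only: of_nat_le_iff)
  qed simp
  also have "\<dots> = 1 / real n ^ c" using n0 by (simp add: power_add)
  finally show ?thesis unfolding prob_r_Compl by simp
qed

end

section \<open>Parameters\<close>

text \<open>All parameters of stage \<open>k\<close> are expressed through \<open>base n k\<close>, the rounded \<open>20k\<close>-th root of \<open>n\<close>;
  stages are run as long as the base exceeds both \<open>k\<close> and a constant. Then \<open>ln n\<close> is at most
  \<open>20 (base n k)\<close> squared, which absorbs the logarithmic factors.\<close>

locale girth_params =
  fixes c :: nat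
begin

definition base :: "nat \<Rightarrow> nat \<Rightarrow> nat" where "base n k = nat \<lfloor>root (20 * k) (real n)\<rfloor>"
definition min_base :: nat where "min_base = 40 * (c + 4)"
definition act :: "nat \<Rightarrow> nat \<Rightarrow> bool" where "act n k \<longleftrightarrow> 3 \<le> k \<and> k \<le> base n k \<and> min_base \<le> base n k"
text \<open>Let \<open>z\<close> be the base. The exponents are chosen such that about
  \<open>n / z ^ 3\<close> samples are few compared with the load \<open>n / z ^ 2\<close> and hit a
  set of size \<open>z ^ 6\<close> about \<open>z ^ 3\<close> times, which beats
  \<open>ln n\<close>. A factor of \<open>z\<close> is left to spare in \<open>M_listed\<close> (11
  + 2 < 14) and in \<open>M_relay\<close> (2 + 2 + 6 < 11).\<close>

definition load :: "nat \<Rightarrow> nat \<Rightarrow> nat" where "load n k = n div base n k ^ 2"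
definition sample :: "nat \<Rightarrow> nat \<Rightarrow> nat" where "sample n k = n div base n k ^ 3"
definition mid_degree :: "nat \<Rightarrow> nat \<Rightarrow> nat" where "mid_degree n k = base n k ^ 11"
definition high_degree :: "nat \<Rightarrow> nat \<Rightarrow> nat" where "high_degree n k = base n k ^ 14"
definition hit_size :: "nat \<Rightarrow> nat \<Rightarrow> nat" where "hit_size n k = base n k ^ 6"

lemma base_le_root: "1 \<le> k \<Longrightarrow> real (base n k) \<le> root (20 * k) (real n)"
  unfolding base_def by simp

lemma root_less_base: "1 \<le> k \<Longrightarrow> root (20 * k) (real n) < real (base n k) + 1"
  unfolding base_def by linarith

lemma base_power: "1 \<le> k \<Longrightarrow> base n k ^ (20 * k) \<le> n"
proof -
  assume k: "1 \<le> k"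
  have "real (base n k) ^ (20 * k) \<le> root (20 * k) (real n) ^ (20 * k)"
    by (rule power_mono[OF base_le_root[OF k]]) simp
  also have "\<dots> = real n" using k by simp
  finally show ?thesis by (simp only: of_nat_power[symmetric] of_nat_le_iff)
qed

lemma base_antimono:
  assumes "1 \<le> k" "k \<le> k'" "1 \<le> n" shows "base n k' \<le> base n k"
proof -
  have "root (20 * k') (real n) \<le> root (20 * k) (real n)"
    using assms by (intro real_root_decreasing) auto
  thus ?thesis unfolding base_def by (intro nat_mono floor_mono)
qed

lemma act_downward: "act n k' \<Longrightarrow> 3 \<le> k \<Longrightarrow> k \<le> k' \<Longrightarrow> 1 \<le> n \<Longrightarrow> act n k"
  using base_antimono[of k k' n] unfolding act_def by simp

lemma root_powr: "1 \<le> k \<Longrightarrow> 1 \<le> n \<Longrightarrow> real n / root (20 * k) (real n) = real n powr (1 - 1 / (20 * real k))"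
  using root_powr_inverse[of "20 * k" "real n"] by (simp add: powr_diff)

context
  fixes n k :: nat assumes a: "act n k" and n1: "1 \<le> n"
begin

lemma base_bounds: "160 \<le> base n k" "k \<le> base n k" "3 \<le> k" "40 * (c + 4) \<le> base n k"
  using a by (auto simp: act_def min_base_def)

lemma n_ge: "base n k ^ 60 \<le> n"
proof -
  have "base n k ^ 60 \<le> base n k ^ (20 * k)" using base_bounds by (intro power_increasing) auto
  also have "\<dots> \<le> n" using base_power[of k n] base_bounds(3) by linarith
  finally show ?thesis .
qed

text \<open>A positive rounded quotient is more than half of the exact one.\<close>

lemma div_bounds:
  fixes b :: nat assumes "0 < b" "b \<le> n"
  shows "n div b * b \<le> n" "n < 2 * (n div b) * b" "1 \<le> n div b"
proof -
  show 1: "1 \<le> n div b" using assms by (simp add: div_greater_zero_iff Suc_le_eq)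
  have "n < (n div b + 1) * b"
    using assms dividend_less_times_div[of b n] by (simp add: algebra_simps)
  also have "\<dots> \<le> (2 * (n div b)) * b" using 1 by (intro mult_le_mono1) simp
  finally show "n < 2 * (n div b) * b" .
qed simp

lemma power_bounds: "0 < base n k ^ i" "i \<le> 60 \<Longrightarrow> base n k ^ i \<le> n"
proof -
  show "0 < base n k ^ i" using base_bounds by simp
  assume "i \<le> 60"
  hence "base n k ^ i \<le> base n k ^ 60" using base_bounds by (intro power_increasing) auto
  thus "base n k ^ i \<le> n" using n_ge by simp
qed

lemmas load_bounds = div_bounds[OF power_bounds(1) power_bounds(2)[of 2], folded load_def, simplified]
lemmas sample_bounds = div_bounds[OF power_bounds(1) power_bounds(2)[of 3], folded sample_def, simplified]

text \<open>Each summand takes at most half of the load; for the second this rests on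
  \<open>14 * l + 3 \<le> 20 * k\<close>.\<close>

lemma tokens_fit: "8 * sample n k + high_degree n k ^ ((k - 1) div 2) \<le> load n k"
proof -
  let ?z = "base n k" and ?l = "(k - 1) div 2"
  have z: "160 \<le> ?z" by (rule base_bounds)
  have "(8 * sample n k * ?z) * ?z ^ 2 = 8 * (sample n k * ?z ^ 3)" by (simp add: power2_eq_square power3_eq_cube)
  also have "\<dots> < 8 * (2 * load n k * ?z ^ 2)" using sample_bounds(1) load_bounds(2) by linarith
  also have "\<dots> = (16 * load n k) * ?z ^ 2" by simp
  finally have "8 * sample n k * ?z < 16 * load n k" by simp
  moreover have "8 * sample n k * 160 \<le> 8 * sample n k * ?z" using z by (intro mult_le_mono2)
  ultimately have 1: "16 * sample n k \<le> load n k" by linarith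
  have "high_degree n k ^ ?l * ?z * ?z ^ 2 = ?z ^ (14 * ?l + 3)"
    by (simp add: high_degree_def power_mult power_add power2_eq_square power3_eq_cube)
  also have "\<dots> \<le> ?z ^ (20 * k)" using z base_bounds(3) by (intro power_increasing) auto
  also have "\<dots> \<le> n" using base_power[of k n] base_bounds by simp
  also have "n < 2 * load n k * ?z ^ 2" by (rule load_bounds)
  finally have "high_degree n k ^ ?l * ?z < 2 * load n k" by simp
  moreover have "high_degree n k ^ ?l * 160 \<le> high_degree n k ^ ?l * ?z" using z by (intro mult_le_mono2)
  ultimately have "2 * high_degree n k ^ ?l \<le> load n k" by linarith
  thus ?thesis using 1 by linarith
qed

lemma listed_bound: "mid_degree n k * n \<le> load n k * (high_degree n k - 1)"
proof -
  let ?z = "base n k"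
  have z: "160 \<le> ?z" by (rule base_bounds)
  have "mid_degree n k * n \<le> ?z ^ 11 * (2 * load n k * ?z ^ 2)"
    unfolding mid_degree_def using load_bounds(2) by (intro mult_le_mono2) simp
  also have "\<dots> = load n k * (2 * (?z ^ 11 * ?z ^ 2))" by (simp only: ac_simps)
  also have "?z ^ 11 * ?z ^ 2 = ?z ^ 13" by (simp flip: power_add)
  also have "load n k * (2 * ?z ^ 13) \<le> load n k * (high_degree n k - 1)" unfolding high_degree_def
  proof (rule mult_le_mono2)
  show "2 * ?z ^ 13 \<le> ?z ^ 14 - 1"
  proof -
    have "3 * ?z ^ 13 \<le> ?z * ?z ^ 13" using z by (intro mult_le_mono1) simp
    moreover have "1 \<le> ?z ^ 13" using z by simp
    moreover have "?z * ?z ^ 13 = ?z ^ 14" by (simp flip: power_Suc)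
    ultimately show ?thesis by linarith
  qed
  qed
  finally show ?thesis .
qed

lemma relay_bound: "n * (n * hit_size n k) \<le> load n k * (load n k * (mid_degree n k - 1))"
proof -
  let ?z = "base n k"
  have z: "160 \<le> ?z" by (rule base_bounds)
  have n: "n \<le> 2 * load n k * ?z ^ 2" using load_bounds(2) by simp
  have "n * (n * hit_size n k) \<le> (2 * load n k * ?z ^ 2) * ((2 * load n k * ?z ^ 2) * ?z ^ 6)"
    unfolding hit_size_def by (intro mult_le_mono n order_refl)
  also have "\<dots> = load n k * (load n k * (4 * (?z ^ 2 * (?z ^ 2 * ?z ^ 6))))"
  proof -
    have "(2 * a * b) * ((2 * a * b) * d) = a * (a * (4 * (b * (b * d))))" for a b d :: nat
      by (simp add: algebra_simps)
    thus ?thesis .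
  qed
  also have "?z ^ 2 * (?z ^ 2 * ?z ^ 6) = ?z ^ 10" by (simp flip: power_add)
  also have "load n k * (load n k * (4 * ?z ^ 10)) \<le> load n k * (load n k * (mid_degree n k - 1))"
    unfolding mid_degree_def
  proof (intro mult_le_mono2)
  show "4 * ?z ^ 10 \<le> ?z ^ 11 - 1"
  proof -
    have "5 * ?z ^ 10 \<le> ?z * ?z ^ 10" using z by (intro mult_le_mono1) simp
    moreover have "1 \<le> ?z ^ 10" using z by simp
    moreover have "?z * ?z ^ 10 = ?z ^ 11" by (simp flip: power_Suc)
    ultimately show ?thesis by linarith
  qed
  qed
  finally show ?thesis .
qed

text \<open>\<open>ln n\<close> is \<open>20 * k\<close> times the logarithm of the root, hence at
  most \<open>20 * z ^ 2\<close>, while the right side is at least \<open>z ^ 3 / 2\<close>. What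
  remains is \<open>40 * (c + 4) \<le> z\<close>, which explains \<open>min_base\<close>.\<close>

lemma sample_suffices: "real (c + 4) * ln (real n) \<le> real (sample n k) * real (hit_size n k) / real n"
proof -
  let ?z = "real (base n k)"
  have "real (40 * (c + 4)) \<le> ?z" using base_bounds(4) by (simp only: of_nat_le_iff)
  hence z: "160 \<le> ?z" "real k \<le> ?z" "40 * (real c + 4) \<le> ?z" using base_bounds by simp_all
  have k: "1 \<le> k" using base_bounds by simp
  have r0: "0 < root (20 * k) (real n)" using n1 k by simp
  have "ln (real n) = ln (root (20 * k) (real n) ^ (20 * k))" using k by simp
  also have "\<dots> = 20 * real k * ln (root (20 * k) (real n))" using r0 by (simp add: ln_realpow)
  also have "\<dots> \<le> 20 * ?z * ?z"
  proof (intro mult_mono)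
    have "ln (root (20 * k) (real n)) \<le> root (20 * k) (real n) - 1" using r0 by (rule ln_le_minus_one)
    thus "ln (root (20 * k) (real n)) \<le> ?z" using root_less_base[OF k, of n] by simp
    have "1 \<le> root (20 * k) (real n)" using n1 k by simp
    thus "0 \<le> ln (root (20 * k) (real n))" by simp
  qed (use z in auto)
  finally have "real (c + 4) * ln (real n) \<le> real (c + 4) * (20 * ?z * ?z)" by (intro mult_left_mono) auto
  also have "\<dots> = (40 * (real c + 4)) * (?z * ?z) / 2" by simp
  also have "\<dots> \<le> ?z * (?z * ?z) / 2" using z by (intro divide_right_mono mult_right_mono) auto
  also have "\<dots> \<le> real (sample n k) * real (hit_size n k) / real n"
  proof -
    have "real n \<le> real (2 * sample n k * base n k ^ 3)" using sample_bounds(2) by (simp only: of_nat_le_iff)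
    hence "?z ^ 3 * real n \<le> ?z ^ 3 * (2 * real (sample n k) * ?z ^ 3)" by (intro mult_left_mono) simp_all
    also have "\<dots> = 2 * (real (sample n k) * real (hit_size n k))" by (simp add: hit_size_def power_add[symmetric])
    finally show ?thesis using n1 by (simp add: field_simps power3_eq_cube)
  qed
  finally show ?thesis .
qed

lemma small_params: "sample n k \<le> n" "hit_size n k \<le> n" "2 \<le> n" "hit_size n k \<le> mid_degree n k" "mid_degree n k \<le> high_degree n k" "2 \<le> mid_degree n k" "k \<le> n"
proof -
  let ?z = "base n k"
  have z: "160 \<le> ?z" by (rule base_bounds)
  show "sample n k \<le> n" by (simp add: sample_def)
  have "?z ^ 6 \<le> ?z ^ 60" using z by (intro power_increasing) auto
  thus "hit_size n k \<le> n" using n_ge by (simp add: hit_size_def)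
  have "?z ^ 1 \<le> ?z ^ 60" using z by (intro power_increasing) auto
  hence zn: "?z \<le> n" using n_ge by simp
  thus "2 \<le> n" "k \<le> n" using z base_bounds by auto
  show "hit_size n k \<le> mid_degree n k" "mid_degree n k \<le> high_degree n k" unfolding hit_size_def mid_degree_def high_degree_def using z by (intro power_increasing; simp)+
  have "?z ^ 1 \<le> ?z ^ 11" using z by (intro power_increasing) auto
  thus "2 \<le> mid_degree n k" using z by (simp add: mid_degree_def)
qed

text \<open>There are at most \<open>2 * z\<close> phases, because \<open>k \<le> z\<close>, of at
  most \<open>n / z ^ 2\<close> rounds each.\<close>

lemma duration_bound: "real ((2 * ((k - 1) div 2) + 2) * load n k) \<le> 2 * real n / real (base n k)"
proof -
  let ?z = "base n k"
  have "2 * ((k - 1) div 2) + 2 \<le> 2 * ?z" using base_bounds by linarith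
  hence "(2 * ((k - 1) div 2) + 2) * load n k * ?z \<le> 2 * ?z * load n k * ?z" by (intro mult_le_mono1)
  also have "\<dots> = 2 * (load n k * ?z ^ 2)" by (simp add: power2_eq_square)
  also have "\<dots> \<le> 2 * n" using load_bounds(1) by simp
  finally have "real ((2 * ((k - 1) div 2) + 2) * load n k * ?z) \<le> real (2 * n)" by (simp only: of_nat_le_iff)
  thus ?thesis using base_bounds by (simp add: field_simps)
qed

end

end

section \<open>Round complexity\<close>

context girth_params
begin

text \<open>The base does not increase with \<open>k\<close>, so the bound on the duration of stage
  \<open>g\<close> serves for all earlier stages.\<close>

lemma start_bound:
  assumes g: "act n g" and n1: "1 \<le> n"
  shows "real (sched.start (act n) (load n) (Suc g)) \<le> real g * (2 * real n / real (base n g))"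
proof -
  have zg: "0 < base n g" using base_bounds[OF g n1] by simp
  have "real (sched.start (act n) (load n) (Suc g)) = (\<Sum>k<Suc g. real (sched.duration (act n) (load n) k))"
    by (simp add: sched.start_def)
  also have "\<dots> = (\<Sum>k=3..g. real (sched.duration (act n) (load n) k))"
    by (rule sum.mono_neutral_right) (auto simp: sched.duration_def act_def)
  also have "\<dots> \<le> (\<Sum>k=3..g. 2 * real n / real (base n g))"
  proof (rule sum_mono)
    fix k assume "k \<in> {3..g}"
    hence k: "3 \<le> k" "k \<le> g" by auto
    have a: "act n k" by (rule act_downward[OF g k n1])
    have "real (sched.duration (act n) (load n) k) \<le> 2 * real n / real (base n k)"
      using duration_bound[OF a n1] a by (simp add: sched.duration_def)
    also have "\<dots> \<le> 2 * real n / real (base n g)"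
      using base_antimono[of k g n] k n1 zg by (intro divide_left_mono) auto
    finally show "real (sched.duration (act n) (load n) k) \<le> 2 * real n / real (base n g)" .
  qed
  also have "\<dots> = real (Suc g - 3) * (2 * real n / real (base n g))" by simp
  also have "\<dots> \<le> real g * (2 * real n / real (base n g))" by (intro mult_right_mono) auto
  finally show ?thesis .
qed

lemma start_bound_n:
  assumes g: "act n g" and n1: "1 \<le> n"
  shows "real (sched.start (act n) (load n) (Suc g)) \<le> 2 * real n"
proof -
  note start_bound[OF g n1]
  also have "real g * (2 * real n / real (base n g)) = (real g / real (base n g)) * (2 * real n)" by simp
  also have "\<dots> \<le> 1 * (2 * real n)" using base_bounds[OF g n1] by (intro mult_right_mono) auto
  finally show ?thesis by simp
qed

lemma bfs_start_bound:
  assumes n1: "1 \<le> n" shows "sched.bfs_start n (act n) (load n) \<le> 2 * n"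
proof (cases "\<exists>k. act n k")
  case False
  thus ?thesis by (simp add: sched.bfs_start_def sched.start_def sched.duration_def)
next
  case True
  have fin: "finite {k. act n k}" by (rule finite_subset[of _ "{..n}"]) (use small_params(7) n1 in auto)
  define K where "K = Max {k. act n k}"
  have K: "act n K" using Max_in[OF fin] True by (auto simp: K_def)
  have "\<not> act n k" if "K < k" for k using Max_ge[OF fin, of k] that by (auto simp: K_def)
  moreover have "K \<le> n" using small_params(7)[OF K n1] .
  ultimately have "sched.bfs_start n (act n) (load n) = sched.start (act n) (load n) (Suc K)"
    unfolding sched.bfs_start_def sched.start_def
    by (intro sum.mono_neutral_right) (auto simp: sched.duration_def)
  thus ?thesis using start_bound_n[OF K n1] by linarith
qed

definition theta :: "nat \<Rightarrow> real" where "theta g = 20 * real g"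
text \<open>The 6 covers \<open>2 * n\<close> rounds of stages, \<open>2 * n\<close> rounds of the
  final phase and \<open>n + 1\<close> rounds of waiting; \<open>min_base\<close> is the loss in
  \<open>rounds_ge\<close>.\<close>

definition factor :: real where "factor = 6 * real min_base"

lemma theta: "linear_order_of_growth theta"
  unfolding linear_order_of_growth_def theta_def by auto

lemma factor: "6 * 160 \<le> factor" by (simp add: factor_def min_base_def)

text \<open>Rounding the root costs at most a factor of 2, and the \<open>20 * g\<close>-th root of
  \<open>n\<close> is \<open>n\<close> to the power \<open>1 / theta g\<close>.\<close>

lemma time_stage:
  assumes g: "act n g" and n1: "1 \<le> n"
  shows "sched.start (act n) (load n) (Suc g) \<le> nat \<lfloor>factor * girth_rounds theta n (enat g)\<rfloor>"
proof -
  let ?s = "real (sched.start (act n) (load n) (Suc g))"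
  have z: "160 \<le> base n g" "3 \<le> g" using base_bounds[OF g n1] by auto
  let ?r = "root (20 * g) (real n)"
  have g1: "1 \<le> g" using z by simp
  have r: "?r \<le> 2 * real (base n g)" "0 < ?r" using root_less_base[OF g1, of n] z n1 g1 by auto
  have "?s \<le> real g * (2 * real n / real (base n g))" by (rule start_bound[OF g n1])
  also have "\<dots> \<le> real g * (4 * (real n / ?r))"
  proof (rule mult_left_mono)
    have "2 * real n * ?r \<le> 2 * real n * (2 * real (base n g))" using r by (intro mult_left_mono) auto
    thus "2 * real n / real (base n g) \<le> 4 * (real n / ?r)" using r z by (simp add: field_simps)
  qed simp
  also have "\<dots> = 4 * (real g * real n powr (1 - 1 / theta g))"
    using root_powr[OF g1 n1] by (simp add: theta_def)
  also have "\<dots> \<le> factor * (real g * real n powr (1 - 1 / theta g))" using factor by (intro mult_right_mono) auto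
  finally have 1: "?s \<le> factor * (real g * real n powr (1 - 1 / theta g))" .
  have "?s \<le> 2 * real n" by (rule start_bound_n[OF g n1])
  also have "\<dots> \<le> factor * real n" using factor by (intro mult_right_mono) auto
  finally have "?s \<le> factor * min (real g * real n powr (1 - 1 / theta g)) (real n)" using 1 by (simp add: min_def)
  thus ?thesis by (simp add: girth_rounds_def le_nat_floor)
qed

text \<open>If stage \<open>g\<close> is not run, the root is at most \<open>g * min_base\<close>.
  So the allowed number of rounds is already linear in \<open>n\<close> and pays for the final
  phase.\<close>

lemma rounds_ge:
  assumes "\<not> act n g" "3 \<le> g" "1 \<le> n"
  shows "6 * real n \<le> factor * girth_rounds theta n (enat g)"
proof -
  let ?r = "root (20 * g) (real n)"
  have g1: "1 \<le> g" using assms by simp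
  have min_base: "1 \<le> min_base" by (simp add: min_base_def)
  have "base n g + 1 \<le> max g min_base" using assms by (auto simp: act_def)
  also have "max g min_base \<le> g * min_base" using g1 min_base by (simp add: max_def)
  finally have "real (base n g + 1) \<le> real (g * min_base)" by (simp only: of_nat_le_iff)
  hence r: "?r \<le> real g * real min_base" "0 < ?r" using root_less_base[OF g1, of n] assms g1 by auto
  hence "real n * ?r \<le> real n * (real g * real min_base)" by (intro mult_left_mono) auto
  hence "real n \<le> real min_base * (real g * (real n / ?r))" using r by (simp add: field_simps)
  also have "real n / ?r = real n powr (1 - 1 / theta g)" using root_powr[OF g1 assms(3)] by (simp add: theta_def)
  finally have "real n \<le> real min_base * (real g * real n powr (1 - 1 / theta g))" .
  moreover have "1 * real n \<le> real min_base * real n" using min_base by (intro mult_right_mono) auto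
  ultimately show ?thesis by (simp add: girth_rounds_def factor_def min_def)
qed

lemma rounds_inf: "6 * real n \<le> factor * girth_rounds theta n \<infinity>"
  using factor by (simp add: girth_rounds_def mult_right_mono)

section \<open>Encoding the tokens in logarithmically many bits\<close>

definition id_bound :: "nat \<Rightarrow> nat \<Rightarrow> nat" where "id_bound a n = n ^ a + 2 * n"
definition width :: "nat \<Rightarrow> nat \<Rightarrow> nat" where "width a n = 9 + 3 * (a + 1) * nat \<lceil>log 2 (real n)\<rceil>"

lemma width_O: "(\<lambda>n. real (width a n)) \<in> O(\<lambda>n. ln (real n))"
proof (rule bigoI[where c = "9 + 9 * (real a + 1)"])
  have "real (width a n) \<le> (9 + 9 * (real a + 1)) * ln (real n)" if n: "3 \<le> n" for n
  proof -
    have "exp 1 \<le> real n" using exp_le n by linarith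
    hence ln1: "1 \<le> ln (real n)" using n by (subst ln_ge_iff) auto
    have "1 / 2 \<le> ln (2::real)" using ln2_ge_two_thirds by simp
    hence "ln (real n) * (1 / 2) \<le> ln (real n) * ln 2" using ln1 by (intro mult_left_mono) auto
    hence "log 2 (real n) \<le> 2 * ln (real n)" by (simp add: log_def field_simps)
    moreover have "real (nat \<lceil>log 2 (real n)\<rceil>) \<le> log 2 (real n) + 1"
    proof -
      have "0 \<le> log 2 (real n)" using n by simp
      thus ?thesis by linarith
    qed
    ultimately have "real (nat \<lceil>log 2 (real n)\<rceil>) \<le> 3 * ln (real n)" using ln1 by linarith
    hence "3 * (real a + 1) * real (nat \<lceil>log 2 (real n)\<rceil>) \<le> 3 * (real a + 1) * (3 * ln (real n))"
      by (intro mult_left_mono) auto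
    moreover have "real (width a n) = 9 + 3 * (real a + 1) * real (nat \<lceil>log 2 (real n)\<rceil>)" by (simp add: width_def)
    moreover have "(9 + 9 * (real a + 1)) * ln (real n) = 9 * ln (real n) + 3 * (real a + 1) * (3 * ln (real n))"
      by (simp add: algebra_simps)
    ultimately show ?thesis using ln1 by linarith
  qed
  moreover have "0 \<le> ln (real n)" if "3 \<le> n" for n using that by simp
  ultimately show "\<forall>\<^sub>F n in sequentially. norm (real (width a n)) \<le> (9 + 9 * (real a + 1)) * norm (ln (real n))"
    by (intro eventually_sequentiallyI[of 3]) simp
qed

lemma tokens_width:
  assumes "1 \<le> n" shows "card (tokens (id_bound a n)) \<le> 2 ^ width a n"
proof -
  define L where "L = nat \<lceil>log 2 (real n)\<rceil>"
  have "real n = 2 powr log 2 (real n)" using assms by simp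
  also have "\<dots> \<le> 2 powr real L" unfolding L_def by (intro powr_mono) (auto simp: real_nat_ceiling_ge)
  also have "\<dots> = 2 ^ L" by (simp add: powr_realpow)
  finally have "real n \<le> real (2 ^ L)" by simp
  hence nL: "n \<le> 2 ^ L" by (simp only: of_nat_le_iff)
  have na: "1 \<le> n ^ a" "1 \<le> n" using assms by auto
  have "1 * 1 \<le> n ^ a * n" "n ^ a * 1 \<le> n ^ a * n" "1 * n \<le> n ^ a * n"
    using na by (intro mult_le_mono; simp)+
  hence "id_bound a n + 1 \<le> 4 * (n ^ a * n)" unfolding id_bound_def by linarith
  hence "(id_bound a n + 1) ^ 3 \<le> (4 * (n ^ a * n)) ^ 3" by (rule power_mono) simp
  also have "\<dots> = 64 * n ^ (3 * (a + 1))" by (simp add: power_mult_distrib power_mult[symmetric] power_add[symmetric] algebra_simps)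
  also have "\<dots> \<le> 64 * (2 ^ L) ^ (3 * (a + 1))" by (intro mult_le_mono2 power_mono nL) simp
  \<comment> \<open>The constant 9 in \<open>width\<close> comes from
    \<open>7 * 64 \<le> 2 ^ 9\<close>.\<close>
  finally have "7 * (id_bound a n + 1) ^ 3 \<le> 2 ^ 9 * (2 ^ L) ^ (3 * (a + 1))" by simp
  also have "\<dots> = 2 ^ width a n" by (simp add: width_def L_def power_add power_mult[symmetric] algebra_simps)
  finally show ?thesis using tokens_card(2)[of "id_bound a n"] by linarith
qed

text \<open>Strings of one fixed positive length leave the empty string to silence.\<close>

lemma encoding:
  assumes "1 \<le> n"
  shows "\<exists>f :: token \<Rightarrow> message. inj_on f (tokens (id_bound a n)) \<and> (\<forall>w\<in>tokens (id_bound a n). f w \<noteq> [] \<and> length (f w) \<le> width a n)"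
proof -
  let ?B = "{bs :: bool list. set bs \<subseteq> UNIV \<and> length bs = width a n}"
  have "card ?B = card (UNIV :: bool set) ^ width a n" by (rule card_lists_length_eq) simp
  hence "card (tokens (id_bound a n)) \<le> card ?B" using tokens_width[OF assms] by simp
  moreover have "finite ?B" by (rule finite_lists_length_eq) simp
  ultimately obtain f where f: "f ` tokens (id_bound a n) \<subseteq> ?B" "inj_on f (tokens (id_bound a n))"
    using card_le_inj[OF tokens_card(1)] by metis
  have "0 < width a n" by (simp add: width_def)
  hence B: "bs \<noteq> [] \<and> length bs \<le> width a n" if "bs \<in> ?B" for bs using that by auto
  have "f w \<noteq> [] \<and> length (f w) \<le> width a n" if "w \<in> tokens (id_bound a n)" for w
    by (rule B) (use f(1) that in blast)
  thus ?thesis using f(2) by blast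
qed

text \<open>Acyclic graphs and girths whose stage is not run are left to the final phase, which
  never errs; only a stage that is run depends on the sample.\<close>

lemma success:
  fixes V E a n enc
  defines "A \<equiv> prog n (width a n)
      (sched.out n (id_bound a n) (act n) (load n) (sample n) (mid_degree n) (high_degree n) enc)
      (sched.res n (id_bound a n) (act n) (load n) enc)"
  assumes graph: "simple_graph V E" and cV: "card V = n" and n1: "1 \<le> n" and Va: "V \<subseteq> {..<n ^ a}"
    and enc: "inj_on enc (tokens (id_bound a n))"
      "\<And>w. w \<in> tokens (id_bound a n) \<Longrightarrow> enc w \<noteq> [] \<and> length (enc w) \<le> width a n"
  shows "1 - 1 / real n ^ c \<le> measure_pmf.prob (execution A V E (nat \<lfloor>factor * girth_rounds theta n (girth E)\<rfloor>))
    {\<sigma>s. first_halting_outputs A V \<sigma>s (girth E)}"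
proof -
  let ?m = "id_bound a n"
  have n_m: "V \<subseteq> {..<?m}" "2 * n \<le> ?m" using Va by (auto simp: id_bound_def)
  have act_bounds: "3 \<le> k \<and> k \<le> n" "0 < load n k" if "act n k" for k
    using small_params(7)[OF that n1] load_bounds(3)[OF that n1] that by (auto simp: act_def)
  interpret pr: prog_run V E n "width a n" "sched.out n ?m (act n) (load n) (sample n) (mid_degree n) (high_degree n) enc"
    "sched.res n ?m (act n) (load n) enc"
    by unfold_locales (use graph n1 in auto)
  interpret run: sched_run n ?m "act n" "load n" "sample n" "mid_degree n" "high_degree n" enc V E "width a n" r for r
    by unfold_locales (use act_bounds cV n_m enc in auto)
  have bfs: "sched.bfs_end n (act n) (load n) \<le> 4 * n"
    using bfs_start_bound[OF n1] by (simp add: run.bfs_end_def)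
  define T where "T = nat \<lfloor>factor * girth_rounds theta n (girth E)\<rfloor>"
  have concl: "1 - 1 / real n ^ c \<le> measure_pmf.prob (execution A V E T)
      {\<sigma>s. first_halting_outputs A V \<sigma>s (girth E)}"
    if good: "1 - 1 / real n ^ c \<le> pr.prob_r {r. good r}" and t: "t \<le> T"
      and out: "\<And>r. good r \<Longrightarrow> run.outputs_at r t (girth E)" for good t
    unfolding A_def
  proof (rule pr.prob_first_halting)
    show "1 - 1 / real n ^ c \<le> measure_pmf.prob (initial_config pr.P V E) {\<sigma>. good (pr.random \<sigma>)}"
      using good by (simp add: pr.prob_r_def)
    fix r assume "good r"
    thus "\<exists>t\<le>T. (\<forall>s<t. \<forall>v\<in>V. run.res (pr.view r s v) = None) \<and> (\<exists>v\<in>V. run.res (pr.view r t v) \<noteq> None) \<and>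
        (\<forall>v\<in>V. run.res (pr.view r t v) \<noteq> None \<longrightarrow> run.res (pr.view r t v) = Some (girth E))"
      using out[of r] t unfolding run.outputs_at_def by blast
  qed
  have all: "1 - 1 / real n ^ c \<le> pr.prob_r {r. True}" by (simp add: pr.prob_r_def)
  show ?thesis unfolding T_def[symmetric]
  proof (cases "girth E")
    case infinity
    have "6 * real n \<le> factor * girth_rounds theta n (girth E)" using rounds_inf infinity by simp
    hence "6 * n \<le> T" unfolding T_def by (simp add: le_nat_floor)
    hence "sched.bfs_end n (act n) (load n) + n + 1 \<le> T" using bfs n1 by linarith
    thus "1 - 1 / real n ^ c \<le> measure_pmf.prob (execution A V E T) {\<sigma>s. first_halting_outputs A V \<sigma>s (girth E)}"
      using run.outputs_acyclic infinity by (intro concl[OF all]) auto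
  next
    case (enat g)
    obtain p where "is_cycle E p" "length p = g" by (rule girth_cycle[OF enat])
    hence g3: "3 \<le> g" by (auto simp: is_cycle_def)
    show "1 - 1 / real n ^ c \<le> measure_pmf.prob (execution A V E T) {\<sigma>s. first_halting_outputs A V \<sigma>s (girth E)}"
    proof (cases "act n g")
      case False
      have "6 * real n \<le> factor * girth_rounds theta n (girth E)" using rounds_ge[OF False g3 n1] enat by simp
      hence "6 * n \<le> T" unfolding T_def by (simp add: le_nat_floor)
      hence t: "sched.bfs_end n (act n) (load n) + g \<le> T" using bfs run.girth_le_n[OF enat] by linarith
      have "k < g" if "act n k" for k
        using act_downward[OF that g3 _ n1] False by (meson not_le)
      thus ?thesis using run.outputs_bfs[OF enat] enat by (intro concl[OF all t]) auto
    next
      case act: True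
      let ?l = "(g - 1) div 2" and ?N = "neighbours E"
      \<comment> \<open>These sets and the family \<open>F\<close> depend on the graph but not on
        the random numbers, so a union bound over them is possible.\<close>
      define S where "S v x w = {u \<in> ?N v. \<exists>p. rwalk E (x # p) \<and> length p = ?l \<and> last p = u} - {w}" for v x w
      define F where "F = {A \<in> (\<lambda>(v, x, w). S v x w) ` (V \<times> V \<times> V) \<union> ?N ` V. hit_size n g \<le> card A}"
      define good where "good r \<longleftrightarrow> card (pr.sampled (sample n g) r) \<le> 8 * sample n g \<and>
        (\<forall>A\<in>F. pr.sampled (sample n g) r \<inter> A \<noteq> {})" for r
      have NV: "?N v \<subseteq> V" for v using pr.edge_V by (auto simp: pr.N_iff)
      have finF: "finite F" unfolding F_def using pr.finV by simp
      have "card F \<le> card ((\<lambda>(v, x, w). S v x w) ` (V \<times> V \<times> V) \<union> ?N ` V)"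
        unfolding F_def by (rule card_mono) (use pr.finV in auto)
      also have "\<dots> \<le> card ((\<lambda>(v, x, w). S v x w) ` (V \<times> V \<times> V)) + card (?N ` V)" by (rule card_Un_le)
      also have "\<dots> \<le> card (V \<times> V \<times> V) + card V" by (intro add_mono card_image_le) (use pr.finV in auto)
      also have "\<dots> = n ^ 3 + n" using cV by (simp add: card_cartesian_product power3_eq_cube)
      finally have cF: "card F \<le> n ^ 3 + n" .
      have FV: "A \<subseteq> V \<and> hit_size n g \<le> card A" if "A \<in> F" for A
        using that NV by (auto simp: F_def S_def)
      note sp = small_params[OF act n1]
      have prob: "1 - 1 / real n ^ c \<le> pr.prob_r {r. good r}"
        unfolding good_def
        by (rule pr.prob_r_hitting[OF cV sp(3,1,2) finF cF FV sample_suffices[OF act n1]])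
      have "run.outputs_at r (sched.start (act n) (load n) (Suc g)) (enat g)" if r: "good r" for r
      proof (rule run.outputs_stage[OF enat act])
        have X: "{v \<in> V. r v < sample n g} = pr.sampled (sample n g) r" by (simp add: pr.sampled_def)
        have hit: "\<exists>w\<in>{v \<in> V. r v < sample n g}. w \<in> A" if "A \<in> F" for A
          using r that unfolding X good_def by blast
        show "stage_girth V E {v \<in> V. r v < sample n g} ?l (mid_degree n g) (high_degree n g) (load n g) (run.got r g) g (hit_size n g)"
        proof (rule stage_girth.intro[OF run.stage[OF act]], unfold_locales)
          show "girth E = enat g" by (rule enat)
          show "2 * ?l + 1 \<le> g" "g \<le> 2 * ?l + 2" using g3 by linarith+
          show "{v \<in> V. r v < sample n g} \<subseteq> V" by blast
          show "hit_size n g \<le> mid_degree n g" "mid_degree n g \<le> high_degree n g" "2 \<le> mid_degree n g" using sp by auto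
          show "card {v \<in> V. r v < sample n g} + high_degree n g ^ ?l \<le> load n g"
            using r tokens_fit[OF act n1] unfolding X good_def by linarith
          show "mid_degree n g * card V \<le> load n g * (high_degree n g - 1)" using listed_bound[OF act n1] cV by simp
          show "card V * (card V * hit_size n g) \<le> load n g * (load n g * (mid_degree n g - 1))"
            using relay_bound[OF act n1] cV by simp
          show "\<exists>w\<in>{v \<in> V. r v < sample n g}. w \<in> {w \<in> ?N v. \<exists>p. rwalk E (x # p) \<and> length p = ?l \<and> last p = w} - {w0}"
            if "v \<in> V" "x \<in> V" "w0 \<in> V"
              "hit_size n g \<le> card ({w \<in> ?N v. \<exists>p. rwalk E (x # p) \<and> length p = ?l \<and> last p = w} - {w0})" for v x w0
            unfolding S_def[symmetric]
          proof (rule hit)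
            show "S v x w0 \<in> F" using that unfolding F_def S_def[symmetric] by blast
          qed
          show "?N v \<inter> {v \<in> V. r v < sample n g} \<noteq> {}" if "v \<in> V" "hit_size n g \<le> card (?N v)" for v
            using hit[of "?N v"] that unfolding F_def by blast
        qed
      qed
      moreover have "sched.start (act n) (load n) (Suc g) \<le> T"
        using time_stage[OF act n1] by (simp add: T_def enat)
      ultimately show ?thesis using enat by (intro concl[OF prob]) auto
    qed
  qed
qed

end

theorem theorem6:
  fixes a c :: nat
  shows "\<exists>(A :: nat \<Rightarrow> nat program) (\<theta> :: nat \<Rightarrow> real) (C :: real).
    congest_algorithm A \<and> linear_order_of_growth \<theta> \<and> C > 0 \<and>
    (\<forall>(n :: nat) V E.
       simple_graph V E \<and> card V = n \<and> n \<ge> 1 \<and> V \<subseteq> {..<n ^ a} \<longrightarrow>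
       measure_pmf.prob
         (execution (A n) V E (nat \<lfloor>C * girth_rounds \<theta> n (girth E)\<rfloor>))
         {\<sigma>s. first_halting_outputs (A n) V \<sigma>s (girth E)}
       \<ge> 1 - 1 / real n ^ c)"
proof -
  interpret girth_params c .
  have "\<forall>n. \<exists>f :: token \<Rightarrow> message. 1 \<le> n \<longrightarrow> inj_on f (tokens (id_bound a n)) \<and>
      (\<forall>w\<in>tokens (id_bound a n). f w \<noteq> [] \<and> length (f w) \<le> width a n)"
    using encoding by blast
  \<comment> \<open>The encoding is fixed for each \<open>n\<close> before any graph is given, so it
    can be part of the algorithm.\<close>
  from choice[OF this] obtain enc :: "nat \<Rightarrow> token \<Rightarrow> message" where enc: "\<forall>n. 1 \<le> n \<longrightarrow> inj_on (enc n) (tokens (id_bound a n)) \<and>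
      (\<forall>w\<in>tokens (id_bound a n). enc n w \<noteq> [] \<and> length (enc n w) \<le> width a n)" by blast
  define A where "A n = prog n (width a n)
      (sched.out n (id_bound a n) (act n) (load n) (sample n) (mid_degree n) (high_degree n) (enc n))
      (sched.res n (id_bound a n) (act n) (load n) (enc n))" for n
  have "has_bandwidth A (width a)" by (simp add: has_bandwidth_def A_def prog_def)
  hence "congest_algorithm A" using width_O unfolding congest_algorithm_def by blast
  moreover have "0 < factor" using factor by linarith
  moreover have "1 - 1 / real n ^ c \<le> measure_pmf.prob
      (execution (A n) V E (nat \<lfloor>factor * girth_rounds theta n (girth E)\<rfloor>))
      {\<sigma>s. first_halting_outputs (A n) V \<sigma>s (girth E)}"
    if "simple_graph V E" "card V = n" "1 \<le> n" "V \<subseteq> {..<n ^ a}" for n V E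
    unfolding A_def by (rule success[OF that]) (use enc that(3) in blast)+
  ultimately show ?thesis using theta by blast
qed

end
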